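(* Let $\Bbbk$ be a field, let $A$ be a $\Bbbk$-algebra with zero multiplication ($A^2=0$), let $X$ be a linear basis of $A$, and let $\le$ be a well order on $X$, extended to the monomial order on $X^{**}$ described in the context. Then the following polynomials form a Gröbner--Shirshov basis of the universal enveloping pre-commutative algebra $U_{(+)}(A)$: (R1) $f_{abc}=a(bc)-(ab)c-(ba)c$, for $a,b,c\in X^{**}$; (R2) $g_{xy}=xy+yx$, for $x,y\in X$, $x<y$; (R2$'$) $u_x=xx$, for $x\in X$; (R3) $t_{axy}=(ax)y+(ay)x$, for $x,y\in X$, $x<y$, and $a\in X^{**}$ of even length; (R3$'$) $t_{axx}=(ax)x$, for $x\in X$ and $a\in X^{**}$ of even length. That is, the set $S$ of these polynomials is a Gröbner--Shirshov basis in $M\langle X\rangle$, and $M\langle X\rangle/I(S)\cong U_{(+)}(A)$ via the map sending each $x\in X$ to its canonical image in $U_{(+)}(A)$, where $I(S)$ is the ideal generated by $S$.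
   Context: A pre-commutative (Zinbiel) algebra is a linear space $Z$ with a bilinear product satisfying $a(bc)=(ab)c+(ba)c$. $Z^{(+)}$ is the same space with the associative commutative product $a*b=ab+ba$. For an associative commutative algebra $A$, the universal enveloping pre-commutative algebra $U_{(+)}(A)$ is the Zinbiel algebra with a homomorphism $i:A\to U_{(+)}(A)^{(+)}$ such that every homomorphism $\varphi:A\to Z^{(+)}$, $Z$ Zinbiel, factors as $\varphi=\psi\circ i$ for a unique homomorphism of Zinbiel algebras $\psi:U_{(+)}(A)\to Z$. $M\langle X\rangle$ is the free non-associative $\Bbbk$-algebra (no unit) generated by $X$; its linear basis is the set $X^{**}$ of all non-empty non-associative words in $X$. $|u|$ is the length of $u$. Order on $X^{**}$: put $\mathrm{wt}(x)=(1,x)$ for $x\in X$ and $\mathrm{wt}(u)=(|u|,u_2,u_1)$ for $u=(u_1u_2)$; then $u\le v$ iff $\mathrm{wt}(u)\le\mathrm{wt}(v)$ lexicographically (recursively in length). Thus shorter words are smaller, words of length 1 are compared as in $X$, and for equal length $>1$ one compares first the right factors, then the left factors. This is a monomial order. For $0\ne f\in M\langle X\rangle$, $\bar f$ is its largest monomial; $f$ is monic if the coefficient of $\bar f$ is 1. Let $\star\notin X$ be a new letter; below, $u\in(X\cup\{\star\})^{**}$ denotes a word with exactly one occurrence of $\star$, and $u|_{\star=g}$ is the result of substituting $g$ for $\star$. For monic $f,g$ with $\bar f=u|_{\star=\bar g}$, the composition is $(f,g)_u=f-u|_{\star=g}$. For a set $S$ of monic polynomials and $w\in X^{**}$, $h$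 is trivial modulo $(S,w)$ if $h=\sum_i\alpha_iu_i|_{\star=s_i}$ (finite sum) with $\alpha_i\in\Bbbk$, $s_i\in S$, $u_i|_{\star=\bar s_i}<w$. $S$ is a Gröbner--Shirshov basis if for all $f,g\in S$ every existing composition $(f,g)_u$ is trivial modulo $(S,\bar f)$.
   Formalization: The isomorphism of M⟨X⟩/I(S) with U_(+)(A) is stated only for fields of characteristic different from 2, since in characteristic 2 it fails for every nonzero A (xx is nonzero in U_(+)(A)); the Gröbner–Shirshov basis claim is stated for every field. *)

theory Defs
  imports "Jordan_Normal_Form.VS_Connect" "HOL-Algebra.QuotRing" "HOL-Library.Poly_Mapping"
begin

section \<open>Algebras over a field\<close>

text \<open>Algebras are records of type \<^typ>\<open>('k, 'v) module\<close>; the product is the field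
  \<^const>\<open>mult\<close>, and the field \<^const>\<open>one\<close> of the record is never used: algebras need
  not have a unit.\<close>

locale nonassoc_algebra = vectorspace K V for K and V (structure) +
  assumes prod_closed: "\<lbrakk>a \<in> carrier V; b \<in> carrier V\<rbrakk> \<Longrightarrow> a \<otimes> b \<in> carrier V"
    and prod_add_left: "\<lbrakk>a \<in> carrier V; b \<in> carrier V; c \<in> carrier V\<rbrakk>
      \<Longrightarrow> (a \<oplus> b) \<otimes> c = (a \<otimes> c) \<oplus> (b \<otimes> c)"
    and prod_add_right: "\<lbrakk>a \<in> carrier V; b \<in> carrier V; c \<in> carrier V\<rbrakk>
      \<Longrightarrow> a \<otimes> (b \<oplus> c) = (a \<otimes> b) \<oplus> (a \<otimes> c)"
    and prod_smult_left: "\<lbrakk>\<alpha> \<in> carrier K; a \<in> carrier V; b \<in> carrier V\<rbrakk>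
      \<Longrightarrow> (\<alpha> \<odot>\<^bsub>V\<^esub> a) \<otimes> b = \<alpha> \<odot>\<^bsub>V\<^esub> (a \<otimes> b)"
    and prod_smult_right: "\<lbrakk>\<alpha> \<in> carrier K; a \<in> carrier V; b \<in> carrier V\<rbrakk>
      \<Longrightarrow> a \<otimes> (\<alpha> \<odot>\<^bsub>V\<^esub> b) = \<alpha> \<odot>\<^bsub>V\<^esub> (a \<otimes> b)"

locale zinbiel_algebra = nonassoc_algebra K V for K and V (structure) +
  assumes zinbiel: "\<lbrakk>a \<in> carrier V; b \<in> carrier V; c \<in> carrier V\<rbrakk>
      \<Longrightarrow> a \<otimes> (b \<otimes> c) = ((a \<otimes> b) \<otimes> c) \<oplus> ((b \<otimes> a) \<otimes> c)"

definition plus_algebra :: "('k, 'v) module \<Rightarrow> ('k, 'v) module" where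
  "plus_algebra Z = Z\<lparr>mult := \<lambda>a b. (a \<otimes>\<^bsub>Z\<^esub> b) \<oplus>\<^bsub>Z\<^esub> (b \<otimes>\<^bsub>Z\<^esub> a)\<rparr>"

definition alg_hom :: "'k ring \<Rightarrow> ('k, 'a) module \<Rightarrow> ('k, 'b) module \<Rightarrow> ('a \<Rightarrow> 'b) set" where
  "alg_hom K A B = {f \<in> LinearCombinations.module_hom K A B.
     \<forall>x\<in>carrier A. \<forall>y\<in>carrier A. f (x \<otimes>\<^bsub>A\<^esub> y) = f x \<otimes>\<^bsub>B\<^esub> f y}"

text \<open>\<open>(U, i)\<close> is a universal enveloping pre-commutative algebra of \<open>A\<close>, tested against all
  Zinbiel algebras \<open>Z\<close> whose carrier is a set of elements of the type \<open>'z\<close>. HOL cannot quantify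
  over types inside a formula; a theorem about arbitrary \<open>'z\<close> covers all \<open>Z\<close>.
  Homomorphisms are made unique as HOL functions by requiring them to be extensional.\<close>

definition univ_envelope ::
  "'z itself \<Rightarrow> 'k ring \<Rightarrow> ('k, 'a) module \<Rightarrow> ('k, 'u) module \<Rightarrow> ('a \<Rightarrow> 'u) \<Rightarrow> bool" where
  "univ_envelope _ K A U i \<longleftrightarrow>
     zinbiel_algebra K U \<and> i \<in> alg_hom K A (plus_algebra U) \<and>
     (\<forall>(Z :: ('k, 'z) module) \<phi>.
        zinbiel_algebra K Z \<and> \<phi> \<in> alg_hom K A (plus_algebra Z) \<longrightarrow>
        (\<exists>!\<psi>. \<psi> \<in> alg_hom K U Z \<inter> extensional (carrier U) \<and>
              (\<forall>a\<in>carrier A. \<phi> a = \<psi> (i a))))"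

definition alg_ideal :: "'k ring \<Rightarrow> 'v set \<Rightarrow> ('k, 'v) module \<Rightarrow> bool" where
  "alg_ideal K I M \<longleftrightarrow> VectorSpace.subspace K I M \<and>
     (\<forall>a\<in>carrier M. \<forall>x\<in>I. a \<otimes>\<^bsub>M\<^esub> x \<in> I \<and> x \<otimes>\<^bsub>M\<^esub> a \<in> I)"

definition alg_genideal :: "'k ring \<Rightarrow> ('k, 'v) module \<Rightarrow> 'v set \<Rightarrow> 'v set" where
  "alg_genideal K M S = \<Inter>{I. alg_ideal K I M \<and> S \<subseteq> I}"

text \<open>The library's \<^term>\<open>M Quot I\<close> together with the induced scalar multiplication.\<close>

definition alg_quot :: "('k, 'v) module \<Rightarrow> 'v set \<Rightarrow> ('k, 'v set) module" where
  "alg_quot M I = \<lparr>carrier = carrier (M Quot I), mult = mult (M Quot I), one = one (M Quot I),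
     zero = zero (M Quot I), add = add (M Quot I),
     smult = (\<lambda>\<alpha> C. \<Union>x\<in>C. I +>\<^bsub>M\<^esub> (\<alpha> \<odot>\<^bsub>M\<^esub> x))\<rparr>"


section \<open>Non-associative words and the free algebra\<close>

datatype 'x nword = Letter 'x | App "'x nword" "'x nword"  (infixl \<open>\<diamondop>\<close> 70)

definition nwords :: "'x set \<Rightarrow> 'x nword set" where
  "nwords X = {w. set_nword w \<subseteq> X}"

primrec wlen :: "'x nword \<Rightarrow> nat" where
  "wlen (Letter x) = 1"
| "wlen (u \<diamondop> v) = wlen u + wlen v"

text \<open>\<open>r\<close> is the (reflexive) order on the letters.\<close>

fun word_le :: "'x rel \<Rightarrow> 'x nword \<Rightarrow> 'x nword \<Rightarrow> bool" where
  "word_le r (Letter x) (Letter y) \<longleftrightarrow> (x, y) \<in> r"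
| "word_le r (Letter x) (v1 \<diamondop> v2) \<longleftrightarrow> True"
| "word_le r (u1 \<diamondop> u2) (Letter y) \<longleftrightarrow> False"
| "word_le r (u1 \<diamondop> u2) (v1 \<diamondop> v2) \<longleftrightarrow>
     wlen (u1 \<diamondop> u2) < wlen (v1 \<diamondop> v2) \<or>
     wlen (u1 \<diamondop> u2) = wlen (v1 \<diamondop> v2) \<and>
       (u2 \<noteq> v2 \<and> word_le r u2 v2 \<or> u2 = v2 \<and> word_le r u1 v1)"

definition word_less :: "'x rel \<Rightarrow> 'x nword \<Rightarrow> 'x nword \<Rightarrow> bool" where
  "word_less r u v \<longleftrightarrow> word_le r u v \<and> u \<noteq> v"

abbreviation wmon :: "'x nword \<Rightarrow> 'x nword \<Rightarrow>\<^sub>0 'k::field" where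
  "wmon w \<equiv> Poly_Mapping.single w 1"

definition poly_smult :: "'k \<Rightarrow> ('x nword \<Rightarrow>\<^sub>0 'k) \<Rightarrow> ('x nword \<Rightarrow>\<^sub>0 'k::field)" where
  "poly_smult \<alpha> f = Poly_Mapping.map ((*) \<alpha>) f"

definition poly_mult ::
  "('x nword \<Rightarrow>\<^sub>0 'k) \<Rightarrow> ('x nword \<Rightarrow>\<^sub>0 'k) \<Rightarrow> ('x nword \<Rightarrow>\<^sub>0 'k::field)" where
  "poly_mult f g = (\<Sum>u\<in>Poly_Mapping.keys f. \<Sum>v\<in>Poly_Mapping.keys g.
     Poly_Mapping.single (u \<diamondop> v) (Poly_Mapping.lookup f u * Poly_Mapping.lookup g v))"

definition free_alg :: "'x set \<Rightarrow> ('k::field, 'x nword \<Rightarrow>\<^sub>0 'k) module" where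
  "free_alg X = \<lparr>carrier = {f. Poly_Mapping.keys f \<subseteq> nwords X}, mult = poly_mult,
     one = undefined, zero = 0, add = (+), smult = poly_smult\<rparr>"


section \<open>Groebner--Shirshov bases\<close>

text \<open>A word with exactly one occurrence of the extra letter \<open>\<star>\<close> is represented as a one-hole
  context, the hole being the place of \<open>\<star>\<close>.\<close>

datatype 'x ctx = Hole | AppL "'x ctx" "'x nword" | AppR "'x nword" "'x ctx"

definition ctxs :: "'x set \<Rightarrow> 'x ctx set" where
  "ctxs X = {u. set_ctx u \<subseteq> X}"

primrec word_subst :: "'x ctx \<Rightarrow> 'x nword \<Rightarrow> 'x nword" where
  "word_subst Hole w = w"
| "word_subst (AppL u v) w = word_subst u w \<diamondop> v"
| "word_subst (AppR v u) w = v \<diamondop> word_subst u w"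

primrec poly_subst :: "'x ctx \<Rightarrow> ('x nword \<Rightarrow>\<^sub>0 'k) \<Rightarrow> ('x nword \<Rightarrow>\<^sub>0 'k::field)" where
  "poly_subst Hole g = g"
| "poly_subst (AppL u v) g = poly_mult (poly_subst u g) (wmon v)"
| "poly_subst (AppR v u) g = poly_mult (wmon v) (poly_subst u g)"

definition lead :: "'x rel \<Rightarrow> ('x nword \<Rightarrow>\<^sub>0 'k::field) \<Rightarrow> 'x nword" where
  "lead r f = (THE w. w \<in> Poly_Mapping.keys f \<and> (\<forall>v\<in>Poly_Mapping.keys f. word_le r v w))"

definition monic :: "'x rel \<Rightarrow> ('x nword \<Rightarrow>\<^sub>0 'k::field) \<Rightarrow> bool" where
  "monic r f \<longleftrightarrow> f \<noteq> 0 \<and> Poly_Mapping.lookup f (lead r f) = 1"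

definition trivial_mod ::
  "'x rel \<Rightarrow> 'x set \<Rightarrow> ('x nword \<Rightarrow>\<^sub>0 'k::field) set \<Rightarrow> 'x nword \<Rightarrow> ('x nword \<Rightarrow>\<^sub>0 'k) \<Rightarrow> bool" where
  "trivial_mod r X S w h \<longleftrightarrow>
     (\<exists>(n::nat) \<alpha> u s.
        (\<forall>i<n. u i \<in> ctxs X \<and> s i \<in> S \<and> word_less r (word_subst (u i) (lead r (s i))) w) \<and>
        h = (\<Sum>i<n. poly_smult (\<alpha> i) (poly_subst (u i) (s i))))"

definition GS_basis :: "'x rel \<Rightarrow> 'x set \<Rightarrow> ('x nword \<Rightarrow>\<^sub>0 'k::field) set \<Rightarrow> bool" where
  "GS_basis r X S \<longleftrightarrow>
     S \<subseteq> carrier (free_alg X) \<and> (\<forall>f\<in>S. monic r f) \<and>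
     (\<forall>f\<in>S. \<forall>g\<in>S. \<forall>u\<in>ctxs X. lead r f = word_subst u (lead r g) \<longrightarrow>
        trivial_mod r X S (lead r f) (f - poly_subst u g))"


section \<open>The defining relations\<close>

definition relations :: "'x rel \<Rightarrow> 'x set \<Rightarrow> ('x nword \<Rightarrow>\<^sub>0 'k::field) set" where
  "relations r X =
     {wmon (a \<diamondop> (b \<diamondop> c)) - wmon (a \<diamondop> b \<diamondop> c) - wmon (b \<diamondop> a \<diamondop> c) | a b c.
        a \<in> nwords X \<and> b \<in> nwords X \<and> c \<in> nwords X} \<union>
     {wmon (Letter x \<diamondop> Letter y) + wmon (Letter y \<diamondop> Letter x) | x y.
        x \<in> X \<and> y \<in> X \<and> (x, y) \<in> r \<and> x \<noteq> y} \<union>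
     {wmon (Letter x \<diamondop> Letter x) | x. x \<in> X} \<union>
     {wmon (a \<diamondop> Letter x \<diamondop> Letter y) + wmon (a \<diamondop> Letter y \<diamondop> Letter x) | a x y.
        a \<in> nwords X \<and> even (wlen a) \<and> x \<in> X \<and> y \<in> X \<and> (x, y) \<in> r \<and> x \<noteq> y} \<union>
     {wmon (a \<diamondop> Letter x \<diamondop> Letter x) | a x.
        a \<in> nwords X \<and> even (wlen a) \<and> x \<in> X}"

text \<open>The relation \<open>xx\<close> follows from \<open>x * x = 2 xx = 0\<close> only if \<open>2\<close> is invertible. Over a field of
  characteristic 2 the relations still form a Groebner--Shirshov basis, but in general not one of the
  universal envelope: for a one-dimensional \<open>A\<close> with basis \<open>x\<close>, every product \<open>a * a\<close> vanishes in
  characteristic 2, so the universal envelope is the free Zinbiel algebra generated by \<open>x\<close>, which is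
  infinite-dimensional, whereas the quotient by the relations is spanned by \<open>x\<close>.\<close>

abbreviation rel_ideal ::
  "'x rel \<Rightarrow> 'x set \<Rightarrow> ('x nword \<Rightarrow>\<^sub>0 'k::field) set" where
  "rel_ideal r X \<equiv> alg_genideal class_ring (free_alg X) (relations r X)"

abbreviation rel_quot ::
  "'x rel \<Rightarrow> 'x set \<Rightarrow> ('k::field, ('x nword \<Rightarrow>\<^sub>0 'k) set) module" where
  "rel_quot r X \<equiv> alg_quot (free_alg X) (rel_ideal r X)"

abbreviation gen_class ::
  "'x rel \<Rightarrow> 'x set \<Rightarrow> 'x \<Rightarrow> ('x nword \<Rightarrow>\<^sub>0 'k::field) set" where
  "gen_class r X x \<equiv> rel_ideal r X +>\<^bsub>(free_alg X :: ('k, 'x nword \<Rightarrow>\<^sub>0 'k) module)\<^esub> wmon (Letter x)"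

end

theory Submission
  imports Defs
begin

text \<open>Modulo the ideal \<open>I\<close> generated by (R1) and all \<open>xy + yx\<close> with \<open>x, y \<in> X\<close>, an induction on the
  degree gives, for words \<open>p\<close>, \<open>q\<close> of odd length and \<open>a\<close> of even length: \<open>pa \<in> I\<close>, \<open>pq + qp \<in> I\<close> and
  \<open>(ap)q + (aq)p \<in> I\<close>. In particular \<open>I\<close> contains (R2), (R3) and, if \<open>2\<close> is invertible, (R2') and
  (R3'); this gives the universal property of the quotient.

  All relations are homogeneous, so an element \<open>h\<close> of the ideal is a combination of relations in
  words of the degree of \<open>h\<close>, and every such combination times \<open>c\<close> is trivial with respect to a word
  \<open>a(bc)\<close> of the same degree, because the order compares right factors first and \<open>c\<close> is shorter than
  \<open>bc\<close>. Hence a composition at the right factor of \<open>a(bc)\<close> only has to be reduced modulo (R1) to terms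
  \<open>hc\<close> and multiples of (R3). A composition inside \<open>a\<close>, \<open>b\<close> or \<open>c\<close> is trivial since the relations
  (R1) and (R3) are linear in these words.\<close>

section \<open>The space of non-associative polynomials\<close>

text \<open>The parity condition in (R3) comes from one computation. Composing (R1) with (R2) at
  \<open>a(xy)\<close> leaves, modulo (R1) and up to sign,
  \<open>(ax)y + (ay)x + (xa)y + (ya)x\<close>. For odd \<open>a\<close> the sums
  \<open>ax + xa\<close> and \<open>ay + ya\<close> already lie in the ideal of (R1) and all
  \<open>xy + yx\<close>. For even \<open>a\<close> it is \<open>xa\<close> and \<open>ya\<close>
  that lie there, and the rest \<open>(ax)y + (ay)x\<close> has to be added as a relation. Composing
  (R1) with itself leaves a right multiple of \<open>a*(b*c) - (a*b)*c\<close>, where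
  \<open>u*v = uv + vu\<close>, so it is trivial for the reason that makes \<open>*\<close>
  associative in a Zinbiel algebra. The parity facts need no division by 2, since for
  \<open>x = y\<close> the generator \<open>xy + yx\<close> is \<open>2xx\<close>. Division enters
  only where an evaluation in an arbitrary Zinbiel algebra has to kill \<open>xx\<close> and
  \<open>(ax)x\<close>; the Groebner--Shirshov claim therefore holds over every field. The parity
  facts serve twice: with degrees recorded, to bound leading words, and with degrees forgotten, in
  the kernel of an evaluation.\<close>

notation poly_mult (infixl \<open>\<star>\<close> 70)

lemma lookup_poly_smult [simp]:
  "Poly_Mapping.lookup (poly_smult \<alpha> f) w = \<alpha> * Poly_Mapping.lookup f w"
  by (simp add: poly_smult_def Poly_Mapping.map.rep_eq when_def)

lemma vector_space_poly_smult: "Vector_Spaces.vector_space poly_smult"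
  by unfold_locales (auto intro!: poly_mapping_eqI simp: lookup_add algebra_simps)

interpretation poly: Vector_Spaces.vector_space poly_smult
  by (rule vector_space_poly_smult)

interpretation poly: Vector_Spaces.vector_space_pair poly_smult poly_smult
  by unfold_locales

abbreviation poly_linear :: "(('x nword \<Rightarrow>\<^sub>0 'k::field) \<Rightarrow> ('y nword \<Rightarrow>\<^sub>0 'k)) \<Rightarrow> bool" where
  "poly_linear \<equiv> Vector_Spaces.linear poly_smult poly_smult"

lemma keys_poly_smult: "Poly_Mapping.keys (poly_smult \<alpha> f) \<subseteq> Poly_Mapping.keys f"
  by (auto simp: in_keys_iff)

lemma poly_smult_single [simp]:
  "poly_smult \<alpha> (Poly_Mapping.single w \<beta>) = Poly_Mapping.single w (\<alpha> * \<beta>)"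
  by (rule poly_mapping_eqI) (simp add: lookup_single when_def)

text \<open>Bilinearity is awkward from the definition because the support of \<open>f + g\<close>
  can be smaller than the union of the supports. Over fixed finite supersets the additional summands
  are zero, and sums can be compared term by term.\<close>

lemma poly_mult_superset:
  assumes "finite A" "finite B" "Poly_Mapping.keys f \<subseteq> A" "Poly_Mapping.keys g \<subseteq> B"
  shows "f \<star> g = (\<Sum>u\<in>A. \<Sum>v\<in>B.
    Poly_Mapping.single (u \<diamondop> v) (Poly_Mapping.lookup f u * Poly_Mapping.lookup g v))"
proof -
  have "f \<star> g = (\<Sum>u\<in>Poly_Mapping.keys f. \<Sum>v\<in>B.
    Poly_Mapping.single (u \<diamondop> v) (Poly_Mapping.lookup f u * Poly_Mapping.lookup g v))"
    unfolding poly_mult_def using assms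
    by (intro sum.cong refl sum.mono_neutral_left) (auto simp: in_keys_iff)
  also have "\<dots> = (\<Sum>u\<in>A. \<Sum>v\<in>B.
    Poly_Mapping.single (u \<diamondop> v) (Poly_Mapping.lookup f u * Poly_Mapping.lookup g v))"
    using assms by (intro sum.mono_neutral_left) (auto simp: in_keys_iff)
  finally show ?thesis .
qed

lemma poly_mult_add_left: "(f + g) \<star> h = f \<star> h + g \<star> h"
  unfolding poly_mult_superset
    [OF finite_UnI[OF finite_keys[of f] finite_keys[of g]] finite_keys[of h] keys_add order_refl]
    poly_mult_superset
    [OF finite_UnI[OF finite_keys[of f] finite_keys[of g]] finite_keys[of h] Un_upper1 order_refl]
    poly_mult_superset
    [OF finite_UnI[OF finite_keys[of f] finite_keys[of g]] finite_keys[of h] Un_upper2 order_refl]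
  by (simp add: lookup_add distrib_right single_add sum.distrib)

lemma poly_mult_add_right: "h \<star> (f + g) = h \<star> f + h \<star> g"
  unfolding poly_mult_superset
    [OF finite_keys[of h] finite_UnI[OF finite_keys[of f] finite_keys[of g]] order_refl keys_add]
    poly_mult_superset
    [OF finite_keys[of h] finite_UnI[OF finite_keys[of f] finite_keys[of g]] order_refl Un_upper1]
    poly_mult_superset
    [OF finite_keys[of h] finite_UnI[OF finite_keys[of f] finite_keys[of g]] order_refl Un_upper2]
  by (simp add: lookup_add distrib_left single_add sum.distrib)

lemma poly_mult_smult_left: "poly_smult \<alpha> f \<star> g = poly_smult \<alpha> (f \<star> g)"
  unfolding poly_mult_superset[OF finite_keys[of f] finite_keys[of g] keys_poly_smult order_refl]
    poly_mult_superset[OF finite_keys[of f] finite_keys[of g] order_refl order_refl]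
  by (simp add: poly.scale_sum_right mult.assoc)

lemma poly_mult_smult_right: "f \<star> poly_smult \<alpha> g = poly_smult \<alpha> (f \<star> g)"
  unfolding poly_mult_superset[OF finite_keys[of f] finite_keys[of g] order_refl keys_poly_smult]
    poly_mult_superset[OF finite_keys[of f] finite_keys[of g] order_refl order_refl]
  by (simp add: poly.scale_sum_right mult.left_commute)

lemma poly_linear_mult_left: "poly_linear (\<lambda>f. f \<star> g)"
  by unfold_locales (simp_all add: poly_mult_add_left poly_mult_smult_left)

lemma poly_linear_mult_right: "poly_linear (\<lambda>g. f \<star> g)"
  by unfold_locales (simp_all add: poly_mult_add_right poly_mult_smult_right)

lemma poly_linearI:
  assumes "\<And>f g. L (f + g) = L f + L g" "\<And>\<alpha> f. L (poly_smult \<alpha> f) = poly_smult \<alpha> (L f)"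
  shows "poly_linear L"
  using assms by unfold_locales auto

lemmas poly_mult_diff_left = poly.linear_diff[OF poly_linear_mult_left]
  and poly_mult_diff_right = poly.linear_diff[OF poly_linear_mult_right]
  and poly_mult_neg_left = poly.linear_neg[OF poly_linear_mult_left]
  and poly_mult_neg_right = poly.linear_neg[OF poly_linear_mult_right]

lemma poly_mult_zero [simp]: "0 \<star> f = 0" "f \<star> 0 = 0"
  by (simp_all add: poly_mult_def)

lemmas poly_mult_simps = poly_mult_add_left poly_mult_add_right poly_mult_diff_left
  poly_mult_diff_right poly_mult_neg_left poly_mult_neg_right

lemma poly_mult_single [simp]:
  "Poly_Mapping.single u \<alpha> \<star> Poly_Mapping.single v \<beta> = Poly_Mapping.single (u \<diamondop> v) (\<alpha> * \<beta>)"
  by (subst poly_mult_superset[of "{u}" "{v}"]) auto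

lemma poly_sum_monomials:
  fixes p :: "'x nword \<Rightarrow>\<^sub>0 'k::field"
  shows "p = (\<Sum>w\<in>Poly_Mapping.keys p. poly_smult (Poly_Mapping.lookup p w) (wmon w))"
proof (rule poly_mapping_eqI)
  fix v
  show "Poly_Mapping.lookup p v =
      Poly_Mapping.lookup (\<Sum>w\<in>Poly_Mapping.keys p. poly_smult (Poly_Mapping.lookup p w) (wmon w)) v"
    by (auto simp: lookup_sum lookup_single when_def sum.delta in_keys_iff)
qed

lemma poly_linear_poly_subst: "poly_linear (poly_subst u :: ('x nword \<Rightarrow>\<^sub>0 'k::field) \<Rightarrow> _)"
proof (induction u)
  case Hole
  show ?case by (rule poly_linearI) simp_all
next
  case (AppL u v)
  show ?case
    by (rule poly_linearI)
      (simp_all add: poly.linear_add[OF AppL] poly.linear_scale[OF AppL]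
        poly_mult_add_left poly_mult_smult_left)
next
  case (AppR v u)
  show ?case
    by (rule poly_linearI)
      (simp_all add: poly.linear_add[OF AppR] poly.linear_scale[OF AppR]
        poly_mult_add_right poly_mult_smult_right)
qed

lemma poly_subst_wmon [simp]: "poly_subst u (wmon w) = wmon (word_subst u w)"
  by (induction u) auto

text \<open>Reduces multilinear statements to monomials, one argument at a time. Only monomials of
  the support of \<open>p\<close> are tested, so restrictions on the letters survive.\<close>

lemma poly_linear_in_subspace:
  assumes "poly_linear L" "poly.subspace T" "\<And>w. w \<in> Poly_Mapping.keys p \<Longrightarrow> L (wmon w) \<in> T"
  shows "L p \<in> T"
proof -
  have "L p = (\<Sum>w\<in>Poly_Mapping.keys p. poly_smult (Poly_Mapping.lookup p w) (L (wmon w)))"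
    by (subst poly_sum_monomials[of p])
      (simp only: poly.linear_sum[OF assms(1)] poly.linear_scale[OF assms(1)])
  also have "\<dots> \<in> T"
    using assms by (intro poly.subspace_sum poly.subspace_scale)
  finally show ?thesis .
qed

section \<open>Words and their order\<close>

lemma nwords_Letter [simp]: "Letter x \<in> nwords X \<longleftrightarrow> x \<in> X"
  by (simp add: nwords_def)

lemma nwords_App [simp]: "u \<diamondop> v \<in> nwords X \<longleftrightarrow> u \<in> nwords X \<and> v \<in> nwords X"
  by (simp add: nwords_def)

lemma wlen_pos: "0 < wlen w"
  by (induction w) auto

lemma ctxs_simps [simp]:
  "Hole \<in> ctxs X" "AppL u v \<in> ctxs X \<longleftrightarrow> u \<in> ctxs X \<and> v \<in> nwords X"
  "AppR v u \<in> ctxs X \<longleftrightarrow> u \<in> ctxs X \<and> v \<in> nwords X"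
  by (auto simp: ctxs_def nwords_def)

lemma word_subst_nwords: "u \<in> ctxs X \<Longrightarrow> w \<in> nwords X \<Longrightarrow> word_subst u w \<in> nwords X"
  by (induction u) auto

lemma wlen_word_subst_cong: "wlen v = wlen w \<Longrightarrow> wlen (word_subst u v) = wlen (word_subst u w)"
  by (induction u) auto

lemma wlen_App_gt_1: "1 < wlen (u \<diamondop> v)"
  using wlen_pos[of u] wlen_pos[of v] by simp

lemma word_less_if_shorter:
  assumes "wlen u < wlen v"
  shows "word_less r u v"
proof -
  have "word_le r u v"
  proof (cases u)
    case (Letter x)
    then show ?thesis
      using assms by (cases v) simp_all
  next
    case (App u1 u2)
    then show ?thesis
      using assms wlen_App_gt_1[of u1 u2] by (cases v) simp_all
  qed
  then show ?thesis
    using assms by (auto simp: word_less_def)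
qed

lemma word_less_App_right:
  assumes "wlen (u1 \<diamondop> u2) = wlen (v1 \<diamondop> v2)" "word_less r u2 v2"
  shows "word_less r (u1 \<diamondop> u2) (v1 \<diamondop> v2)"
  using assms by (simp add: word_less_def)

lemma word_less_App_left:
  assumes "wlen u = wlen v" "word_less r u v"
  shows "word_less r (u \<diamondop> c) (v \<diamondop> c)"
  using assms by (simp add: word_less_def)

text \<open>The monomial property between words of equal length, the case that arises for the words
  of one homogeneous relation. Equal lengths make \<open>AppR\<close> a comparison of right factors
  and \<open>AppL\<close> one of left factors.\<close>

lemma word_less_word_subst:
  assumes "wlen v = wlen w" "word_less r v w"
  shows "word_less r (word_subst u v) (word_subst u w)"
proof (induction u)
  case Hole
  show ?case using assms by simp
next
  case (AppL u c)
  then show ?case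
    using word_less_App_left[OF wlen_word_subst_cong[OF assms(1)]] by simp
next
  case (AppR c u)
  have "wlen (c \<diamondop> word_subst u v) = wlen (c \<diamondop> word_subst u w)"
    using wlen_word_subst_cong[OF assms(1)] by simp
  from word_less_App_right[OF this] show ?case
    using AppR by simp
qed

lemma word_le_antisym:
  assumes "antisym r" "word_le r u v" "word_le r v u"
  shows "u = v"
  using assms(2,3)
proof (induction u arbitrary: v)
  case (Letter x)
  then show ?case
    using assms(1) by (cases v) (simp_all add: antisym_def)
next
  case (App u1 u2)
  show ?case
  proof (cases v)
    case (Letter y)
    then show ?thesis
      using App.prems by simp
  next
    case (App v1 v2)
    then have "u2 = v2"
      using App.prems App.IH(2)[of v2] by (metis less_asym less_irrefl word_le.simps(4))
    then show ?thesis
      using App App.prems App.IH(1)[of v1] by auto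
  qed
qed

text \<open>\<open>lead\<close> is a definite description: antisymmetry gives its uniqueness, and
  reflexivity at \<open>w\<close> lets \<open>w\<close> satisfy it.\<close>

lemma lead_eqI:
  assumes "antisym r" "w \<in> Poly_Mapping.keys f" "\<And>v. v \<in> Poly_Mapping.keys f \<Longrightarrow> v \<noteq> w \<Longrightarrow> word_less r v w"
    "word_le r w w"
  shows "lead r f = w"
  unfolding lead_def
proof (rule the_equality)
  show "w \<in> Poly_Mapping.keys f \<and> (\<forall>v\<in>Poly_Mapping.keys f. word_le r v w)"
    using assms by (auto simp: word_less_def)
  show "v = w" if "v \<in> Poly_Mapping.keys f \<and> (\<forall>v'\<in>Poly_Mapping.keys f. word_le r v' v)" for v
    using that assms by (auto simp: word_less_def intro: word_le_antisym)
qed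

lemma word_le_refl:
  assumes "refl_on X r" "w \<in> nwords X"
  shows "word_le r w w"
  using assms(2)
  using assms(1) by (induction w) (simp_all add: refl_on_def)

section \<open>Consequences of the Zinbiel identity and anticommuting letters\<close>

definition zinbiel_poly :: "'x nword \<Rightarrow> 'x nword \<Rightarrow> 'x nword \<Rightarrow> ('x nword \<Rightarrow>\<^sub>0 'k::field)" where
  "zinbiel_poly a b c = wmon (a \<diamondop> (b \<diamondop> c)) - wmon (a \<diamondop> b \<diamondop> c) - wmon (b \<diamondop> a \<diamondop> c)"

text \<open>Two instances matter: the degree \<open>n\<close> parts of the ideal of relations, and the constant
  family formed by the kernel of an evaluation homomorphism.\<close>

locale graded_zinbiel_ideal =
  fixes X :: "'x set" and J :: "nat \<Rightarrow> ('x nword \<Rightarrow>\<^sub>0 'k::field) set"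
  assumes subspace: "poly.subspace (J n)"
    and mult_right: "\<lbrakk>p \<in> J n; v \<in> nwords X\<rbrakk> \<Longrightarrow> p \<star> wmon v \<in> J (n + wlen v)"
    and mult_left: "\<lbrakk>p \<in> J n; v \<in> nwords X\<rbrakk> \<Longrightarrow> wmon v \<star> p \<in> J (wlen v + n)"
    and zinbiel_poly: "\<lbrakk>a \<in> nwords X; b \<in> nwords X; c \<in> nwords X\<rbrakk>
      \<Longrightarrow> zinbiel_poly a b c \<in> J (wlen a + wlen b + wlen c)"
    and anticomm: "\<lbrakk>x \<in> X; y \<in> X\<rbrakk> \<Longrightarrow> wmon (Letter x \<diamondop> Letter y) + wmon (Letter y \<diamondop> Letter x) \<in> J 2"
begin

lemmas add = poly.subspace_add[OF subspace]
  and diff = poly.subspace_diff[OF subspace]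

lemma mult_right': "\<lbrakk>p \<in> J n; v \<in> nwords X; m = n + wlen v\<rbrakk> \<Longrightarrow> p \<star> wmon v \<in> J m"
  using mult_right by blast

lemma zinbiel_poly': "\<lbrakk>a \<in> nwords X; b \<in> nwords X; c \<in> nwords X; n = wlen a + wlen b + wlen c\<rbrakk>
      \<Longrightarrow> zinbiel_poly a b c \<in> J n"
  using zinbiel_poly by blast

section \<open>Parity relations, one total degree at a time\<close>

definition odd_even :: "nat \<Rightarrow> bool" where
  "odd_even n \<longleftrightarrow> (\<forall>p\<in>nwords X. \<forall>q\<in>nwords X. odd (wlen p) \<longrightarrow> even (wlen q) \<longrightarrow>
     wlen p + wlen q = n \<longrightarrow> wmon (p \<diamondop> q) \<in> J n)"

definition odd_odd :: "nat \<Rightarrow> bool" where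
  "odd_odd n \<longleftrightarrow> (\<forall>p\<in>nwords X. \<forall>q\<in>nwords X. odd (wlen p) \<longrightarrow> odd (wlen q) \<longrightarrow>
     wlen p + wlen q = n \<longrightarrow> wmon (p \<diamondop> q) + wmon (q \<diamondop> p) \<in> J n)"

definition even_odd_odd :: "nat \<Rightarrow> bool" where
  "even_odd_odd n \<longleftrightarrow> (\<forall>a\<in>nwords X. \<forall>p\<in>nwords X. \<forall>q\<in>nwords X.
     even (wlen a) \<longrightarrow> odd (wlen p) \<longrightarrow> odd (wlen q) \<longrightarrow>
     wlen a + wlen p + wlen q = n \<longrightarrow> wmon (a \<diamondop> p \<diamondop> q) + wmon (a \<diamondop> q \<diamondop> p) \<in> J n)"

lemma odd_evenD:
  "\<lbrakk>odd_even n; p \<in> nwords X; q \<in> nwords X; odd (wlen p); even (wlen q); n = wlen p + wlen q\<rbrakk>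
    \<Longrightarrow> wmon (p \<diamondop> q) \<in> J n"
  unfolding odd_even_def by blast

lemma odd_oddD:
  "\<lbrakk>odd_odd n; p \<in> nwords X; q \<in> nwords X; odd (wlen p); odd (wlen q); n = wlen p + wlen q\<rbrakk>
    \<Longrightarrow> wmon (p \<diamondop> q) + wmon (q \<diamondop> p) \<in> J n"
  unfolding odd_odd_def by blast

lemma even_odd_oddD:
  "\<lbrakk>even_odd_odd n; a \<in> nwords X; p \<in> nwords X; q \<in> nwords X; even (wlen a); odd (wlen p);
     odd (wlen q); n = wlen a + wlen p + wlen q\<rbrakk>
    \<Longrightarrow> wmon (a \<diamondop> p \<diamondop> q) + wmon (a \<diamondop> q \<diamondop> p) \<in> J n"
  unfolding even_odd_odd_def by blast

text \<open>With \<open>q = q1 q2\<close>, (R1) gives \<open>p(q1 q2) = (p q1)q2 + (q1 p)q2\<close>.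
  For odd \<open>q1\<close> the sum \<open>p q1 + q1 p\<close> has smaller degree. For even
  \<open>q1\<close> so has \<open>p q1\<close>, while \<open>(q1 p)q2\<close> is again odd times
  even with a shorter right factor; hence the inner induction on \<open>wlen q\<close> inside the
  fixed degree \<open>n\<close>.\<close>

lemma odd_even_step:
  assumes A: "\<And>m. m < n \<Longrightarrow> odd_even m" and B: "\<And>m. m < n \<Longrightarrow> odd_odd m"
  shows "odd_even n"
proof -
  have "wmon (p \<diamondop> q) \<in> J n"
    if "p \<in> nwords X" "q \<in> nwords X" "odd (wlen p)" "even (wlen q)" "wlen p + wlen q = n" for p q
    using that
  proof (induction "wlen q" arbitrary: p q rule: less_induct)
    case less
    obtain q1 q2 where q: "q = q1 \<diamondop> q2"
      using less.prems(4) by (cases q) auto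
    have len: "wlen p + wlen q1 < n" "n = wlen p + wlen q1 + wlen q2"
      using less.prems(5) wlen_pos[of q2] by (simp_all add: q)
    have z: "zinbiel_poly p q1 q2 \<in> J n"
      using less.prems q len by (intro zinbiel_poly') auto
    show ?case
    proof (cases "odd (wlen q1)")
      case True
      have "wmon (p \<diamondop> q1) + wmon (q1 \<diamondop> p) \<in> J (wlen p + wlen q1)"
        using less.prems q True by (intro odd_oddD B len) auto
      then have "(wmon (p \<diamondop> q1) + wmon (q1 \<diamondop> p)) \<star> wmon q2 \<in> J n"
        by (rule mult_right') (use less.prems q len in auto)
      from add[OF z this] show ?thesis
        by (simp add: q zinbiel_poly_def poly_mult_simps)
    next
      case False
      then have "wmon (p \<diamondop> q1) \<in> J (wlen p + wlen q1)"
        using less.prems q by (intro odd_evenD A len) auto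
      then have 1: "wmon (p \<diamondop> q1) \<star> wmon q2 \<in> J n"
        by (rule mult_right') (use less.prems q len in auto)
      have 2: "wmon (q1 \<diamondop> p \<diamondop> q2) \<in> J n"
        using less.prems q False by (intro less.hyps) (auto simp: wlen_pos)
      from add[OF z add[OF 1 2]] show ?thesis
        by (simp add: q zinbiel_poly_def poly_mult_simps)
    qed
  qed
  then show ?thesis
    unfolding odd_even_def by (intro ballI impI)
qed

text \<open>If \<open>q1\<close> is odd, both summands vanish separately: \<open>ap\<close> and
  \<open>q1\<close> are odd and anticommute, and \<open>(a q1)q2\<close> and \<open>q1 a\<close> are
  odd times even. If \<open>q1\<close> is even, it is absorbed into the even word: modulo
  \<open>J n\<close>, \<open>(ap)(q1 q2)\<close> becomes \<open>((q1 a)p)q2 + ((a q1)p)q2\<close>,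
  and \<open>(a(q1 q2))p\<close> becomes \<open>((a q1)q2)p + ((q1 a)q2)p\<close>. These pair up to
  two instances of the claim with \<open>q2\<close> in place of \<open>q1 q2\<close>.\<close>

lemma even_odd_odd_reduce:
  assumes A: "\<And>m. m < n \<Longrightarrow> odd_even m" and B: "\<And>m. m < n \<Longrightarrow> odd_odd m"
    and X: "a \<in> nwords X" "p \<in> nwords X" "q1 \<in> nwords X" "q2 \<in> nwords X"
    and par: "even (wlen a)" "odd (wlen p)" "odd (wlen (q1 \<diamondop> q2))"
    and n: "n = wlen a + wlen p + wlen (q1 \<diamondop> q2)"
    and IH: "\<And>b. \<lbrakk>b \<in> nwords X; even (wlen b); odd (wlen q2); wlen b + wlen p + wlen q2 = n\<rbrakk>
      \<Longrightarrow> wmon (b \<diamondop> p \<diamondop> q2) + wmon (b \<diamondop> q2 \<diamondop> p) \<in> J n"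
  shows "wmon (a \<diamondop> p \<diamondop> (q1 \<diamondop> q2)) + wmon (a \<diamondop> (q1 \<diamondop> q2) \<diamondop> p) \<in> J n"
proof -
  have len: "wlen a + wlen p + wlen q1 < n" "wlen a + wlen q1 + wlen q2 < n" "wlen q1 + wlen a < n"
    using n wlen_pos[of p] wlen_pos[of q2] unfolding wlen.simps by linarith+
  have "zinbiel_poly a q1 q2 \<in> J (wlen a + wlen q1 + wlen q2)"
    using X by (intro zinbiel_poly)
  then have z: "zinbiel_poly a q1 q2 \<star> wmon p \<in> J n"
    by (rule mult_right') (use X n in auto)
  show ?thesis
  proof (cases "odd (wlen q1)")
    case True
    have z1: "zinbiel_poly (a \<diamondop> p) q1 q2 \<in> J n"
      using X n by (intro zinbiel_poly') auto
    have "wmon (a \<diamondop> p \<diamondop> q1) + wmon (q1 \<diamondop> (a \<diamondop> p)) \<in> J (wlen a + wlen p + wlen q1)"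
      using X par True by (intro odd_oddD B len) auto
    then have 1: "(wmon (a \<diamondop> p \<diamondop> q1) + wmon (q1 \<diamondop> (a \<diamondop> p))) \<star> wmon q2 \<in> J n"
      by (rule mult_right') (use X n in auto)
    have "wmon (a \<diamondop> q1 \<diamondop> q2) \<in> J (wlen a + wlen q1 + wlen q2)"
      using X par n True by (intro odd_evenD A len) auto
    then have 2: "wmon (a \<diamondop> q1 \<diamondop> q2) \<star> wmon p \<in> J n"
      by (rule mult_right') (use X n in auto)
    have "wmon (q1 \<diamondop> a) \<in> J (wlen q1 + wlen a)"
      using X par n True by (intro odd_evenD A len) auto
    then have "wmon (q1 \<diamondop> a) \<star> wmon q2 \<in> J (wlen q1 + wlen a + wlen q2)"
      using X by (intro mult_right)
    then have 3: "wmon (q1 \<diamondop> a) \<star> wmon q2 \<star> wmon p \<in> J n"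
      by (rule mult_right') (use X n in auto)
    from add[OF add[OF add[OF z1 1] 2] add[OF 3 z]] show ?thesis
      by (simp add: zinbiel_poly_def poly_mult_simps)
  next
    case False
    then have q2: "odd (wlen q2)"
      using par by simp
    have z1: "zinbiel_poly (a \<diamondop> p) q1 q2 \<in> J n"
      using X n by (intro zinbiel_poly') auto
    have "wmon (a \<diamondop> p \<diamondop> q1) \<in> J (wlen a + wlen p + wlen q1)"
      using X par n False by (intro odd_evenD A len) auto
    then have 1: "wmon (a \<diamondop> p \<diamondop> q1) \<star> wmon q2 \<in> J n"
      by (rule mult_right') (use X n in auto)
    have "zinbiel_poly q1 a p \<in> J (wlen q1 + wlen a + wlen p)"
      using X by (intro zinbiel_poly)
    then have z2: "zinbiel_poly q1 a p \<star> wmon q2 \<in> J n"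
      by (rule mult_right') (use X n in auto)
    \<comment> \<open>The instances \<open>b = q1 a\<close> and \<open>b = a q1\<close> of
      \<open>IH\<close>; both words are even.\<close>
    have 2: "wmon (q1 \<diamondop> a \<diamondop> p \<diamondop> q2) + wmon (q1 \<diamondop> a \<diamondop> q2 \<diamondop> p) \<in> J n"
      "wmon (a \<diamondop> q1 \<diamondop> p \<diamondop> q2) + wmon (a \<diamondop> q1 \<diamondop> q2 \<diamondop> p) \<in> J n"
      by (rule IH; use X par n q2 False in simp)+
    from add[OF add[OF add[OF z1 z2] add[OF 2]] add[OF 1 z]]
    show ?thesis
      by (simp add: zinbiel_poly_def poly_mult_simps)
  qed
qed

text \<open>The inner induction is on the joint length of \<open>p\<close> and \<open>q\<close> in
  the fixed degree \<open>n\<close>, so \<open>a\<close> grows while they shrink. What remains is a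
  pair of letters, where the claim comes from expanding \<open>a(xy + yx)\<close>.\<close>

lemma even_odd_odd_step:
  assumes A: "\<And>m. m < n \<Longrightarrow> odd_even m" and B: "\<And>m. m < n \<Longrightarrow> odd_odd m"
  shows "even_odd_odd n"
proof -
  have "wmon (a \<diamondop> p \<diamondop> q) + wmon (a \<diamondop> q \<diamondop> p) \<in> J n"
    if "a \<in> nwords X" "p \<in> nwords X" "q \<in> nwords X"
      "even (wlen a)" "odd (wlen p)" "odd (wlen q)" "wlen a + wlen p + wlen q = n" for a p q
    using that
  proof (induction "wlen p + wlen q" arbitrary: a p q rule: less_induct)
    case less
    \<comment> \<open>The claim is symmetric in \<open>p\<close> and \<open>q\<close>, so whichever
      of them is a product may be taken apart.\<close>
    have reduce: "wmon (a \<diamondop> p' \<diamondop> (q1 \<diamondop> q2)) + wmon (a \<diamondop> (q1 \<diamondop> q2) \<diamondop> p') \<in> J n"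
      if "p' = p \<and> q1 \<diamondop> q2 = q \<or> p' = q \<and> q1 \<diamondop> q2 = p" for p' q1 q2
    proof (rule even_odd_odd_reduce[OF A B])
      have X: "p' \<in> nwords X" "q1 \<diamondop> q2 \<in> nwords X"
        and par: "odd (wlen p')" "odd (wlen (q1 \<diamondop> q2))"
        and len: "wlen p' + wlen (q1 \<diamondop> q2) = wlen p + wlen q"
        using that less.prems by auto
      show "a \<in> nwords X" "p' \<in> nwords X" "q1 \<in> nwords X" "q2 \<in> nwords X"
        "even (wlen a)" "odd (wlen p')" "odd (wlen (q1 \<diamondop> q2))"
        using X par less.prems by simp_all
      show "n = wlen a + wlen p' + wlen (q1 \<diamondop> q2)"
        using len less.prems by linarith
      fix b
      assume "b \<in> nwords X" "even (wlen b)" "odd (wlen q2)" "wlen b + wlen p' + wlen q2 = n"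
      then show "wmon (b \<diamondop> p' \<diamondop> q2) + wmon (b \<diamondop> q2 \<diamondop> p') \<in> J n"
        using X par len wlen_pos[of q1] by (intro less.hyps) simp_all
    qed
    show ?case
    proof (cases q)
      case (App q1 q2)
      then show ?thesis
        using reduce[of p q1 q2] by simp
    next
      case (Letter y)
      show ?thesis
      proof (cases p)
        case (App p1 p2)
        then show ?thesis
          using reduce[of q p1 p2] by (simp add: add.commute)
      next
        case (Letter x)
        note xy = \<open>q = Letter y\<close> \<open>p = Letter x\<close>
        have z: "zinbiel_poly a p q \<in> J n" "zinbiel_poly a q p \<in> J n"
          using less.prems by (auto intro!: zinbiel_poly')
        have "wlen p + wlen a < n" "wlen q + wlen a < n"
          using less.prems wlen_pos[of p] wlen_pos[of q] by linarith+
        then have "wmon (p \<diamondop> a) \<in> J (wlen p + wlen a)" "wmon (q \<diamondop> a) \<in> J (wlen q + wlen a)"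
          using odd_evenD[OF A, of "wlen p + wlen a" p a] odd_evenD[OF A, of "wlen q + wlen a" q a]
            less.prems by simp_all
        from mult_right'[OF this(1), of q n] mult_right'[OF this(2), of p n]
        have 1: "wmon (p \<diamondop> a \<diamondop> q) \<in> J n" "wmon (q \<diamondop> a \<diamondop> p) \<in> J n"
          using less.prems by simp_all
        have "wmon a \<star> (wmon (p \<diamondop> q) + wmon (q \<diamondop> p)) \<in> J (wlen a + 2)"
          unfolding xy by (rule mult_left[OF anticomm]) (use less.prems xy in simp_all)
        moreover have "wlen a + 2 = n"
          using less.prems xy by simp
        ultimately have 2: "wmon (a \<diamondop> (p \<diamondop> q)) + wmon (a \<diamondop> (q \<diamondop> p)) \<in> J n"
          by (simp add: poly_mult_add_right)
        \<comment> \<open>Expanding \<open>a(xy)\<close> and \<open>a(yx)\<close> by (R1) also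
          produces \<open>(xa)y\<close> and \<open>(ya)x\<close>; they lie in \<open>J n\<close>
          because \<open>xa\<close> and \<open>ya\<close> are odd times even.\<close>
        have "wmon (a \<diamondop> p \<diamondop> q) + wmon (a \<diamondop> q \<diamondop> p) =
            (wmon (a \<diamondop> (p \<diamondop> q)) + wmon (a \<diamondop> (q \<diamondop> p)) :: _ \<Rightarrow>\<^sub>0 'k) -
            (zinbiel_poly a p q + zinbiel_poly a q p + (wmon (p \<diamondop> a \<diamondop> q) + wmon (q \<diamondop> a \<diamondop> p)))"
          by (simp add: zinbiel_poly_def)
        then show ?thesis
          using diff[OF 2 add[OF add[OF z] add[OF 1]]] by metis
      qed
    qed
  qed
  then show ?thesis
    unfolding even_odd_odd_def by (intro ballI impI)
qed

text \<open>For \<open>q = q1 q2\<close> with even \<open>q1\<close>, expanding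
  \<open>p(q1 q2)\<close> leaves \<open>(q1 p)q2 + (q1 q2)p\<close> in the full degree
  \<open>n\<close>. This is why \<open>even_odd_odd n\<close> itself is assumed here, and not just
  its smaller degrees.\<close>

lemma odd_odd_step:
  assumes A: "\<And>m. m < n \<Longrightarrow> odd_even m" and B: "\<And>m. m < n \<Longrightarrow> odd_odd m" and C: "even_odd_odd n"
  shows "odd_odd n"
proof -
  have reduce: "wmon (p \<diamondop> (q1 \<diamondop> q2)) + wmon ((q1 \<diamondop> q2) \<diamondop> p) \<in> J n"
    if X: "p \<in> nwords X" "q1 \<in> nwords X" "q2 \<in> nwords X"
      and par: "odd (wlen p)" "odd (wlen (q1 \<diamondop> q2))" and n: "wlen p + wlen (q1 \<diamondop> q2) = n"
    for p q1 q2
  proof -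
    have z: "zinbiel_poly p q1 q2 \<in> J n"
      using X n by (intro zinbiel_poly') auto
    have len: "wlen p + wlen q1 < n" "wlen q1 + wlen q2 < n"
      using n wlen_pos[of q2] wlen_pos[of p] unfolding wlen.simps by linarith+
    show ?thesis
    proof (cases "odd (wlen q1)")
      case True
      have "wmon (p \<diamondop> q1) + wmon (q1 \<diamondop> p) \<in> J (wlen p + wlen q1)"
        using X par True by (intro odd_oddD B len) auto
      then have 1: "(wmon (p \<diamondop> q1) + wmon (q1 \<diamondop> p)) \<star> wmon q2 \<in> J n"
        by (rule mult_right') (use X n in auto)
      have "wmon (q1 \<diamondop> q2) \<in> J (wlen q1 + wlen q2)"
        using X par True by (intro odd_evenD A len) auto
      then have 2: "wmon (q1 \<diamondop> q2) \<star> wmon p \<in> J n"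
        by (rule mult_right') (use X n in auto)
      from add[OF z add[OF 1 2]] show ?thesis
        by (simp add: zinbiel_poly_def poly_mult_simps)
    next
      case False
      then have "wmon (p \<diamondop> q1) \<in> J (wlen p + wlen q1)"
        using X par by (intro odd_evenD A len) auto
      then have 1: "wmon (p \<diamondop> q1) \<star> wmon q2 \<in> J n"
        by (rule mult_right') (use X n in auto)
      have 2: "wmon (q1 \<diamondop> p \<diamondop> q2) + wmon (q1 \<diamondop> q2 \<diamondop> p) \<in> J n"
        using X n par False by (intro even_odd_oddD C) auto
      from add[OF z add[OF 1 2]] show ?thesis
        by (simp add: zinbiel_poly_def poly_mult_simps)
    qed
  qed
  have "wmon (p \<diamondop> q) + wmon (q \<diamondop> p) \<in> J n"
    if X: "p \<in> nwords X" "q \<in> nwords X" and par: "odd (wlen p)" "odd (wlen q)"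
      and n: "wlen p + wlen q = n" for p q
  proof (cases q)
    case (App q1 q2)
    then show ?thesis
      using reduce[of p q1 q2] X par n by simp
  next
    case (Letter y)
    note q = this
    show ?thesis
    proof (cases p)
      case (App p1 p2)
      then show ?thesis
        using reduce[of q p1 p2] X par n by (simp add: add.commute)
    next
      case (Letter x)
      have "n = 2"
        using Letter q n by simp
      then show ?thesis
        using anticomm[of x y] Letter q X by simp
    qed
  qed
  then show ?thesis
    unfolding odd_odd_def by (intro ballI impI)
qed

text \<open>Within one degree the order matters: \<open>odd_even n\<close> and
  \<open>even_odd_odd n\<close> rest on smaller degrees only, and \<open>odd_odd n\<close> also uses
  \<open>even_odd_odd n\<close>. Fixing the total degree in each claim makes this simultaneous
  induction possible.\<close>

lemma graded_relations: "odd_even n \<and> odd_odd n \<and> even_odd_odd n"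
proof (induction n rule: less_induct)
  case (less n)
  have A: "odd_even m" and B: "odd_odd m" if "m < n" for m
    using less[OF that] by simp_all
  have "even_odd_odd n"
    by (rule even_odd_odd_step[OF A B])
  then show ?case
    using odd_even_step[OF A B] odd_odd_step[OF A B] by simp
qed

lemma odd_even_mem:
  "\<lbrakk>p \<in> nwords X; q \<in> nwords X; odd (wlen p); even (wlen q)\<rbrakk>
    \<Longrightarrow> wmon (p \<diamondop> q) \<in> J (wlen p + wlen q)"
  by (rule odd_evenD) (use graded_relations in auto)

lemma odd_odd_mem:
  "\<lbrakk>p \<in> nwords X; q \<in> nwords X; odd (wlen p); odd (wlen q)\<rbrakk>
    \<Longrightarrow> wmon (p \<diamondop> q) + wmon (q \<diamondop> p) \<in> J (wlen p + wlen q)"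
  by (rule odd_oddD) (use graded_relations in auto)

lemma even_odd_odd_mem:
  "\<lbrakk>a \<in> nwords X; p \<in> nwords X; q \<in> nwords X; even (wlen a); odd (wlen p); odd (wlen q)\<rbrakk>
    \<Longrightarrow> wmon (a \<diamondop> p \<diamondop> q) + wmon (a \<diamondop> q \<diamondop> p) \<in> J (wlen a + wlen p + wlen q)"
  by (rule even_odd_oddD) (use graded_relations in auto)

end

section \<open>The composition argument\<close>

text \<open>(R2) and (R2'), and likewise (R3) and (R3'), are the cases \<open>x \<noteq> y\<close> and \<open>x = y\<close> of one family.\<close>

definition alt_poly2 :: "'x \<Rightarrow> 'x \<Rightarrow> ('x nword \<Rightarrow>\<^sub>0 'k::field)" where
  "alt_poly2 x y = wmon (Letter x \<diamondop> Letter y) + (if x = y then 0 else wmon (Letter y \<diamondop> Letter x))"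

definition alt_poly3 :: "'x nword \<Rightarrow> 'x \<Rightarrow> 'x \<Rightarrow> ('x nword \<Rightarrow>\<^sub>0 'k::field)" where
  "alt_poly3 a x y = wmon (a \<diamondop> Letter x \<diamondop> Letter y) +
     (if x = y then 0 else wmon (a \<diamondop> Letter y \<diamondop> Letter x))"

text \<open>Triviality is treated as membership in a span, so that closure under linear combinations
  comes for free. \<open>P\<close> tests the leading word of the substituted relation; it becomes
  \<open>word_less r v w\<close> for triviality and \<open>wlen v = n\<close> for the graded
  ideal.\<close>

definition subst_span ::
  "'x rel \<Rightarrow> 'x set \<Rightarrow> ('x nword \<Rightarrow>\<^sub>0 'k::field) set \<Rightarrow> ('x nword \<Rightarrow> bool) \<Rightarrow> ('x nword \<Rightarrow>\<^sub>0 'k) set"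
  where "subst_span r X S P =
    poly.span {poly_subst u s | u s. u \<in> ctxs X \<and> s \<in> S \<and> P (word_subst u (lead r s))}"

lemma subspace_subst_span: "poly.subspace (subst_span r X S P)"
  by (simp add: subst_span_def)

lemma subst_span_base:
  "\<lbrakk>u \<in> ctxs X; s \<in> S; P (word_subst u (lead r s))\<rbrakk> \<Longrightarrow> poly_subst u s \<in> subst_span r X S P"
  unfolding subst_span_def by (rule poly.span_base) blast

text \<open>A member of a span is a combination of a finite set of generators. Choosing a context
  and a relation for each generator and enumerating the set gives the indexed sum that
  \<open>trivial_mod\<close> asks for.\<close>

lemma trivial_mod_if_subst_span:
  assumes "h \<in> subst_span r X S (\<lambda>v. word_less r v w)"
  shows "trivial_mod r X S w h"
proof -
  obtain T c where T: "finite T" and h: "h = (\<Sum>p\<in>T. poly_smult (c p) p)"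
    and sub: "T \<subseteq> {poly_subst u s | u s. u \<in> ctxs X \<and> s \<in> S \<and> word_less r (word_subst u (lead r s)) w}"
    using assms unfolding subst_span_def poly.span_explicit by blast
  have "\<forall>p\<in>T. \<exists>us. p = poly_subst (fst us) (snd us) \<and> fst us \<in> ctxs X \<and> snd us \<in> S \<and>
      word_less r (word_subst (fst us) (lead r (snd us))) w"
    using sub by fastforce
  then obtain us where us: "\<And>p. p \<in> T \<Longrightarrow> p = poly_subst (fst (us p)) (snd (us p))"
    "\<And>p. p \<in> T \<Longrightarrow> fst (us p) \<in> ctxs X \<and> snd (us p) \<in> S \<and>
      word_less r (word_subst (fst (us p)) (lead r (snd (us p)))) w"
    by metis
  obtain e where e: "bij_betw e {..<card T} T"
    using ex_bij_betw_nat_finite[OF T] by (auto simp: lessThan_atLeast0)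
  then have eT: "e i \<in> T" if "i < card T" for i
    using that by (auto simp: bij_betw_def)
  have "h = (\<Sum>i<card T. poly_smult (c (e i)) (e i))"
    unfolding h by (rule sum.reindex_bij_betw[OF e, symmetric])
  also have "\<dots> = (\<Sum>i<card T. poly_smult (c (e i)) (poly_subst (fst (us (e i))) (snd (us (e i)))))"
    using us(1)[OF eT] by (intro sum.cong) auto
  finally show ?thesis
    unfolding trivial_mod_def using us(2)[OF eT]
    by (intro exI[of _ "card T"] exI[of _ "\<lambda>i. c (e i)"] exI[of _ "\<lambda>i. fst (us (e i))"]
        exI[of _ "\<lambda>i. snd (us (e i))"]) simp
qed

lemma subspace_preimage:
  assumes "poly_linear L" "poly.subspace T"
  shows "poly.subspace {p. L p \<in> T}"
  using assms
  by (simp add: poly.subspace_def poly.linear_0 poly.linear_add poly.linear_scale)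

text \<open>Multiplying \<open>poly_subst u s\<close> by \<open>c\<close> is substitution into
  \<open>AppL u c\<close>, so generators go to generators and only the condition on the leading word
  changes.\<close>

lemma subst_span_mult_right:
  assumes "h \<in> subst_span r X S P" "c \<in> nwords X" "\<And>v. P v \<Longrightarrow> Q (v \<diamondop> c)"
  shows "h \<star> wmon c \<in> subst_span r X S Q"
proof -
  have "poly_subst u s \<star> wmon c \<in> subst_span r X S Q"
    if "u \<in> ctxs X" "s \<in> S" "P (word_subst u (lead r s))" for u s
    using subst_span_base[of "AppL u c" X s S Q r] that assms by simp
  then have "subst_span r X S P \<subseteq> {p. p \<star> wmon c \<in> subst_span r X S Q}"
    unfolding subst_span_def[of r X S P]
    by (intro poly.span_minimal subspace_preimage poly_linear_mult_left subspace_subst_span) blast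
  then show ?thesis
    using assms(1) by blast
qed

lemma subst_span_mult_left:
  assumes "h \<in> subst_span r X S P" "c \<in> nwords X" "\<And>v. P v \<Longrightarrow> Q (c \<diamondop> v)"
  shows "wmon c \<star> h \<in> subst_span r X S Q"
proof -
  have "wmon c \<star> poly_subst u s \<in> subst_span r X S Q"
    if "u \<in> ctxs X" "s \<in> S" "P (word_subst u (lead r s))" for u s
    using subst_span_base[of "AppR c u" X s S Q r] that assms by simp
  then have "subst_span r X S P \<subseteq> {p. wmon c \<star> p \<in> subst_span r X S Q}"
    unfolding subst_span_def[of r X S P]
    by (intro poly.span_minimal subspace_preimage poly_linear_mult_right subspace_subst_span) blast
  then show ?thesis
    using assms(1) by blast
qed

locale ordered_letters =
  fixes r :: "'x rel" and X :: "'x set"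
  assumes well_order: "well_order_on X r"
begin

lemma antisym: "antisym r" and refl_on: "refl_on X r" and total_on: "total_on X r"
  using well_order
  by (auto simp: well_order_on_def linear_order_on_def partial_order_on_def preorder_on_def)

text \<open>Five families become three, indexed by pairs of the reflexive order \<open>r\<close>;
  the diagonal pairs account for (R2') and (R3').\<close>

lemma relations_eq: "(relations r X :: ('x nword \<Rightarrow>\<^sub>0 'k::field) set) =
    {zinbiel_poly a b c | a b c. a \<in> nwords X \<and> b \<in> nwords X \<and> c \<in> nwords X} \<union>
    {alt_poly2 x y | x y. x \<in> X \<and> y \<in> X \<and> (x, y) \<in> r} \<union>
    {alt_poly3 a x y | a x y. a \<in> nwords X \<and> even (wlen a) \<and> x \<in> X \<and> y \<in> X \<and> (x, y) \<in> r}"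
proof -
  have "({alt_poly2 x y | x y. x \<in> X \<and> y \<in> X \<and> (x, y) \<in> r} :: ('x nword \<Rightarrow>\<^sub>0 'k) set) =
      {wmon (Letter x \<diamondop> Letter y) + wmon (Letter y \<diamondop> Letter x) | x y.
        x \<in> X \<and> y \<in> X \<and> (x, y) \<in> r \<and> x \<noteq> y} \<union> {wmon (Letter x \<diamondop> Letter x) | x. x \<in> X}"
  proof (intro equalityI subsetI)
    fix p :: "'x nword \<Rightarrow>\<^sub>0 'k"
    assume "p \<in> {alt_poly2 x y | x y. x \<in> X \<and> y \<in> X \<and> (x, y) \<in> r}"
    then obtain x y where "p = alt_poly2 x y" "x \<in> X" "y \<in> X" "(x, y) \<in> r"
      by blast
    then show "p \<in> {wmon (Letter x \<diamondop> Letter y) + wmon (Letter y \<diamondop> Letter x) | x y.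
        x \<in> X \<and> y \<in> X \<and> (x, y) \<in> r \<and> x \<noteq> y} \<union> {wmon (Letter x \<diamondop> Letter x) | x. x \<in> X}"
      by (cases "x = y") (auto simp: alt_poly2_def)
  next
    fix p :: "'x nword \<Rightarrow>\<^sub>0 'k"
    assume "p \<in> {wmon (Letter x \<diamondop> Letter y) + wmon (Letter y \<diamondop> Letter x) | x y.
        x \<in> X \<and> y \<in> X \<and> (x, y) \<in> r \<and> x \<noteq> y} \<union> {wmon (Letter x \<diamondop> Letter x) | x. x \<in> X}"
    then obtain x y where "x \<in> X" "y \<in> X" "(x, y) \<in> r" "p = alt_poly2 x y"
      using refl_onD[OF refl_on] by (auto simp: alt_poly2_def)
    then show "p \<in> {alt_poly2 x y | x y. x \<in> X \<and> y \<in> X \<and> (x, y) \<in> r}"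
      by blast
  qed
  moreover have "({alt_poly3 a x y | a x y. a \<in> nwords X \<and> even (wlen a) \<and> x \<in> X \<and> y \<in> X \<and> (x, y) \<in> r}
      :: ('x nword \<Rightarrow>\<^sub>0 'k) set) =
     {wmon (a \<diamondop> Letter x \<diamondop> Letter y) + wmon (a \<diamondop> Letter y \<diamondop> Letter x) | a x y.
        a \<in> nwords X \<and> even (wlen a) \<and> x \<in> X \<and> y \<in> X \<and> (x, y) \<in> r \<and> x \<noteq> y} \<union>
     {wmon (a \<diamondop> Letter x \<diamondop> Letter x) | a x.
        a \<in> nwords X \<and> even (wlen a) \<and> x \<in> X}"
  proof (intro equalityI subsetI)
    fix p :: "'x nword \<Rightarrow>\<^sub>0 'k"
    assume "p \<in> {alt_poly3 a x y | a x y. a \<in> nwords X \<and> even (wlen a) \<and> x \<in> X \<and> y \<in> X \<and> (x, y) \<in> r}"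
    then obtain a x y where "p = alt_poly3 a x y" "a \<in> nwords X" "even (wlen a)"
      "x \<in> X" "y \<in> X" "(x, y) \<in> r"
      by blast
    then show "p \<in> {wmon (a \<diamondop> Letter x \<diamondop> Letter y) + wmon (a \<diamondop> Letter y \<diamondop> Letter x) | a x y.
        a \<in> nwords X \<and> even (wlen a) \<and> x \<in> X \<and> y \<in> X \<and> (x, y) \<in> r \<and> x \<noteq> y} \<union>
     {wmon (a \<diamondop> Letter x \<diamondop> Letter x) | a x.
        a \<in> nwords X \<and> even (wlen a) \<and> x \<in> X}"
      by (cases "x = y") (auto simp: alt_poly3_def)
  next
    fix p :: "'x nword \<Rightarrow>\<^sub>0 'k"
    assume "p \<in> {wmon (a \<diamondop> Letter x \<diamondop> Letter y) + wmon (a \<diamondop> Letter y \<diamondop> Letter x) | a x y.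
        a \<in> nwords X \<and> even (wlen a) \<and> x \<in> X \<and> y \<in> X \<and> (x, y) \<in> r \<and> x \<noteq> y} \<union>
     {wmon (a \<diamondop> Letter x \<diamondop> Letter x) | a x.
        a \<in> nwords X \<and> even (wlen a) \<and> x \<in> X}"
    then obtain a x y where "a \<in> nwords X" "even (wlen a)" "x \<in> X" "y \<in> X" "(x, y) \<in> r"
      "p = alt_poly3 a x y"
      using refl_onD[OF refl_on] by (auto simp: alt_poly3_def)
    then show "p \<in> {alt_poly3 a x y | a x y. a \<in> nwords X \<and> even (wlen a) \<and> x \<in> X \<and> y \<in> X \<and> (x, y) \<in> r}"
      by blast
  qed
  ultimately show ?thesis
    unfolding relations_def zinbiel_poly_def by (simp add: Un_assoc)
qed

lemma relations_cases [consumes 1, case_names zinbiel alt2 alt3]: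
  assumes "s \<in> relations r X"
  obtains a b c where "s = zinbiel_poly a b c" "a \<in> nwords X" "b \<in> nwords X" "c \<in> nwords X"
  | x y where "s = alt_poly2 x y" "x \<in> X" "y \<in> X" "(x, y) \<in> r"
  | a x y where "s = alt_poly3 a x y" "a \<in> nwords X" "even (wlen a)" "x \<in> X" "y \<in> X" "(x, y) \<in> r"
  using assms unfolding relations_eq by blast

lemma zinbiel_poly_relation:
  "\<lbrakk>a \<in> nwords X; b \<in> nwords X; c \<in> nwords X\<rbrakk> \<Longrightarrow> zinbiel_poly a b c \<in> relations r X"
  unfolding relations_eq by blast

lemma alt_poly2_relation:
  "\<lbrakk>x \<in> X; y \<in> X; (x, y) \<in> r\<rbrakk> \<Longrightarrow> alt_poly2 x y \<in> relations r X"
  unfolding relations_eq by blast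

lemma alt_poly3_relation:
  "\<lbrakk>a \<in> nwords X; even (wlen a); x \<in> X; y \<in> X; (x, y) \<in> r\<rbrakk> \<Longrightarrow> alt_poly3 a x y \<in> relations r X"
  unfolding relations_eq by blast

section \<open>Leading words and homogeneity of the relations\<close>

lemma monic_leadI:
  assumes "w \<in> nwords X" "\<And>v. v \<in> Poly_Mapping.keys h \<Longrightarrow> word_less r v w"
  shows "lead r (wmon w + h) = w \<and> monic r (wmon w + h :: 'x nword \<Rightarrow>\<^sub>0 'k::field)"
proof -
  have h: "Poly_Mapping.lookup h w = 0"
    using assms(2)[of w] by (auto simp: word_less_def in_keys_iff)
  have "lead r (wmon w + h) = w"
  proof (rule lead_eqI[OF antisym])
    show "w \<in> Poly_Mapping.keys (wmon w + h)"
      by (simp add: in_keys_iff lookup_add h)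
    show "word_less r v w" if "v \<in> Poly_Mapping.keys (wmon w + h)" "v \<noteq> w" for v
      using that assms(2)[of v] by (simp add: in_keys_iff lookup_add lookup_single)
    show "word_le r w w"
      by (rule word_le_refl[OF refl_on assms(1)])
  qed
  moreover have "wmon w + h \<noteq> 0"
  proof
    assume "wmon w + h = 0"
    then have "Poly_Mapping.lookup (wmon w + h) w = 0"
      by simp
    then show False
      by (simp add: lookup_add h)
  qed
  ultimately show ?thesis
    by (simp add: monic_def lookup_add h)
qed

lemma word_less_Letter: "\<lbrakk>(x, y) \<in> r; x \<noteq> y\<rbrakk> \<Longrightarrow> word_less r (Letter x) (Letter y)"
  by (simp add: word_less_def)

lemma word_less_App_shorter:
  assumes "wlen (u1 \<diamondop> u2) = wlen (v1 \<diamondop> v2)" "wlen u2 < wlen v2"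
  shows "word_less r (u1 \<diamondop> u2) (v1 \<diamondop> v2)"
  using assms by (intro word_less_App_right word_less_if_shorter)

text \<open>Both other monomials have the right factor \<open>c\<close>, which is shorter than
  \<open>bc\<close>; the left factors are never compared.\<close>

lemma zinbiel_poly_props:
  assumes "a \<in> nwords X" "b \<in> nwords X" "c \<in> nwords X"
  shows "lead r (zinbiel_poly a b c :: 'x nword \<Rightarrow>\<^sub>0 'k::field) = a \<diamondop> (b \<diamondop> c)"
    "monic r (zinbiel_poly a b c :: 'x nword \<Rightarrow>\<^sub>0 'k::field)"
proof -
  let ?h = "- wmon (a \<diamondop> b \<diamondop> c) - wmon (b \<diamondop> a \<diamondop> c) :: 'x nword \<Rightarrow>\<^sub>0 'k"
  have "Poly_Mapping.keys ?h \<subseteq> {a \<diamondop> b \<diamondop> c, b \<diamondop> a \<diamondop> c}"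
    by (auto simp: in_keys_iff lookup_minus lookup_single when_def split: if_splits)
  moreover have "word_less r (a \<diamondop> b \<diamondop> c) (a \<diamondop> (b \<diamondop> c))" "word_less r (b \<diamondop> a \<diamondop> c) (a \<diamondop> (b \<diamondop> c))"
    using wlen_pos[of b] by (simp_all add: word_less_App_shorter)
  ultimately have "lead r (wmon (a \<diamondop> (b \<diamondop> c)) + ?h) = a \<diamondop> (b \<diamondop> c) \<and> monic r (wmon (a \<diamondop> (b \<diamondop> c)) + ?h)"
    using assms by (intro monic_leadI) auto
  then show "lead r (zinbiel_poly a b c :: 'x nword \<Rightarrow>\<^sub>0 'k::field) = a \<diamondop> (b \<diamondop> c)"
    "monic r (zinbiel_poly a b c :: 'x nword \<Rightarrow>\<^sub>0 'k::field)"
    by (simp_all add: zinbiel_poly_def add_diff_eq)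
qed

text \<open>Right factors are compared first, so the larger letter \<open>y\<close> stands on the
  right in the leading word.\<close>

lemma alt_poly2_props:
  assumes "x \<in> X" "y \<in> X" "(x, y) \<in> r"
  shows "lead r (alt_poly2 x y :: 'x nword \<Rightarrow>\<^sub>0 'k::field) = Letter x \<diamondop> Letter y"
    "monic r (alt_poly2 x y :: 'x nword \<Rightarrow>\<^sub>0 'k::field)"
proof -
  have "word_less r v (Letter x \<diamondop> Letter y)"
    if "v \<in> Poly_Mapping.keys (if x = y then 0 else wmon (Letter y \<diamondop> Letter x) :: 'x nword \<Rightarrow>\<^sub>0 'k)" for v
    using that assms by (auto split: if_splits intro!: word_less_App_right word_less_Letter)
  then show "lead r (alt_poly2 x y :: 'x nword \<Rightarrow>\<^sub>0 'k::field) = Letter x \<diamondop> Letter y"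
    "monic r (alt_poly2 x y :: 'x nword \<Rightarrow>\<^sub>0 'k::field)"
    unfolding alt_poly2_def using assms monic_leadI by (metis nwords_App nwords_Letter)+
qed

lemma alt_poly3_props:
  assumes "a \<in> nwords X" "x \<in> X" "y \<in> X" "(x, y) \<in> r"
  shows "lead r (alt_poly3 a x y :: 'x nword \<Rightarrow>\<^sub>0 'k::field) = a \<diamondop> Letter x \<diamondop> Letter y"
    "monic r (alt_poly3 a x y :: 'x nword \<Rightarrow>\<^sub>0 'k::field)"
proof -
  have "word_less r v (a \<diamondop> Letter x \<diamondop> Letter y)"
    if "v \<in> Poly_Mapping.keys (if x = y then 0 else wmon (a \<diamondop> Letter y \<diamondop> Letter x) :: 'x nword \<Rightarrow>\<^sub>0 'k)" for v
    using that assms by (auto split: if_splits intro!: word_less_App_right word_less_Letter)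
  then show "lead r (alt_poly3 a x y :: 'x nword \<Rightarrow>\<^sub>0 'k::field) = a \<diamondop> Letter x \<diamondop> Letter y"
    "monic r (alt_poly3 a x y :: 'x nword \<Rightarrow>\<^sub>0 'k::field)"
    unfolding alt_poly3_def using assms monic_leadI by (metis nwords_App nwords_Letter)+
qed

text \<open>Replacing the leading word of a relation by another of its monomials thus keeps the
  length of the surrounding word, and with it the evenness required in (R3).\<close>

lemma relation_homogeneous:
  assumes "s \<in> relations r X" "v \<in> Poly_Mapping.keys (s :: 'x nword \<Rightarrow>\<^sub>0 'k::field)"
  shows "v \<in> nwords X \<and> wlen v = wlen (lead r s)"
  using assms(1)
proof (cases rule: relations_cases)
  case (zinbiel a b c)
  then have "v \<in> {a \<diamondop> (b \<diamondop> c), a \<diamondop> b \<diamondop> c, b \<diamondop> a \<diamondop> c}"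
    using assms(2)
    by (auto simp: zinbiel_poly_def in_keys_iff lookup_minus lookup_single when_def split: if_splits)
  then show ?thesis
    using zinbiel by (auto simp: zinbiel_poly_props)
next
  case (alt2 x y)
  then have "v \<in> {Letter x \<diamondop> Letter y, Letter y \<diamondop> Letter x}"
    using assms(2)
    by (auto simp: alt_poly2_def in_keys_iff lookup_add lookup_single when_def split: if_splits)
  then show ?thesis
    using alt2 by (auto simp: alt_poly2_props)
next
  case (alt3 a x y)
  then have "v \<in> {a \<diamondop> Letter x \<diamondop> Letter y, a \<diamondop> Letter y \<diamondop> Letter x}"
    using assms(2)
    by (auto simp: alt_poly3_def in_keys_iff lookup_add lookup_single when_def split: if_splits)
  then show ?thesis
    using alt3 by (auto simp: alt_poly3_props)
qed

lemma relation_monic: "s \<in> relations r X \<Longrightarrow> monic r (s :: 'x nword \<Rightarrow>\<^sub>0 'k::field)"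
  by (cases rule: relations_cases) (auto simp: zinbiel_poly_props alt_poly2_props alt_poly3_props)

lemma lead_relation_App: "s \<in> relations r X \<Longrightarrow> \<exists>u v. lead r (s :: 'x nword \<Rightarrow>\<^sub>0 'k::field) = u \<diamondop> v"
  by (cases rule: relations_cases) (auto simp: zinbiel_poly_props alt_poly2_props alt_poly3_props)

lemma lead_max:
  assumes "s \<in> relations r X" "v \<in> Poly_Mapping.keys (s :: 'x nword \<Rightarrow>\<^sub>0 'k::field)" "v \<noteq> lead r s"
  shows "word_less r v (lead r s)"
  using assms(1)
proof (cases rule: relations_cases)
  case (zinbiel a b c)
  then have "v \<in> {a \<diamondop> (b \<diamondop> c), a \<diamondop> b \<diamondop> c, b \<diamondop> a \<diamondop> c}"
    using assms(2)
    by (auto simp: zinbiel_poly_def in_keys_iff lookup_minus lookup_single when_def split: if_splits)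
  then show ?thesis
    using zinbiel assms(3) wlen_pos[of b] by (auto simp: zinbiel_poly_props intro!: word_less_App_shorter)
next
  case (alt2 x y)
  then have "v \<in> {Letter x \<diamondop> Letter y, Letter y \<diamondop> Letter x}"
    using assms(2)
    by (auto simp: alt_poly2_def in_keys_iff lookup_add lookup_single when_def split: if_splits)
  then show ?thesis
    using alt2 assms(3)
    by (auto simp: alt_poly2_props intro!: word_less_App_right word_less_Letter)
next
  case (alt3 a x y)
  then have "v \<in> {a \<diamondop> Letter x \<diamondop> Letter y, a \<diamondop> Letter y \<diamondop> Letter x}"
    using assms(2)
    by (auto simp: alt_poly3_def in_keys_iff lookup_add lookup_single when_def split: if_splits)
  then show ?thesis
    using alt3 assms(3)
    by (auto simp: alt_poly3_props intro!: word_less_App_right word_less_Letter)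
qed

text \<open>Totality of \<open>r\<close> decides which orientation is a relation; for
  \<open>x = y\<close> the sum is \<open>xx\<close> twice, which needs no division. \<open>T\<close>
  is arbitrary so that the graded ideal and the ideal of relations are both covered.\<close>

lemma anticomm_mem:
  assumes T: "poly.subspace (T :: ('x nword \<Rightarrow>\<^sub>0 'k::field) set)"
    and alt: "\<And>u v. \<lbrakk>u \<in> X; v \<in> X; (u, v) \<in> r\<rbrakk> \<Longrightarrow> alt_poly2 u v \<in> T" and xy: "x \<in> X" "y \<in> X"
  shows "wmon (Letter x \<diamondop> Letter y) + wmon (Letter y \<diamondop> Letter x) \<in> T"
proof -
  consider "x = y" | "x \<noteq> y" "(x, y) \<in> r" | "x \<noteq> y" "(y, x) \<in> r"
    using xy total_on unfolding total_on_def by blast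
  then show ?thesis
  proof cases
    case 1
    then have "alt_poly2 x y \<in> T"
      using alt[of x y] xy refl_onD[OF refl_on] by simp
    from poly.subspace_add[OF T this this] show ?thesis
      using 1 by (simp add: alt_poly2_def)
  next
    case 2
    then show ?thesis
      using alt[of x y] xy by (simp add: alt_poly2_def)
  next
    case 3
    then show ?thesis
      using alt[of y x] xy by (simp add: alt_poly2_def add.commute)
  qed
qed

text \<open>The common tool for compositions inside a word: \<open>s\<close> minus its leading word
  has only smaller monomials of the same length, and after substitution \<open>L\<close> sends them
  into \<open>T\<close>. In the applications \<open>L (wmon v)\<close> is a relation with
  \<open>v\<close> in a variable place.\<close>

lemma subst_relation_linear:
  assumes s: "s \<in> relations r X" and u: "u \<in> ctxs X"
    and L: "poly_linear (L :: ('x nword \<Rightarrow>\<^sub>0 'k::field) \<Rightarrow> ('x nword \<Rightarrow>\<^sub>0 'k))" and T: "poly.subspace T"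
    and smaller: "\<And>v. \<lbrakk>v \<in> nwords X; wlen v = wlen (word_subst u (lead r s));
        word_less r v (word_subst u (lead r s))\<rbrakk> \<Longrightarrow> L (wmon v) \<in> T"
  shows "L (poly_subst u s) - L (wmon (word_subst u (lead r s))) \<in> T"
proof -
  \<comment> \<open>The tail of \<open>s\<close>: being monic, \<open>s\<close> loses exactly its
    leading monomial.\<close>
  define p where "p = s - wmon (lead r s)"
  have "Poly_Mapping.lookup s (lead r s) = 1"
    using relation_monic[OF s] by (simp add: monic_def)
  then have keys: "v \<in> Poly_Mapping.keys s \<and> v \<noteq> lead r s" if "v \<in> Poly_Mapping.keys p" for v
    using that by (auto simp: p_def in_keys_iff lookup_minus lookup_single when_def split: if_splits)
  have mem: "L (poly_subst u (wmon v)) \<in> T" if "v \<in> Poly_Mapping.keys p" for v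
  proof -
    have "v \<in> nwords X" "wlen v = wlen (lead r s)" "word_less r v (lead r s)"
      using keys[OF that] relation_homogeneous[OF s, of v] lead_max[OF s, of v] by blast+
    then show ?thesis
      unfolding poly_subst_wmon using u
      by (intro smaller word_subst_nwords wlen_word_subst_cong word_less_word_subst)
  qed
  have "poly_linear (\<lambda>p. L (poly_subst u p))"
    using Vector_Spaces.linear_compose[OF poly_linear_poly_subst L] by (simp add: o_def)
  from poly_linear_in_subspace[OF this T mem] have "L (poly_subst u p) \<in> T" .
  then show ?thesis
    by (simp add: p_def poly.linear_diff[OF poly_linear_poly_subst] poly.linear_diff[OF L])
qed

abbreviation lower :: "'x nword \<Rightarrow> ('x nword \<Rightarrow>\<^sub>0 'k::field) set" where
  "lower w \<equiv> subst_span r X (relations r X) (\<lambda>v. word_less r v w)"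

abbreviation graded :: "nat \<Rightarrow> ('x nword \<Rightarrow>\<^sub>0 'k::field) set" where
  "graded n \<equiv> subst_span r X (relations r X) (\<lambda>v. wlen v = n)"

text \<open>Makes the parity facts available with control of degrees: members of
  \<open>graded n\<close> are combinations of substituted relations whose leading words have length
  exactly \<open>n\<close>, as \<open>graded_mult_lower\<close> requires.\<close>

lemma graded_zinbiel_ideal: "graded_zinbiel_ideal X graded"
proof
  show "poly.subspace (graded n :: ('x nword \<Rightarrow>\<^sub>0 'k::field) set)" for n
    by (rule subspace_subst_span)
  show "p \<star> wmon v \<in> graded (n + wlen v)" "wmon v \<star> p \<in> graded (wlen v + n)"
    if "p \<in> graded n" "v \<in> nwords X" for p :: "'x nword \<Rightarrow>\<^sub>0 'k::field" and n v
    using that by (auto intro: subst_span_mult_right subst_span_mult_left)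
  show "(zinbiel_poly a b c :: 'x nword \<Rightarrow>\<^sub>0 'k::field) \<in> graded (wlen a + wlen b + wlen c)"
    if "a \<in> nwords X" "b \<in> nwords X" "c \<in> nwords X" for a b c
    using subst_span_base[of Hole X "zinbiel_poly a b c :: 'x nword \<Rightarrow>\<^sub>0 'k" "relations r X"
        "\<lambda>v. wlen v = wlen a + wlen b + wlen c" r] that
    by (simp add: zinbiel_poly_props zinbiel_poly_relation)
  show "(wmon (Letter x \<diamondop> Letter y) + wmon (Letter y \<diamondop> Letter x) :: 'x nword \<Rightarrow>\<^sub>0 'k::field) \<in> graded 2"
    if "x \<in> X" "y \<in> X" for x y
  proof (rule anticomm_mem[OF subspace_subst_span _ that])
    show "(alt_poly2 u v :: 'x nword \<Rightarrow>\<^sub>0 'k) \<in> graded 2" if "u \<in> X" "v \<in> X" "(u, v) \<in> r" for u v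
      using subst_span_base[of Hole X "alt_poly2 u v :: 'x nword \<Rightarrow>\<^sub>0 'k" "relations r X"
          "\<lambda>v. wlen v = 2" r] that
      by (simp add: alt_poly2_props alt_poly2_relation)
  qed
qed

interpretation graded: graded_zinbiel_ideal X "graded :: nat \<Rightarrow> ('x nword \<Rightarrow>\<^sub>0 'k::field) set"
  by (rule graded_zinbiel_ideal)

section \<open>Compositions as combinations of relations below the leading word\<close>

lemmas lower_add = poly.subspace_add[OF subspace_subst_span]
  and lower_diff = poly.subspace_diff[OF subspace_subst_span]
  and lower_neg = poly.subspace_neg[OF subspace_subst_span]
  and lower_zero = poly.subspace_0[OF subspace_subst_span]

lemma zinbiel_poly_lower:
  assumes "a \<in> nwords X" "b \<in> nwords X" "c \<in> nwords X" "word_less r (a \<diamondop> (b \<diamondop> c)) w"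
  shows "(zinbiel_poly a b c :: 'x nword \<Rightarrow>\<^sub>0 'k::field) \<in> lower w"
  using subst_span_base[of Hole X "zinbiel_poly a b c :: 'x nword \<Rightarrow>\<^sub>0 'k" "relations r X"
      "\<lambda>v. word_less r v w" r] assms
  by (simp add: zinbiel_poly_props zinbiel_poly_relation)

lemma alt_poly3_lower:
  assumes "a \<in> nwords X" "even (wlen a)" "x \<in> X" "y \<in> X" "(x, y) \<in> r"
    "word_less r (a \<diamondop> Letter x \<diamondop> Letter y) w"
  shows "(alt_poly3 a x y :: 'x nword \<Rightarrow>\<^sub>0 'k::field) \<in> lower w"
  using subst_span_base[of Hole X "alt_poly3 a x y :: 'x nword \<Rightarrow>\<^sub>0 'k" "relations r X"
      "\<lambda>v. word_less r v w" r] assms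
  by (simp add: alt_poly3_props alt_poly3_relation)

lemma subst_lower:
  assumes "u \<in> ctxs X" "s \<in> relations r X" "word_less r (word_subst u (lead r s)) w"
  shows "poly_subst u (s :: 'x nword \<Rightarrow>\<^sub>0 'k::field) \<in> lower w"
  using assms by (intro subst_span_base)

text \<open>A word whose right factor is shorter than that of another word of the same length is
  smaller, whatever the left factors are; hence only the degree of \<open>h\<close> matters.\<close>

lemma graded_mult_lower:
  assumes "h \<in> graded n" "c \<in> nwords X" "n + wlen c = wlen (v1 \<diamondop> v2)" "wlen c < wlen v2"
  shows "h \<star> wmon c \<in> lower (v1 \<diamondop> v2)"
  using assms(2-) by (intro subst_span_mult_right[OF assms(1)] word_less_App_shorter) auto

text \<open>\<open>L v\<close> is (R1) with \<open>v\<close> in place of \<open>a\<close>, so the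
  smaller words produced by \<open>g\<close> contribute relations below \<open>a(bc)\<close>. The
  composition differs from \<open>L a - L P\<close> only by \<open>(Pb)c\<close> and
  \<open>(bP)c\<close>, whose right factor \<open>c\<close> is shorter than
  \<open>bc\<close>.\<close>

lemma composition_left:
  fixes g :: "'x nword \<Rightarrow>\<^sub>0 'k::field"
  assumes g: "g \<in> relations r X" and u: "u \<in> ctxs X" and a: "a = word_subst u (lead r g)"
    and X: "a \<in> nwords X" "b \<in> nwords X" "c \<in> nwords X"
  shows "zinbiel_poly a b c - poly_subst u g \<star> wmon (b \<diamondop> c) \<in> lower (a \<diamondop> (b \<diamondop> c))"
proof -
  define P where "P = poly_subst u g"
  define L where "L = (\<lambda>p :: 'x nword \<Rightarrow>\<^sub>0 'k. p \<star> wmon (b \<diamondop> c) - p \<star> wmon b \<star> wmon c - wmon b \<star> p \<star> wmon c)"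
  have lin: "poly_linear L"
    by (rule poly_linearI)
      (simp_all add: L_def poly_mult_simps poly_mult_smult_left poly_mult_smult_right
        poly.scale_right_diff_distrib)
  have L: "L (wmon v) = zinbiel_poly v b c" for v
    by (simp add: L_def zinbiel_poly_def)
  have 1: "L P - L (wmon a) \<in> lower (a \<diamondop> (b \<diamondop> c))"
    unfolding P_def a
  proof (rule subst_relation_linear[OF g u lin subspace_subst_span])
    fix v
    assume "v \<in> nwords X" "wlen v = wlen (word_subst u (lead r g))" "word_less r v (word_subst u (lead r g))"
    then show "L (wmon v) \<in> lower (word_subst u (lead r g) \<diamondop> (b \<diamondop> c))"
      unfolding L using X by (intro zinbiel_poly_lower word_less_App_left)
  qed
  have 2: "P \<star> wmon b \<star> wmon c \<in> lower (a \<diamondop> (b \<diamondop> c))"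
    using subst_lower[of "AppL (AppL u b) c" g "a \<diamondop> (b \<diamondop> c)"] g u X wlen_pos[of b]
    by (simp add: P_def a word_less_App_shorter)
  have 3: "wmon b \<star> P \<star> wmon c \<in> lower (a \<diamondop> (b \<diamondop> c))"
    using subst_lower[of "AppL (AppR b u) c" g "a \<diamondop> (b \<diamondop> c)"] g u X wlen_pos[of b]
    by (simp add: P_def a word_less_App_shorter)
  have "- (L P - L (wmon a)) - (P \<star> wmon b \<star> wmon c + wmon b \<star> P \<star> wmon c)
      \<in> lower (a \<diamondop> (b \<diamondop> c))"
    by (rule lower_diff[OF lower_neg[OF 1] lower_add[OF 2 3]])
  moreover have "- (L P - L (wmon a)) - (P \<star> wmon b \<star> wmon c + wmon b \<star> P \<star> wmon c) =
      zinbiel_poly a b c - P \<star> wmon (b \<diamondop> c)"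
    unfolding L by (simp add: L_def)
  ultimately show ?thesis
    by (simp add: P_def)
qed

lemma composition_middle:
  fixes g :: "'x nword \<Rightarrow>\<^sub>0 'k::field"
  assumes g: "g \<in> relations r X" and u: "u \<in> ctxs X" and b: "b = word_subst u (lead r g)"
    and X: "a \<in> nwords X" "b \<in> nwords X" "c \<in> nwords X"
  shows "zinbiel_poly a b c - wmon a \<star> (poly_subst u g \<star> wmon c) \<in> lower (a \<diamondop> (b \<diamondop> c))"
proof -
  define P where "P = poly_subst u g"
  define L where "L = (\<lambda>p :: 'x nword \<Rightarrow>\<^sub>0 'k. wmon a \<star> (p \<star> wmon c) - wmon a \<star> p \<star> wmon c - p \<star> wmon a \<star> wmon c)"
  have lin: "poly_linear L"
    by (rule poly_linearI)
      (simp_all add: L_def poly_mult_simps poly_mult_smult_left poly_mult_smult_right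
        poly.scale_right_diff_distrib)
  have L: "L (wmon v) = zinbiel_poly a v c" for v
    by (simp add: L_def zinbiel_poly_def)
  have 1: "L P - L (wmon b) \<in> lower (a \<diamondop> (b \<diamondop> c))"
    unfolding P_def b
  proof (rule subst_relation_linear[OF g u lin subspace_subst_span])
    fix v
    assume "v \<in> nwords X" "wlen v = wlen (word_subst u (lead r g))" "word_less r v (word_subst u (lead r g))"
    \<comment> \<open>\<open>v < b\<close> gives \<open>vc < bc\<close> at equal length, and this
      right factor decides the comparison of \<open>a(vc)\<close> with \<open>a(bc)\<close>.\<close>
    then show "L (wmon v) \<in> lower (a \<diamondop> (word_subst u (lead r g) \<diamondop> c))"
      unfolding L using X by (intro zinbiel_poly_lower word_less_App_left word_less_App_right) simp_all
  qed
  have 2: "wmon a \<star> P \<star> wmon c \<in> lower (a \<diamondop> (b \<diamondop> c))"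
    using subst_lower[of "AppL (AppR a u) c" g "a \<diamondop> (b \<diamondop> c)"] g u X wlen_pos[of b]
    by (simp add: P_def b word_less_App_shorter)
  have 3: "P \<star> wmon a \<star> wmon c \<in> lower (a \<diamondop> (b \<diamondop> c))"
    using subst_lower[of "AppL (AppL u a) c" g "a \<diamondop> (b \<diamondop> c)"] g u X wlen_pos[of b]
    by (simp add: P_def b word_less_App_shorter)
  have "- (L P - L (wmon b)) - (wmon a \<star> P \<star> wmon c + P \<star> wmon a \<star> wmon c)
      \<in> lower (a \<diamondop> (b \<diamondop> c))"
    by (rule lower_diff[OF lower_neg[OF 1] lower_add[OF 2 3]])
  moreover have "- (L P - L (wmon b)) - (wmon a \<star> P \<star> wmon c + P \<star> wmon a \<star> wmon c) =
      zinbiel_poly a b c - wmon a \<star> (P \<star> wmon c)"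
    unfolding L by (simp add: L_def)
  ultimately show ?thesis
    by (simp add: P_def)
qed

lemma composition_right:
  fixes g :: "'x nword \<Rightarrow>\<^sub>0 'k::field"
  assumes g: "g \<in> relations r X" and u: "u \<in> ctxs X" and c: "c = word_subst u (lead r g)"
    and X: "a \<in> nwords X" "b \<in> nwords X" "c \<in> nwords X"
  shows "zinbiel_poly a b c - wmon a \<star> (wmon b \<star> poly_subst u g) \<in> lower (a \<diamondop> (b \<diamondop> c))"
proof -
  define P where "P = poly_subst u g"
  define L where "L = (\<lambda>p :: 'x nword \<Rightarrow>\<^sub>0 'k. wmon a \<star> (wmon b \<star> p) - wmon (a \<diamondop> b) \<star> p - wmon (b \<diamondop> a) \<star> p)"
  have lin: "poly_linear L"
    by (rule poly_linearI)
      (simp_all add: L_def poly_mult_simps poly_mult_smult_left poly_mult_smult_right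
        poly.scale_right_diff_distrib)
  have L: "L (wmon v) = zinbiel_poly a b v" for v
    by (simp add: L_def zinbiel_poly_def)
  have 1: "L P - L (wmon c) \<in> lower (a \<diamondop> (b \<diamondop> c))"
    unfolding P_def c
  proof (rule subst_relation_linear[OF g u lin subspace_subst_span])
    fix v
    assume "v \<in> nwords X" "wlen v = wlen (word_subst u (lead r g))" "word_less r v (word_subst u (lead r g))"
    then show "L (wmon v) \<in> lower (a \<diamondop> (b \<diamondop> word_subst u (lead r g)))"
      unfolding L using X by (intro zinbiel_poly_lower word_less_App_right) simp_all
  qed
  \<comment> \<open>The right factor is now the substituted word \<open>c\<close> itself, still
    shorter than \<open>bc\<close>.\<close>
  have 2: "wmon (a \<diamondop> b) \<star> P \<in> lower (a \<diamondop> (b \<diamondop> c))"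
    using subst_lower[of "AppR (a \<diamondop> b) u" g "a \<diamondop> (b \<diamondop> c)"] g u X wlen_pos[of b]
    by (simp add: P_def c word_less_App_shorter)
  have 3: "wmon (b \<diamondop> a) \<star> P \<in> lower (a \<diamondop> (b \<diamondop> c))"
    using subst_lower[of "AppR (b \<diamondop> a) u" g "a \<diamondop> (b \<diamondop> c)"] g u X wlen_pos[of b]
    by (simp add: P_def c word_less_App_shorter)
  have "- (L P - L (wmon c)) - (wmon (a \<diamondop> b) \<star> P + wmon (b \<diamondop> a) \<star> P)
      \<in> lower (a \<diamondop> (b \<diamondop> c))"
    by (rule lower_diff[OF lower_neg[OF 1] lower_add[OF 2 3]])
  moreover have "- (L P - L (wmon c)) - (wmon (a \<diamondop> b) \<star> P + wmon (b \<diamondop> a) \<star> P) =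
      zinbiel_poly a b c - wmon a \<star> (wmon b \<star> P)"
    unfolding L by (simp add: L_def)
  ultimately show ?thesis
    by (simp add: P_def)
qed

text \<open>After the leading words cancel, (R1) is applied to the products \<open>(ab)(cd)\<close>,
  \<open>(ba)(cd)\<close>, \<open>a((bc)d)\<close> and \<open>a((cb)d)\<close>, all smaller than
  \<open>a(b(cd))\<close>. What is left has the form \<open>hd\<close>, and \<open>h\<close> has the
  degree of \<open>abc\<close>.\<close>

lemma composition_zinbiel_zinbiel:
  assumes X: "a \<in> nwords X" "b \<in> nwords X" "c \<in> nwords X" "d \<in> nwords X"
  shows "zinbiel_poly a b (c \<diamondop> d) - wmon a \<star> zinbiel_poly b c d
    \<in> (lower (a \<diamondop> (b \<diamondop> (c \<diamondop> d))) :: ('x nword \<Rightarrow>\<^sub>0 'k::field) set)"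
proof -
  let ?Z = "zinbiel_poly :: 'x nword \<Rightarrow> 'x nword \<Rightarrow> 'x nword \<Rightarrow> 'x nword \<Rightarrow>\<^sub>0 'k"
  let ?w = "a \<diamondop> (b \<diamondop> (c \<diamondop> d))"
  define n where "n = wlen a + wlen b + wlen c"
  have "?Z a b c \<in> graded n" "?Z a c b \<in> graded n" "?Z c a b \<in> graded n" "?Z c b a \<in> graded n"
    using X by (auto intro!: graded.zinbiel_poly' simp: n_def)
  \<comment> \<open>The terms \<open>(ac)b\<close> and \<open>(ca)b\<close> cancel in this
    combination, which leaves \<open>a*(b*c) - (a*b)*c\<close> for
    \<open>u*v = uv + vu\<close>.\<close>
  then have "?Z a b c + ?Z a c b - (?Z c a b + ?Z c b a) \<in> graded n"
    by (intro lower_add lower_diff)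
  then have 1: "(?Z a b c + ?Z a c b - (?Z c a b + ?Z c b a)) \<star> wmon d \<in> lower ?w"
    by (rule graded_mult_lower) (use X wlen_pos[of b] in \<open>simp_all add: n_def\<close>)
  have 2: "?Z (a \<diamondop> b) c d \<in> lower ?w" "?Z (b \<diamondop> a) c d \<in> lower ?w"
    using X wlen_pos[of b] by (auto intro!: zinbiel_poly_lower word_less_App_shorter)
  have inner: "word_less r (b \<diamondop> c \<diamondop> d) (b \<diamondop> (c \<diamondop> d))" "word_less r (c \<diamondop> b \<diamondop> d) (b \<diamondop> (c \<diamondop> d))"
    using wlen_pos[of c] by (simp_all add: word_less_App_shorter)
  have 3: "?Z a (b \<diamondop> c) d \<in> lower ?w" "?Z a (c \<diamondop> b) d \<in> lower ?w"
    using X inner by (auto intro!: zinbiel_poly_lower word_less_App_right)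
  from lower_add[OF 1 lower_diff[OF lower_add[OF 3] lower_add[OF 2]]] show ?thesis
    by (simp add: zinbiel_poly_def poly_mult_simps algebra_simps)
qed

text \<open>For \<open>x \<noteq> y\<close> the composition is, up to sign, (R1) at the smaller word
  \<open>a(yx)\<close> plus \<open>K x y + K y x\<close>; for \<open>x = y\<close> it is just
  \<open>K x x\<close>. For odd \<open>a\<close> each \<open>au + ua\<close> is in the graded ideal.
  For even \<open>a\<close> each \<open>ua\<close> is, and the terms \<open>(au)v\<close> form
  precisely (R3) or (R3').\<close>

lemma composition_zinbiel_alt2:
  assumes a: "a \<in> nwords X" and xy: "x \<in> X" "y \<in> X" "(x, y) \<in> r"
  shows "zinbiel_poly a (Letter x) (Letter y) - wmon a \<star> alt_poly2 x y
    \<in> (lower (a \<diamondop> (Letter x \<diamondop> Letter y)) :: ('x nword \<Rightarrow>\<^sub>0 'k::field) set)"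
    (is "_ \<in> lower ?w")
proof -
  let ?K = "\<lambda>u v. (wmon (a \<diamondop> Letter u) + wmon (Letter u \<diamondop> a)) \<star> wmon (Letter v) :: 'x nword \<Rightarrow>\<^sub>0 'k"
  have mult: "h \<star> wmon (Letter v) \<in> lower ?w"
    if "h \<in> graded (wlen a + 1)" "v \<in> X" for h :: "'x nword \<Rightarrow>\<^sub>0 'k" and v
    using that by (intro graded_mult_lower[of h "wlen a + 1"]) auto
  \<comment> \<open>The conditional mirrors \<open>alt_poly2\<close>: on the diagonal the relation
    is \<open>xx\<close> and not \<open>2xx\<close>, so only one copy may be counted.\<close>
  have K: "?K x y + (if x = y then 0 else ?K y x) \<in> lower ?w"
  proof (cases "even (wlen a)")
    case True
    then have *: "(wmon (Letter v \<diamondop> a) :: 'x nword \<Rightarrow>\<^sub>0 'k) \<in> graded (wlen a + 1)" if "v \<in> X" for v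
      using graded.odd_even_mem[of "Letter v" a] that a by (simp add: add.commute)
    have 1: "wmon (Letter u \<diamondop> a) \<star> (wmon (Letter v) :: 'x nword \<Rightarrow>\<^sub>0 'k) \<in> lower ?w"
      if "u \<in> X" "v \<in> X" for u v
      using mult[OF *[OF that(1)] that(2)] .
    have 2: "(alt_poly3 a x y :: 'x nword \<Rightarrow>\<^sub>0 'k) \<in> lower ?w"
      using True a xy by (intro alt_poly3_lower word_less_App_shorter) auto
    show ?thesis
    proof (cases "x = y")
      case True
      then show ?thesis
        using lower_add[OF 2 1[of x y]] xy by (simp add: alt_poly3_def poly_mult_simps)
    next
      case False
      then show ?thesis
        using lower_add[OF 2 lower_add[OF 1[of x y] 1[of y x]]] xy
        by (simp add: alt_poly3_def poly_mult_simps algebra_simps)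
    qed
  next
    case False
    have 1: "?K u v \<in> lower ?w" if "u \<in> X" "v \<in> X" for u v
      using False graded.odd_odd_mem[of a "Letter u"] a that by (intro mult) auto
    show ?thesis
      using lower_add[OF 1[of x y] 1[of y x]] 1[of x y] xy by (cases "x = y") simp_all
  qed
  show ?thesis
  proof (cases "x = y")
    case True
    then show ?thesis
      using lower_neg[OF K] by (simp add: zinbiel_poly_def alt_poly2_def poly_mult_simps algebra_simps)
  next
    case False
    have "(zinbiel_poly a (Letter y) (Letter x) :: 'x nword \<Rightarrow>\<^sub>0 'k) \<in> lower ?w"
      using False a xy
      by (intro zinbiel_poly_lower word_less_App_right word_less_Letter) auto
    from lower_neg[OF lower_add[OF this K]] False show ?thesis
      by (simp add: zinbiel_poly_def alt_poly2_def poly_mult_simps algebra_simps)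
  qed
qed

text \<open>The scheme of \<open>composition_zinbiel_alt2\<close> with \<open>du\<close> in place of
  the letter \<open>u\<close>; \<open>du\<close> is odd because \<open>d\<close> is even. For even
  \<open>a\<close>, (R1) turns \<open>a(du)\<close> into \<open>(ad)u + (da)u\<close>, so (R3) or
  (R3') is needed at the two even words \<open>ad\<close> and \<open>da\<close>.\<close>

lemma composition_zinbiel_alt3:
  assumes a: "a \<in> nwords X" and d: "d \<in> nwords X" "even (wlen d)" and xy: "x \<in> X" "y \<in> X" "(x, y) \<in> r"
  shows "zinbiel_poly a (d \<diamondop> Letter x) (Letter y) - wmon a \<star> alt_poly3 d x y
    \<in> (lower (a \<diamondop> (d \<diamondop> Letter x \<diamondop> Letter y)) :: ('x nword \<Rightarrow>\<^sub>0 'k::field) set)"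
    (is "_ \<in> lower ?w")
proof -
  let ?K = "\<lambda>u v. (wmon (a \<diamondop> (d \<diamondop> Letter u)) + wmon (d \<diamondop> Letter u \<diamondop> a)) \<star> wmon (Letter v)
    :: 'x nword \<Rightarrow>\<^sub>0 'k"
  define n where "n = wlen a + wlen d + 1"
  have mult: "h \<star> wmon (Letter v) \<in> lower ?w"
    if "h \<in> graded n" "v \<in> X" for h :: "'x nword \<Rightarrow>\<^sub>0 'k" and v
    using that wlen_pos[of d] by (intro graded_mult_lower[of h n]) (auto simp: n_def)
  have K: "?K x y + (if x = y then 0 else ?K y x) \<in> lower ?w"
  proof (cases "even (wlen a)")
    case True
    have *: "wmon (d \<diamondop> Letter u \<diamondop> a) \<in> (graded n :: ('x nword \<Rightarrow>\<^sub>0 'k) set)"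
      "zinbiel_poly a d (Letter u) \<in> (graded n :: ('x nword \<Rightarrow>\<^sub>0 'k) set)" if "u \<in> X" for u
      using graded.odd_even_mem[of "d \<diamondop> Letter u" a] graded.zinbiel_poly[of a d "Letter u"] that a d True
      by (simp_all add: n_def ac_simps)
    have 1: "(zinbiel_poly a d (Letter u) + wmon (d \<diamondop> Letter u \<diamondop> a)) \<star> wmon (Letter v)
        \<in> (lower ?w :: ('x nword \<Rightarrow>\<^sub>0 'k) set)"
      if "u \<in> X" "v \<in> X" for u v
      by (rule mult[OF lower_add[OF *(2)[OF that(1)] *(1)[OF that(1)]] that(2)])
    have 2: "(alt_poly3 (a \<diamondop> d) x y :: 'x nword \<Rightarrow>\<^sub>0 'k) \<in> lower ?w"
      "(alt_poly3 (d \<diamondop> a) x y :: 'x nword \<Rightarrow>\<^sub>0 'k) \<in> lower ?w"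
      using True a d xy wlen_pos[of d] by (auto intro!: alt_poly3_lower word_less_App_shorter)
    show ?thesis
    proof (cases "x = y")
      case True
      then show ?thesis
        using lower_add[OF lower_add[OF 2] 1[of x y]] xy
        by (simp add: alt_poly3_def zinbiel_poly_def poly_mult_simps algebra_simps)
    next
      case False
      then show ?thesis
        using lower_add[OF lower_add[OF 2] lower_add[OF 1[of x y] 1[of y x]]] xy
        by (simp add: alt_poly3_def zinbiel_poly_def poly_mult_simps algebra_simps)
    qed
  next
    case False
    have 1: "?K u v \<in> lower ?w" if "u \<in> X" "v \<in> X" for u v
      using False graded.odd_odd_mem[of a "d \<diamondop> Letter u"] a d that
      by (intro mult) (simp_all add: n_def ac_simps)
    show ?thesis
      using lower_add[OF 1[of x y] 1[of y x]] 1[of x y] xy by (cases "x = y") simp_all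
  qed
  show ?thesis
  proof (cases "x = y")
    case True
    then show ?thesis
      using lower_neg[OF K] by (simp add: zinbiel_poly_def alt_poly3_def poly_mult_simps algebra_simps)
  next
    case False
    have "(zinbiel_poly a (d \<diamondop> Letter y) (Letter x) :: 'x nword \<Rightarrow>\<^sub>0 'k) \<in> lower ?w"
      using False a d xy
      by (intro zinbiel_poly_lower word_less_App_right word_less_Letter) auto
    from lower_neg[OF lower_add[OF this K]] False show ?thesis
      by (simp add: zinbiel_poly_def alt_poly3_def poly_mult_simps algebra_simps)
  qed
qed

lemma composition_alt3:
  fixes g :: "'x nword \<Rightarrow>\<^sub>0 'k::field"
  assumes g: "g \<in> relations r X" and u: "u \<in> ctxs X" and a: "a = word_subst u (lead r g)"
    and X: "a \<in> nwords X" "even (wlen a)" and xy: "x \<in> X" "y \<in> X" "(x, y) \<in> r"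
  shows "alt_poly3 a x y - poly_subst u g \<star> wmon (Letter x) \<star> wmon (Letter y)
    \<in> lower (a \<diamondop> Letter x \<diamondop> Letter y)" (is "_ \<in> lower ?w")
proof -
  define P where "P = poly_subst u g"
  define swap where "swap = (\<lambda>p :: 'x nword \<Rightarrow>\<^sub>0 'k. if x = y then 0 else p \<star> wmon (Letter y) \<star> wmon (Letter x))"
  define L where "L = (\<lambda>p :: 'x nword \<Rightarrow>\<^sub>0 'k. p \<star> wmon (Letter x) \<star> wmon (Letter y) + swap p)"
  have lin: "poly_linear L"
    by (rule poly_linearI)
      (simp_all add: L_def swap_def poly_mult_simps poly_mult_smult_left poly.scale_right_distrib)
  have L: "L (wmon v) = alt_poly3 v x y" for v
    by (simp add: L_def swap_def alt_poly3_def)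
  have 1: "L P - L (wmon a) \<in> lower ?w"
    unfolding P_def a
  proof (rule subst_relation_linear[OF g u lin subspace_subst_span])
    fix v
    assume "v \<in> nwords X" "wlen v = wlen (word_subst u (lead r g))" "word_less r v (word_subst u (lead r g))"
    \<comment> \<open>\<open>v\<close> has the length of \<open>a\<close>, hence even length, so
      \<open>alt_poly3 v x y\<close> is again a relation.\<close>
    then show "L (wmon v) \<in> lower (word_subst u (lead r g) \<diamondop> Letter x \<diamondop> Letter y)"
      unfolding L using X xy a by (intro alt_poly3_lower word_less_App_left) simp_all
  qed
  \<comment> \<open>The swapped words end in \<open>x\<close>, which is smaller than
    \<open>y\<close>; on the diagonal \<open>swap\<close> is zero.\<close>
  have 2: "swap P \<in> lower ?w"
    using subst_lower[of "AppL (AppL u (Letter y)) (Letter x)" g ?w] g u xy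
    by (simp add: P_def swap_def a word_less_App_right word_less_Letter lower_zero)
  have "swap P - (L P - L (wmon a)) \<in> lower ?w"
    by (rule lower_diff[OF 2 1])
  moreover have "swap P - (L P - L (wmon a)) = alt_poly3 a x y - P \<star> wmon (Letter x) \<star> wmon (Letter y)"
    unfolding L by (simp add: L_def)
  ultimately show ?thesis
    by (simp add: P_def)
qed

section \<open>All positions of one leading word inside another\<close>

lemma word_subst_lead_neq_Letter:
  "s \<in> relations r X \<Longrightarrow> word_subst u (lead r (s :: 'x nword \<Rightarrow>\<^sub>0 'k::field)) \<noteq> Letter x"
  using lead_relation_App[of s] by (cases u) auto

text \<open>The shapes \<open>a(bc)\<close>, \<open>xy\<close> and \<open>(ax)y\<close> differ in
  which factors are letters, and each determines its parameters. A composition at the whole word is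
  therefore \<open>f - f\<close>.\<close>

lemma lead_inj:
  assumes "f \<in> relations r X" "g \<in> relations r X" "lead r f = lead r (g :: 'x nword \<Rightarrow>\<^sub>0 'k::field)"
  shows "f = g"
  using assms(1)
proof (cases rule: relations_cases)
  case (zinbiel a b c)
  show ?thesis
    using assms(2) by (cases rule: relations_cases)
      (use zinbiel assms(3) in \<open>auto simp: zinbiel_poly_props alt_poly2_props alt_poly3_props\<close>)
next
  case (alt2 x y)
  show ?thesis
    using assms(2) by (cases rule: relations_cases)
      (use alt2 assms(3) in \<open>auto simp: zinbiel_poly_props alt_poly2_props alt_poly3_props\<close>)
next
  case (alt3 a x y)
  show ?thesis
    using assms(2) by (cases rule: relations_cases)
      (use alt3 assms(3) in \<open>auto simp: zinbiel_poly_props alt_poly2_props alt_poly3_props\<close>)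
qed

lemma composition_lower:
  fixes f g :: "'x nword \<Rightarrow>\<^sub>0 'k::field"
  assumes f: "f \<in> relations r X" and g: "g \<in> relations r X" and u: "u \<in> ctxs X"
    and lead: "lead r f = word_subst u (lead r g)"
  shows "f - poly_subst u g \<in> lower (lead r f)"
proof (cases u)
  case Hole
  then show ?thesis
    using lead_inj[OF f g] lead by (simp add: lower_zero)
next
  case (AppL u1 v)
  show ?thesis
    using f
  proof (cases rule: relations_cases)
    case (zinbiel a b c)
    then show ?thesis
      using composition_left[OF g, of u1 a b c] AppL u lead by (simp add: zinbiel_poly_props)
  next
    case (alt2 x y)
    then show ?thesis
      using word_subst_lead_neq_Letter[OF g, of u1 x] AppL lead by (auto simp: alt_poly2_props)
  next
    case (alt3 a x y)
    then have ax: "a \<diamondop> Letter x = word_subst u1 (lead r g)" and v: "v = Letter y"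
      and w: "lead r f = a \<diamondop> Letter x \<diamondop> Letter y"
      using AppL lead by (simp_all add: alt_poly3_props)
    show ?thesis
    proof (cases u1)
      \<comment> \<open>Here \<open>ax\<close> would itself be a leading word ending in a letter.
        Then \<open>a\<close> would be a letter or a product \<open>dz\<close> with \<open>d\<close>
        even and \<open>z\<close> a letter, of odd length in both cases; the evenness of
        \<open>a\<close> excludes this overlap.\<close>
      case Hole
      show ?thesis
        using g by (cases rule: relations_cases)
          (use alt3 ax Hole in \<open>auto simp: zinbiel_poly_props alt_poly2_props alt_poly3_props\<close>)
    next
      case (AppL u2 v2)
      then show ?thesis
        using composition_alt3[OF g, of u2 a x y] alt3 ax v w u \<open>u = AppL u1 v\<close> by simp
    next
      case (AppR v2 u2)
      then show ?thesis
        using word_subst_lead_neq_Letter[OF g, of u2 x] ax by auto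
    qed
  qed
next
  case (AppR v u1)
  show ?thesis
    using f
  proof (cases rule: relations_cases)
    case (zinbiel a b c)
    then have v: "v = a" and bc: "b \<diamondop> c = word_subst u1 (lead r g)"
      and w: "lead r f = a \<diamondop> (b \<diamondop> c)"
      using AppR lead by (simp_all add: zinbiel_poly_props)
    show ?thesis
    proof (cases u1)
      case Hole
      show ?thesis
        using g
      proof (cases rule: relations_cases)
        case (zinbiel a' b' c')
        then show ?thesis
          using composition_zinbiel_zinbiel[of a b b' c'] Hole bc v w AppR
            \<open>f = zinbiel_poly a b c\<close> \<open>a \<in> nwords X\<close> \<open>b \<in> nwords X\<close>
          by (simp add: zinbiel_poly_props)
      next
        case (alt2 x y)
        then show ?thesis
          using composition_zinbiel_alt2[of a x y] Hole bc v w AppR zinbiel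
          by (simp add: alt_poly2_props)
      next
        case (alt3 d x y)
        then show ?thesis
          using composition_zinbiel_alt3[of a d x y] Hole bc v w AppR zinbiel
          by (simp add: alt_poly3_props)
      qed
    next
      case (AppL u2 v2)
      then show ?thesis
        using composition_middle[OF g, of u2 b a c] zinbiel bc v w u \<open>u = AppR v u1\<close> by simp
    next
      case (AppR v2 u2)
      then show ?thesis
        using composition_right[OF g, of u2 c a b] zinbiel bc v w u \<open>u = AppR v u1\<close> by simp
    qed
  next
    case (alt2 x y)
    then show ?thesis
      using word_subst_lead_neq_Letter[OF g, of u1 y] AppR lead by (auto simp: alt_poly2_props)
  next
    case (alt3 a x y)
    then show ?thesis
      using word_subst_lead_neq_Letter[OF g, of u1 y] AppR lead by (auto simp: alt_poly3_props)
  qed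
qed

theorem GS_basis_relations: "GS_basis r X (relations r X :: ('x nword \<Rightarrow>\<^sub>0 'k::field) set)"
  unfolding GS_basis_def
proof (intro conjI ballI impI)
  show "relations r X \<subseteq> carrier (free_alg X :: ('k, 'x nword \<Rightarrow>\<^sub>0 'k) module)"
    using relation_homogeneous by (fastforce simp: free_alg_def)
  show "trivial_mod r X (relations r X) (lead r f) (f - poly_subst u g)"
    if "f \<in> relations r X" "g \<in> relations r X" "u \<in> ctxs X" "lead r f = word_subst u (lead r g)"
    for f g :: "'x nword \<Rightarrow>\<^sub>0 'k" and u
    by (rule trivial_mod_if_subst_span[OF composition_lower[OF that]])
qed (rule relation_monic)

end

section \<open>Quotients of algebras by ideals\<close>

locale algebra_with_ideal = nonassoc_algebra K M
  for K :: "'k ring" and M :: "('k, 'v) module" (structure) +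
  fixes I :: "'v set"
  assumes ideal: "alg_ideal K I M"
begin

lemma ideal_subset: "I \<subseteq> carrier M"
  and ideal_add: "\<lbrakk>x \<in> I; y \<in> I\<rbrakk> \<Longrightarrow> x \<oplus> y \<in> I"
  and ideal_zero: "\<zero> \<in> I"
  and ideal_smult: "\<lbrakk>\<alpha> \<in> carrier K; x \<in> I\<rbrakk> \<Longrightarrow> \<alpha> \<odot>\<^bsub>M\<^esub> x \<in> I"
  and ideal_mult: "\<lbrakk>a \<in> carrier M; x \<in> I\<rbrakk> \<Longrightarrow> a \<otimes> x \<in> I" "\<lbrakk>a \<in> carrier M; x \<in> I\<rbrakk> \<Longrightarrow> x \<otimes> a \<in> I"
  using ideal by (auto simp: alg_ideal_def VectorSpace.subspace_def LinearCombinations.submodule_def)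

lemma ideal_carrier: "x \<in> I \<Longrightarrow> x \<in> carrier M"
  using ideal_subset by blast

lemma ideal_neg: "x \<in> I \<Longrightarrow> \<ominus> x \<in> I"
  using ideal_smult[of "\<ominus>\<^bsub>K\<^esub> \<one>\<^bsub>K\<^esub>" x] ideal_carrier[of x] by (simp add: smult_l_minus)

sublocale coset: abelian_subgroup I M
proof (rule abelian_subgroupI3)
  show "additive_subgroup I M"
    using ideal_subset ideal_add ideal_zero ideal_neg
    by (intro additive_subgroup.intro add.subgroupI) (auto simp: a_inv_def)
  show "abelian_group M" ..
qed

abbreviation proj :: "'v \<Rightarrow> 'v set" where
  "proj x \<equiv> I +> x"

lemma mem_proj: "z \<in> proj x \<longleftrightarrow> (\<exists>h\<in>I. z = h \<oplus> x)"
  by (auto simp: a_r_coset_def')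

lemma proj_eqI: "\<lbrakk>z \<in> proj x; x \<in> carrier M\<rbrakk> \<Longrightarrow> proj z = proj x"
  using a_repr_independence[of z I x] coset.a_subgroup by simp

lemma quot_carrier: "carrier (alg_quot M I) = proj ` carrier M"
  by (auto simp: alg_quot_def FactRing_def A_RCOSETS_def')

lemma quot_zero: "zero (alg_quot M I) = proj \<zero>"
  using proj_eqI[of \<zero> \<zero>] ideal_zero ideal_carrier
  by (auto simp: alg_quot_def FactRing_def a_r_coset_def')

lemma quot_add: "\<lbrakk>x \<in> carrier M; y \<in> carrier M\<rbrakk> \<Longrightarrow> proj x \<oplus>\<^bsub>alg_quot M I\<^esub> proj y = proj (x \<oplus> y)"
  by (simp add: alg_quot_def FactRing_def coset.a_rcos_sum)

text \<open>The product of cosets is a union over representatives. It collapses because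
  \<open>I\<close> is two-sided: \<open>(h + x)(k + y)\<close> differs from \<open>xy\<close> by
  \<open>hk + hy + xk\<close>.\<close>

lemma quot_mult:
  assumes x: "x \<in> carrier M" and y: "y \<in> carrier M"
  shows "proj x \<otimes>\<^bsub>alg_quot M I\<^esub> proj y = proj (x \<otimes> y)"
proof -
  have *: "proj (a \<otimes> b) = proj (x \<otimes> y)" if a: "a \<in> proj x" and b: "b \<in> proj y" for a b
  proof -
    obtain h k where hk: "h \<in> I" "k \<in> I" and ab: "a = h \<oplus> x" "b = k \<oplus> y"
      using a b mem_proj by auto
    note [simp] = ideal_carrier[OF hk(1)] ideal_carrier[OF hk(2)] x y
    have "a \<otimes> b = (h \<otimes> k \<oplus> h \<otimes> y \<oplus> x \<otimes> k) \<oplus> x \<otimes> y"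
      unfolding ab by (simp add: prod_add_left prod_add_right prod_closed a_ac)
    moreover have "h \<otimes> k \<oplus> h \<otimes> y \<oplus> x \<otimes> k \<in> I"
      by (intro ideal_add ideal_mult hk) simp_all
    ultimately have "a \<otimes> b \<in> proj (x \<otimes> y)"
      using mem_proj by blast
    then show ?thesis
      using x y by (intro proj_eqI prod_closed)
  qed
  have "proj x \<otimes>\<^bsub>alg_quot M I\<^esub> proj y = (\<Union>a\<in>proj x. \<Union>b\<in>proj y. proj (a \<otimes> b))"
    by (simp add: alg_quot_def FactRing_def rcoset_mult_def)
  also have "\<dots> = (\<Union>a\<in>proj x. \<Union>b\<in>proj y. proj (x \<otimes> y))"
    using * by simp
  also have "\<dots> = proj (x \<otimes> y)"
    using coset.a_rcos_self[OF x] coset.a_rcos_self[OF y] by auto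
  finally show ?thesis .
qed

lemma quot_smult:
  assumes \<alpha>: "\<alpha> \<in> carrier K" and x: "x \<in> carrier M"
  shows "\<alpha> \<odot>\<^bsub>alg_quot M I\<^esub> proj x = proj (\<alpha> \<odot>\<^bsub>M\<^esub> x)"
proof -
  have *: "proj (\<alpha> \<odot>\<^bsub>M\<^esub> a) = proj (\<alpha> \<odot>\<^bsub>M\<^esub> x)" if a: "a \<in> proj x" for a
  proof -
    obtain h where h: "h \<in> I" "a = h \<oplus> x"
      using a mem_proj by auto
    then have "\<alpha> \<odot>\<^bsub>M\<^esub> a = \<alpha> \<odot>\<^bsub>M\<^esub> h \<oplus> \<alpha> \<odot>\<^bsub>M\<^esub> x"
      using \<alpha> x ideal_carrier by (simp add: smult_r_distr)
    then have "\<alpha> \<odot>\<^bsub>M\<^esub> a \<in> proj (\<alpha> \<odot>\<^bsub>M\<^esub> x)"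
      using mem_proj ideal_smult[OF \<alpha> h(1)] by blast
    then show ?thesis
      using \<alpha> x by (intro proj_eqI smult_closed)
  qed
  have "\<alpha> \<odot>\<^bsub>alg_quot M I\<^esub> proj x = (\<Union>a\<in>proj x. proj (\<alpha> \<odot>\<^bsub>M\<^esub> a))"
    by (simp add: alg_quot_def)
  also have "\<dots> = (\<Union>a\<in>proj x. proj (\<alpha> \<odot>\<^bsub>M\<^esub> x))"
    using * by simp
  also have "\<dots> = proj (\<alpha> \<odot>\<^bsub>M\<^esub> x)"
    using coset.a_rcos_self[OF x] by auto
  finally show ?thesis .
qed

lemmas quot_simps = quot_carrier quot_zero quot_add quot_mult quot_smult

lemma nonassoc_algebra_quot: "nonassoc_algebra K (alg_quot M I)"
proof -
  have "vectorspace K (alg_quot M I)"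
  proof (rule vs_criteria)
    show "field K" ..
    show "\<forall>v\<in>carrier (alg_quot M I). \<exists>w\<in>carrier (alg_quot M I). v \<oplus>\<^bsub>alg_quot M I\<^esub> w = \<zero>\<^bsub>alg_quot M I\<^esub>"
    proof
      fix v
      assume "v \<in> carrier (alg_quot M I)"
      then obtain x where x: "x \<in> carrier M" "v = proj x"
        by (auto simp: quot_carrier)
      then have "v \<oplus>\<^bsub>alg_quot M I\<^esub> proj (\<ominus> x) = \<zero>\<^bsub>alg_quot M I\<^esub>"
        by (simp add: quot_simps r_neg)
      then show "\<exists>w\<in>carrier (alg_quot M I). v \<oplus>\<^bsub>alg_quot M I\<^esub> w = \<zero>\<^bsub>alg_quot M I\<^esub>"
        using x by (auto simp: quot_carrier)
    qed
  qed (auto simp: quot_simps a_ac smult_l_distr smult_r_distr smult_assoc1)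
  then show ?thesis
    by (intro nonassoc_algebra.intro nonassoc_algebra_axioms.intro)
      (auto simp: quot_simps prod_closed prod_add_left prod_add_right prod_smult_left prod_smult_right)
qed

lemma proj_alg_hom: "proj \<in> alg_hom K M (alg_quot M I)"
  by (auto simp: alg_hom_def LinearCombinations.module_hom_def quot_simps)

text \<open>Vanishing on \<open>I\<close> makes the value independent of the representative picked
  by \<open>SOME\<close>. Restriction to the carrier supplies the extensionality in terms of which
  \<open>univ_envelope\<close> phrases uniqueness.\<close>

lemma quot_hom_factor:
  assumes \<psi>: "\<psi> \<in> alg_hom K M Z" and Z: "nonassoc_algebra K Z"
    and ker: "\<And>x. x \<in> I \<Longrightarrow> \<psi> x = \<zero>\<^bsub>Z\<^esub>"
  shows "\<exists>\<theta>\<in>alg_hom K (alg_quot M I) Z \<inter> extensional (carrier (alg_quot M I)).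
    \<forall>x\<in>carrier M. \<theta> (proj x) = \<psi> x"
proof -
  interpret Z: nonassoc_algebra K Z
    by (rule Z)
  define \<theta> where "\<theta> = restrict (\<lambda>C. \<psi> (SOME x. x \<in> carrier M \<and> C = proj x)) (carrier (alg_quot M I))"
  have closed: "\<psi> x \<in> carrier Z" if "x \<in> carrier M" for x
    using \<psi> that by (auto simp: alg_hom_def LinearCombinations.module_hom_def)
  have add: "\<psi> (x \<oplus> y) = \<psi> x \<oplus>\<^bsub>Z\<^esub> \<psi> y" if "x \<in> carrier M" "y \<in> carrier M" for x y
    using \<psi> that by (auto simp: alg_hom_def LinearCombinations.module_hom_def)
  have eq: "\<psi> x = \<psi> y" if "x \<in> carrier M" "y \<in> carrier M" "proj x = proj y" for x y
  proof -
    have "x \<in> proj y"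
      using coset.a_rcos_self[OF that(1)] that(3) by simp
    then obtain h where h: "h \<in> I" "x = h \<oplus> y"
      using mem_proj by auto
    then show ?thesis
      using ker[OF h(1)] closed[OF that(2)] that(2) ideal_carrier[OF h(1)] by (simp add: add)
  qed
  have \<theta>: "\<theta> (proj x) = \<psi> x" if "x \<in> carrier M" for x
  proof -
    define y where "y = (SOME y. y \<in> carrier M \<and> proj x = proj y)"
    have "y \<in> carrier M \<and> proj x = proj y"
      unfolding y_def by (rule someI[of _ x]) (simp add: that)
    then have "\<psi> x = \<psi> y"
      using that eq by blast
    moreover have "\<theta> (proj x) = \<psi> y"
      using that by (simp add: \<theta>_def quot_carrier y_def)
    ultimately show ?thesis
      by simp
  qed
  have "\<theta> \<in> alg_hom K (alg_quot M I) Z"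
    using \<psi> by (auto simp: alg_hom_def LinearCombinations.module_hom_def quot_simps \<theta> prod_closed)
  moreover have "\<theta> \<in> extensional (carrier (alg_quot M I))"
    by (simp add: \<theta>_def)
  ultimately show ?thesis
    using \<theta> by blast
qed

end

section \<open>Linear extension of functions on words\<close>

definition lin_ext :: "('k::field, 'v) module \<Rightarrow> ('x nword \<Rightarrow> 'v) \<Rightarrow> ('x nword \<Rightarrow>\<^sub>0 'k) \<Rightarrow> 'v" where
  "lin_ext V e p = (\<Oplus>\<^bsub>V\<^esub>w\<in>Poly_Mapping.keys p. Poly_Mapping.lookup p w \<odot>\<^bsub>V\<^esub> e w)"

text \<open>\<open>W\<close> is a parameter because two cases occur: all words over
  \<open>X\<close>, for evaluation homomorphisms, and letters alone, for coordinates with respect to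
  a basis.\<close>

locale word_family =
  fixes V :: "('k::field, 'v) module" (structure) and W :: "'x nword set" and e :: "'x nword \<Rightarrow> 'v"
  assumes vectorspace: "vectorspace class_ring V"
    and e_closed: "w \<in> W \<Longrightarrow> e w \<in> carrier V"
begin

sublocale vectorspace class_ring V
  by (rule vectorspace)

lemma smult_UNIV [simp]: "x \<in> carrier V \<Longrightarrow> \<alpha> \<odot>\<^bsub>V\<^esub> x \<in> carrier V"
  using smult_closed by simp

lemma lin_ext_superset:
  assumes "finite B" "Poly_Mapping.keys p \<subseteq> B" "B \<subseteq> W"
  shows "lin_ext V e p = (\<Oplus>w\<in>B. Poly_Mapping.lookup p w \<odot>\<^bsub>V\<^esub> e w)"
  unfolding lin_ext_def
proof (rule add.finprod_mono_neutral_cong_left)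
  show "Poly_Mapping.lookup p w \<odot>\<^bsub>V\<^esub> e w = \<zero>" if "w \<in> B - Poly_Mapping.keys p" for w
    using that assms e_closed smult_l_null[of "e w"] by (auto simp: in_keys_iff)
qed (use assms e_closed in auto)

lemma lin_ext_closed: "Poly_Mapping.keys p \<subseteq> W \<Longrightarrow> lin_ext V e p \<in> carrier V"
  unfolding lin_ext_def using e_closed by (intro finsum_closed) auto

lemma lin_ext_add:
  assumes "Poly_Mapping.keys p \<subseteq> W" "Poly_Mapping.keys q \<subseteq> W"
  shows "lin_ext V e (p + q) = lin_ext V e p \<oplus> lin_ext V e q"
proof -
  define B where "B = Poly_Mapping.keys p \<union> Poly_Mapping.keys q"
  have B: "finite B" "B \<subseteq> W" "Poly_Mapping.keys (p + q) \<subseteq> B"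
    "Poly_Mapping.keys p \<subseteq> B" "Poly_Mapping.keys q \<subseteq> B"
    using assms Poly_Mapping.keys_add[of p q] by (auto simp: B_def)
  have "lin_ext V e (p + q) = (\<Oplus>w\<in>B. Poly_Mapping.lookup p w \<odot>\<^bsub>V\<^esub> e w \<oplus> Poly_Mapping.lookup q w \<odot>\<^bsub>V\<^esub> e w)"
    unfolding lin_ext_superset[OF B(1,3,2)]
    using B e_closed smult_l_distr by (intro finsum_cong') (auto simp: lookup_add)
  also have "\<dots> = lin_ext V e p \<oplus> lin_ext V e q"
    unfolding lin_ext_superset[OF B(1,4,2)] lin_ext_superset[OF B(1,5,2)]
    using B e_closed by (intro finsum_addf) auto
  finally show ?thesis .
qed

lemma lin_ext_smult:
  assumes "Poly_Mapping.keys p \<subseteq> W"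
  shows "lin_ext V e (poly_smult \<alpha> p) = \<alpha> \<odot>\<^bsub>V\<^esub> lin_ext V e p"
proof -
  have B: "finite (Poly_Mapping.keys p)" "Poly_Mapping.keys (poly_smult \<alpha> p) \<subseteq> Poly_Mapping.keys p"
    using keys_poly_smult by auto
  have "lin_ext V e (poly_smult \<alpha> p) =
      (\<Oplus>w\<in>Poly_Mapping.keys p. \<alpha> \<odot>\<^bsub>V\<^esub> (Poly_Mapping.lookup p w \<odot>\<^bsub>V\<^esub> e w))"
    unfolding lin_ext_superset[OF B assms]
    using assms e_closed smult_assoc1 by (intro finsum_cong') auto
  also have "\<dots> = \<alpha> \<odot>\<^bsub>V\<^esub> lin_ext V e p"
    unfolding lin_ext_def using assms e_closed by (intro finsum_smult[symmetric]) auto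
  finally show ?thesis .
qed

lemma lin_ext_single:
  assumes "w \<in> W"
  shows "lin_ext V e (Poly_Mapping.single w \<alpha>) = \<alpha> \<odot>\<^bsub>V\<^esub> e w"
  using assms e_closed by (subst lin_ext_superset[of "{w}"]) auto

lemma lin_ext_wmon: "w \<in> W \<Longrightarrow> lin_ext V e (wmon w) = e w"
  using smult_one[of "e w"] e_closed by (simp add: lin_ext_single)

lemma lin_ext_0: "lin_ext V e 0 = \<zero>"
  by (simp add: lin_ext_def)

end

section \<open>The free algebra and evaluation homomorphisms\<close>

lemma free_alg_simps [simp]:
  "carrier (free_alg X) = {f. Poly_Mapping.keys f \<subseteq> nwords X}"
  "mult (free_alg X) = poly_mult" "zero (free_alg X) = 0" "add (free_alg X) = (+)"
  "smult (free_alg X) = poly_smult"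
  by (simp_all add: free_alg_def)

lemma keys_poly_mult:
  assumes "Poly_Mapping.keys f \<subseteq> nwords X" "Poly_Mapping.keys g \<subseteq> nwords X"
  shows "Poly_Mapping.keys (f \<star> g) \<subseteq> nwords X"
proof
  fix w
  assume w: "w \<in> Poly_Mapping.keys (f \<star> g)"
  show "w \<in> nwords X"
  proof (rule ccontr)
    assume "w \<notin> nwords X"
    then have "u \<diamondop> v \<noteq> w" if "u \<in> Poly_Mapping.keys f" "v \<in> Poly_Mapping.keys g" for u v
      using that assms by auto
    then have "Poly_Mapping.lookup (f \<star> g) w = 0"
      by (simp add: poly_mult_def lookup_sum lookup_single when_def)
    then show False
      using w by (simp add: in_keys_iff)
  qed
qed

lemma keys_poly_add:
  "\<lbrakk>Poly_Mapping.keys f \<subseteq> W; Poly_Mapping.keys g \<subseteq> W\<rbrakk> \<Longrightarrow> Poly_Mapping.keys (f + g) \<subseteq> W"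
  using Poly_Mapping.keys_add[of f g] by blast

lemma keys_poly_smult_subset: "Poly_Mapping.keys f \<subseteq> W \<Longrightarrow> Poly_Mapping.keys (poly_smult \<alpha> f) \<subseteq> W"
  using keys_poly_smult by blast

lemma nonassoc_algebra_free_alg:
  "nonassoc_algebra class_ring (free_alg X :: ('k::field, 'x nword \<Rightarrow>\<^sub>0 'k) module)"
proof -
  have "vectorspace class_ring (free_alg X :: ('k::field, 'x nword \<Rightarrow>\<^sub>0 'k) module)"
  proof (rule vs_criteria)
    show "field (class_ring :: 'k ring)"
      by (rule class_field)
    show "\<forall>v\<in>carrier (free_alg X :: ('k, 'x nword \<Rightarrow>\<^sub>0 'k) module). \<exists>w\<in>carrier (free_alg X).
        v \<oplus>\<^bsub>free_alg X\<^esub> w = \<zero>\<^bsub>free_alg X\<^esub>"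
    proof
      fix v :: "'x nword \<Rightarrow>\<^sub>0 'k"
      assume "v \<in> carrier (free_alg X)"
      then show "\<exists>w\<in>carrier (free_alg X). v \<oplus>\<^bsub>free_alg X\<^esub> w = \<zero>\<^bsub>free_alg X\<^esub>"
        by (intro bexI[of _ "- v"]) simp_all
    qed
  qed (simp_all add: keys_poly_add keys_poly_smult_subset add.assoc add.commute
      poly.scale_left_distrib poly.scale_right_distrib)
  then show ?thesis
    by (intro nonassoc_algebra.intro nonassoc_algebra_axioms.intro)
      (simp_all add: keys_poly_mult poly_mult_add_left poly_mult_add_right
        poly_mult_smult_left poly_mult_smult_right)
qed

text \<open>Every intermediate support stays inside \<open>W\<close>, where the values of a linear
  extension are known to lie in the carrier.\<close>

lemma poly_induct_keys [consumes 1, case_names zero add single]: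
  assumes "Poly_Mapping.keys p \<subseteq> W" and "P 0"
    and "\<And>p q. \<lbrakk>Poly_Mapping.keys p \<subseteq> W; Poly_Mapping.keys q \<subseteq> W; P p; P q\<rbrakk> \<Longrightarrow> P (p + q)"
    and "\<And>w \<alpha>. w \<in> W \<Longrightarrow> P (Poly_Mapping.single w \<alpha>)"
  shows "P (p :: 'x nword \<Rightarrow>\<^sub>0 'k::field)"
proof -
  let ?s = "\<lambda>w. Poly_Mapping.single w (Poly_Mapping.lookup p w)"
  have "Poly_Mapping.keys (\<Sum>w\<in>F. ?s w) \<subseteq> W \<and> P (\<Sum>w\<in>F. ?s w)" if "finite F" "F \<subseteq> W" for F
    using that
  proof (induction F rule: finite_induct)
    case empty
    then show ?case using assms(2) by simp
  next
    case (insert w F)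
    then have "Poly_Mapping.keys (?s w) \<subseteq> W" "P (?s w)"
      using assms(4) by auto
    then show ?case
      using insert assms(3) by (simp add: keys_poly_add)
  qed
  from this[OF finite_keys assms(1)] show ?thesis
    using poly_sum_monomials[of p] by simp
qed

lemma (in nonassoc_algebra) prod_zero:
  assumes "a \<in> carrier V"
  shows "\<zero> \<otimes> a = \<zero>" "a \<otimes> \<zero> = \<zero>"
proof -
  have z: "\<zero>\<^bsub>K\<^esub> \<odot>\<^bsub>V\<^esub> \<zero> = \<zero>"
    by simp
  have c: "\<zero>\<^bsub>K\<^esub> \<in> carrier K" "\<zero> \<in> carrier V"
    by simp_all
  show "\<zero> \<otimes> a = \<zero>"
    using prod_smult_left[OF c assms] prod_closed[OF c(2) assms] z by simp
  show "a \<otimes> \<zero> = \<zero>"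
    using prod_smult_right[OF c(1) assms c(2)] prod_closed[OF assms c(2)] z by simp
qed

primrec word_eval :: "('k, 'v) module \<Rightarrow> ('x \<Rightarrow> 'v) \<Rightarrow> 'x nword \<Rightarrow> 'v" where
  "word_eval V f (Letter x) = f x"
| "word_eval V f (u \<diamondop> v) = word_eval V f u \<otimes>\<^bsub>V\<^esub> word_eval V f v"

locale letter_family =
  fixes V :: "('k::field, 'v) module" (structure) and X :: "'x set" and f :: "'x \<Rightarrow> 'v"
  assumes nonassoc_algebra: "nonassoc_algebra class_ring V"
    and f_closed: "x \<in> X \<Longrightarrow> f x \<in> carrier V"
begin

sublocale nonassoc_algebra class_ring V
  by (rule nonassoc_algebra)

lemma word_eval_closed: "w \<in> nwords X \<Longrightarrow> word_eval V f w \<in> carrier V"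
  by (induction w) (simp_all add: f_closed prod_closed)

sublocale word_family V "nwords X" "word_eval V f"
  by unfold_locales (simp_all add: word_eval_closed vectorspace_axioms)

abbreviation poly_eval :: "('x nword \<Rightarrow>\<^sub>0 'k) \<Rightarrow> 'v" where
  "poly_eval \<equiv> lin_ext V (word_eval V f)"

lemma prod_smult_smult:
  assumes "a \<in> carrier V" "b \<in> carrier V"
  shows "(\<alpha> \<odot>\<^bsub>V\<^esub> a) \<otimes> (\<beta> \<odot>\<^bsub>V\<^esub> b) = (\<alpha> * \<beta>) \<odot>\<^bsub>V\<^esub> (a \<otimes> b)"
  using assms prod_smult_left[of \<alpha> a "\<beta> \<odot>\<^bsub>V\<^esub> b"] prod_smult_right[of \<beta> a b]
    smult_assoc1[of \<alpha> \<beta> "a \<otimes> b"] prod_closed[of a b] by simp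

lemma poly_eval_mult:
  assumes p: "Poly_Mapping.keys p \<subseteq> nwords X" and q: "Poly_Mapping.keys q \<subseteq> nwords X"
  shows "poly_eval (p \<star> q) = poly_eval p \<otimes> poly_eval q"
  using p
proof (induction p rule: poly_induct_keys)
  case zero
  then show ?case
    by (simp add: lin_ext_0 prod_zero lin_ext_closed[OF q])
next
  case (add p p')
  then show ?case
    by (simp add: poly_mult_add_left lin_ext_add keys_poly_mult q prod_add_left lin_ext_closed)
next
  case (single u \<alpha>)
  note u = single
  show ?case
    using q
  proof (induction q rule: poly_induct_keys)
    case zero
    then show ?case
      using u by (simp add: lin_ext_0 prod_zero lin_ext_single word_eval_closed)
  next
    case (add q q')
    have "Poly_Mapping.keys (Poly_Mapping.single u \<alpha>) \<subseteq> nwords X"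
      using u by simp
    with add show ?case
      by (simp add: poly_mult_add_right lin_ext_add keys_poly_mult prod_add_right lin_ext_closed)
  next
    case (single v \<beta>)
    with u show ?case
      by (simp add: lin_ext_single prod_smult_smult word_eval_closed)
  qed
qed

lemma poly_eval_alg_hom: "poly_eval \<in> alg_hom class_ring (free_alg X) V"
  by (simp add: alg_hom_def LinearCombinations.module_hom_def lin_ext_closed lin_ext_add
      lin_ext_smult poly_eval_mult)

end

section \<open>Linear maps defined on a basis\<close>

lemma module_hom_zero:
  assumes "module K A" "module K B" "h \<in> LinearCombinations.module_hom K A B"
  shows "h \<zero>\<^bsub>A\<^esub> = \<zero>\<^bsub>B\<^esub>"
proof -
  interpret mod_hom K A B h
    using assms by (simp add: mod_hom_def mod_hom_axioms_def)
  show ?thesis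
    by (rule f0_is_0)
qed

lemma module_hom_eq_on_basis:
  fixes A :: "('k, 'a) module" and B :: "('k, 'b) module"
  assumes A: "vectorspace K A" and B: "vectorspace K B" and X: "vectorspace.basis K A X"
    and g: "g \<in> LinearCombinations.module_hom K A B" and h: "h \<in> LinearCombinations.module_hom K A B"
    and eq: "\<And>x. x \<in> X \<Longrightarrow> g x = h x" and a: "a \<in> carrier A"
  shows "g a = h a"
proof -
  interpret A: vectorspace K A by (rule A)
  interpret B: vectorspace K B by (rule B)
  have X: "A.span X = carrier A" "X \<subseteq> carrier A"
    using X by (simp_all add: A.basis_def)
  have mods: "module K A" "module K B" ..
  let ?N = "{a \<in> carrier A. g a = h a}"
  have "LinearCombinations.submodule K ?N A"
    unfolding LinearCombinations.submodule_def
    using mods module_hom_zero[OF mods g] module_hom_zero[OF mods h]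
      LinearCombinations.module_hom_add[OF g] LinearCombinations.module_hom_add[OF h]
      LinearCombinations.module_hom_smult[OF g] LinearCombinations.module_hom_smult[OF h]
    by auto
  then have "A.span X \<subseteq> ?N"
    using X eq by (intro A.span_is_subset) auto
  then show ?thesis
    using a X by auto
qed

text \<open>A coordinate vector of finite support is encoded as a polynomial in letters, so that
  \<open>lin_ext\<close> can be reused; on a letter, \<open>word_eval\<close> returns the basis
  vector. The values form a submodule containing \<open>X\<close>, which gives existence; a nonzero
  difference of two encodings would be a linear dependence.\<close>

lemma basis_coordinates:
  fixes A :: "('k::field, 'a) module"
  assumes A: "vectorspace class_ring A" and X: "vectorspace.basis class_ring A X" and a: "a \<in> carrier A"
  shows "\<exists>!p. Poly_Mapping.keys p \<subseteq> Letter ` X \<and> lin_ext A (word_eval A (\<lambda>x. x)) p = a"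
proof -
  interpret A: vectorspace class_ring A by (rule A)
  have X: "A.span X = carrier A" "X \<subseteq> carrier A" "A.lin_indpt X"
    using X by (simp_all add: A.basis_def)
  interpret E: word_family A "Letter ` X" "word_eval A (\<lambda>x. x)"
    by (rule word_family.intro[OF A]) (use X in auto)
  let ?E = "lin_ext A (word_eval A (\<lambda>x. x))"
  let ?N = "{?E p | p. Poly_Mapping.keys p \<subseteq> Letter ` X}"
  have sub: "LinearCombinations.submodule class_ring ?N A"
    unfolding LinearCombinations.submodule_def
  proof (intro conjI allI impI)
    show "module class_ring A" ..
    show "?N \<subseteq> carrier A"
      using E.lin_ext_closed by auto
    show "\<zero>\<^bsub>A\<^esub> \<in> ?N"
      using E.lin_ext_0 by (intro CollectI exI[of _ 0]) simp
    show "v \<oplus>\<^bsub>A\<^esub> w \<in> ?N" if vw: "v \<in> ?N" "w \<in> ?N" for v w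
    proof -
      obtain p q where pq: "Poly_Mapping.keys p \<subseteq> Letter ` X" "Poly_Mapping.keys q \<subseteq> Letter ` X"
        "v = ?E p" "w = ?E q"
        using vw by blast
      then have "v \<oplus>\<^bsub>A\<^esub> w = ?E (p + q)" "Poly_Mapping.keys (p + q) \<subseteq> Letter ` X"
        using E.lin_ext_add[OF pq(1,2)] keys_poly_add[OF pq(1,2)] by simp_all
      then show ?thesis
        by blast
    qed
    show "c \<odot>\<^bsub>A\<^esub> v \<in> ?N" if v: "v \<in> ?N" for c v
    proof -
      obtain p where p: "Poly_Mapping.keys p \<subseteq> Letter ` X" "v = ?E p"
        using v by blast
      then have "c \<odot>\<^bsub>A\<^esub> v = ?E (poly_smult c p)" "Poly_Mapping.keys (poly_smult c p) \<subseteq> Letter ` X"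
        using E.lin_ext_smult[OF p(1)] keys_poly_smult_subset[OF p(1)] by simp_all
      then show ?thesis
        by blast
    qed
  qed
  have XN: "X \<subseteq> ?N"
  proof
    fix x
    assume "x \<in> X"
    then have "?E (wmon (Letter x)) = x" "Poly_Mapping.keys (wmon (Letter x) :: 'a nword \<Rightarrow>\<^sub>0 'k) \<subseteq> Letter ` X"
      using E.lin_ext_wmon[of "Letter x"] by simp_all
    then show "x \<in> ?N"
      by (metis (mono_tags, lifting) mem_Collect_eq)
  qed
  have "carrier A \<subseteq> ?N"
    using A.span_is_subset[OF XN sub] X(1) by simp
  then have ex: "\<exists>p. Poly_Mapping.keys p \<subseteq> Letter ` X \<and> ?E p = a"
    using a by blast
  have "p = q" if p: "Poly_Mapping.keys p \<subseteq> Letter ` X" "?E p = a"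
    and q: "Poly_Mapping.keys q \<subseteq> Letter ` X" "?E q = a" for p q
  proof (rule ccontr)
    assume "p \<noteq> q"
    define d where "d = p + poly_smult (-1) q"
    have "d = p - q"
      by (rule poly_mapping_eqI) (simp add: d_def lookup_add lookup_minus)
    with \<open>p \<noteq> q\<close> have "d \<noteq> 0"
      by simp
    have d: "Poly_Mapping.keys d \<subseteq> Letter ` X"
      unfolding d_def using p q by (intro keys_poly_add keys_poly_smult_subset)
    have "?E d = a \<oplus>\<^bsub>A\<^esub> (-1) \<odot>\<^bsub>A\<^esub> a"
      unfolding d_def E.lin_ext_add[OF p(1) keys_poly_smult_subset[OF q(1)]] E.lin_ext_smult[OF q(1)]
        p(2) q(2) by (rule refl)
    also have "\<dots> = (1 + -1) \<odot>\<^bsub>A\<^esub> a"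
      using A.smult_l_distr[of 1 "-1" a] A.smult_one[of a] a by simp
    also have "\<dots> = \<zero>\<^bsub>A\<^esub>"
      using A.smult_l_null[of a] a by simp
    finally have E0: "?E d = \<zero>\<^bsub>A\<^esub>" .
    define F where "F = {x. Letter x \<in> Poly_Mapping.keys d}"
    have F: "Letter ` F = Poly_Mapping.keys d"
      using d by (auto simp: F_def)
    have inj: "inj_on Letter F"
      by (simp add: inj_on_def)
    have fin: "finite F"
      using finite_imageD[OF _ inj] F by simp
    have FX: "F \<subseteq> X"
      using d F by blast
    obtain w where "w \<in> Poly_Mapping.keys d"
      using \<open>d \<noteq> 0\<close> by (metis in_keys_iff lookup_zero poly_mapping_eqI)
    then obtain x where x: "x \<in> F"
      using F by blast
    have "A.lincomb (\<lambda>x. Poly_Mapping.lookup d (Letter x)) F = ?E d"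
    proof -
      have "(\<Oplus>\<^bsub>A\<^esub>w\<in>Letter ` F. Poly_Mapping.lookup d w \<odot>\<^bsub>A\<^esub> word_eval A (\<lambda>x. x) w) =
          (\<Oplus>\<^bsub>A\<^esub>x\<in>F. Poly_Mapping.lookup d (Letter x) \<odot>\<^bsub>A\<^esub> word_eval A (\<lambda>x. x) (Letter x))"
        using FX X inj by (intro A.add.finprod_reindex) auto
      then show ?thesis
        by (simp add: A.lincomb_def lin_ext_def F)
    qed
    then have "A.lin_dep X"
      using fin FX x E0 by (intro A.lin_dep_crit[of F X _ x]) (auto simp: F_def in_keys_iff)
    with X show False
      by simp
  qed
  with ex show ?thesis
    by blast
qed

lemma basis_extension:
  fixes A :: "('k::field, 'a) module" and B :: "('k, 'b) module"
  assumes A: "vectorspace class_ring A" and X: "vectorspace.basis class_ring A X"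
    and B: "vectorspace class_ring B" and f: "\<And>x. x \<in> X \<Longrightarrow> f x \<in> carrier B"
  shows "\<exists>j\<in>LinearCombinations.module_hom class_ring A B. \<forall>x\<in>X. j x = f x"
proof -
  interpret A: vectorspace class_ring A by (rule A)
  have XA: "X \<subseteq> carrier A"
    using X by (simp add: A.basis_def)
  interpret E: word_family A "Letter ` X" "word_eval A (\<lambda>x. x)"
    by (rule word_family.intro[OF A]) (use XA in auto)
  interpret F: word_family B "Letter ` X" "word_eval B f"
    by (rule word_family.intro[OF B]) (auto simp: f)
  let ?P = "\<lambda>a p. Poly_Mapping.keys p \<subseteq> Letter ` X \<and> lin_ext A (word_eval A (\<lambda>x. x)) p = a"
  define coord where "coord a = (THE p. ?P a p)" for a
  have coord: "?P a (coord a)" if "a \<in> carrier A" for a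
    unfolding coord_def by (rule theI'[OF basis_coordinates[OF A X that]])
  have coord_eq: "coord a = p" if "a \<in> carrier A" "?P a p" for a p
    unfolding coord_def by (rule the1_equality[OF basis_coordinates[OF A X that(1)] that(2)])
  define j where "j a = lin_ext B (word_eval B f) (coord a)" for a
  have "j \<in> LinearCombinations.module_hom class_ring A B"
    unfolding LinearCombinations.module_hom_def
  proof (intro CollectI conjI allI impI)
    show "j \<in> carrier A \<rightarrow> carrier B"
      using coord F.lin_ext_closed by (auto simp: j_def)
    fix a b
    assume "a \<in> carrier A \<and> b \<in> carrier A"
    then have ab: "?P a (coord a)" "?P b (coord b)" "a \<in> carrier A" "b \<in> carrier A"
      using coord by auto
    then have "coord (a \<oplus>\<^bsub>A\<^esub> b) = coord a + coord b"
      by (intro coord_eq) (auto simp: E.lin_ext_add keys_poly_add)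
    then show "j (a \<oplus>\<^bsub>A\<^esub> b) = j a \<oplus>\<^bsub>B\<^esub> j b"
      using ab by (simp add: j_def F.lin_ext_add)
  next
    fix c :: 'k and a
    assume "c \<in> carrier class_ring \<and> a \<in> carrier A"
    then have a: "?P a (coord a)" "a \<in> carrier A"
      using coord by auto
    then have "coord (c \<odot>\<^bsub>A\<^esub> a) = poly_smult c (coord a)"
      by (intro coord_eq) (auto simp: E.lin_ext_smult keys_poly_smult_subset)
    then show "j (c \<odot>\<^bsub>A\<^esub> a) = c \<odot>\<^bsub>B\<^esub> j a"
      using a by (simp add: j_def F.lin_ext_smult)
  qed
  moreover have "j x = f x" if "x \<in> X" for x
  proof -
    have "coord x = wmon (Letter x)"
      using that XA E.lin_ext_wmon[of "Letter x"] by (intro coord_eq) auto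
    then show ?thesis
      using that F.lin_ext_wmon[of "Letter x"] by (simp add: j_def)
  qed
  ultimately show ?thesis
    by blast
qed

section \<open>Generated ideals and kernels\<close>

lemma alg_ideal_genideal:
  assumes M: "nonassoc_algebra K M" and S: "S \<subseteq> carrier M"
  shows "alg_ideal K (alg_genideal K M S) M"
proof -
  interpret nonassoc_algebra K M by (rule M)
  have VM: "vectorspace K M" "module K M" ..
  \<comment> \<open>The carrier is one of the ideals being intersected, which keeps the intersection
    inside it.\<close>
  have "alg_ideal K (carrier M) M"
    using VM by (auto simp: alg_ideal_def VectorSpace.subspace_def LinearCombinations.submodule_def prod_closed)
  then have sub: "alg_genideal K M S \<subseteq> carrier M"
    using S unfolding alg_genideal_def by blast
  have J: "J \<subseteq> carrier M \<and> \<zero>\<^bsub>M\<^esub> \<in> J \<and> (\<forall>v w. v \<in> J \<longrightarrow> w \<in> J \<longrightarrow> v \<oplus>\<^bsub>M\<^esub> w \<in> J) \<and>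
      (\<forall>c v. c \<in> carrier K \<longrightarrow> v \<in> J \<longrightarrow> c \<odot>\<^bsub>M\<^esub> v \<in> J) \<and>
      (\<forall>a\<in>carrier M. \<forall>x\<in>J. a \<otimes>\<^bsub>M\<^esub> x \<in> J \<and> x \<otimes>\<^bsub>M\<^esub> a \<in> J)" if "alg_ideal K J M" for J
    using that by (simp add: alg_ideal_def VectorSpace.subspace_def LinearCombinations.submodule_def)
  show ?thesis
    unfolding alg_ideal_def VectorSpace.subspace_def LinearCombinations.submodule_def
    using VM sub J unfolding alg_genideal_def by (intro conjI; blast)
qed

lemma alg_genideal_superset: "S \<subseteq> alg_genideal K M S"
  by (auto simp: alg_genideal_def)

lemma alg_genideal_minimal: "\<lbrakk>alg_ideal K J M; S \<subseteq> J\<rbrakk> \<Longrightarrow> alg_genideal K M S \<subseteq> J"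
  by (auto simp: alg_genideal_def)

lemma alg_ideal_kernel:
  assumes M: "nonassoc_algebra K M" and Z: "nonassoc_algebra K Z" and h: "h \<in> alg_hom K M Z"
  shows "alg_ideal K {x \<in> carrier M. h x = \<zero>\<^bsub>Z\<^esub>} M"
proof -
  interpret M: nonassoc_algebra K M by (rule M)
  interpret Z: nonassoc_algebra K Z by (rule Z)
  have VM: "vectorspace K M" "module K M" "module K Z" ..
  have hom: "h \<in> LinearCombinations.module_hom K M Z"
    and mult: "\<And>x y. \<lbrakk>x \<in> carrier M; y \<in> carrier M\<rbrakk> \<Longrightarrow> h (x \<otimes>\<^bsub>M\<^esub> y) = h x \<otimes>\<^bsub>Z\<^esub> h y"
    using h by (simp_all add: alg_hom_def)
  have closed: "h x \<in> carrier Z" if "x \<in> carrier M" for x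
    using LinearCombinations.module_hom_closed[OF hom] that by auto
  show ?thesis
    unfolding alg_ideal_def VectorSpace.subspace_def LinearCombinations.submodule_def
    using VM module_hom_zero[OF VM(2,3) hom]
    by (auto simp: mult closed M.prod_closed Z.prod_zero LinearCombinations.module_hom_add[OF hom]
        LinearCombinations.module_hom_smult[OF hom])
qed

text \<open>Passes from submodules of the record \<open>free_alg X\<close> to subspaces of the type
  of all polynomials, for which \<open>poly_linear_in_subspace\<close> is stated.\<close>

lemma alg_ideal_free_alg_subspace:
  assumes "alg_ideal class_ring I (free_alg X :: ('k::field, 'x nword \<Rightarrow>\<^sub>0 'k) module)"
  shows "poly.subspace I"
  using assms
  by (simp add: alg_ideal_def VectorSpace.subspace_def LinearCombinations.submodule_def poly.subspace_def)

lemma alg_hom_eq_on_letters: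
  assumes Z: "nonassoc_algebra class_ring Z"
    and g: "g \<in> alg_hom class_ring (free_alg X :: ('k::field, 'x nword \<Rightarrow>\<^sub>0 'k) module) Z"
    and h: "h \<in> alg_hom class_ring (free_alg X) Z"
    and eq: "\<And>x. x \<in> X \<Longrightarrow> g (wmon (Letter x)) = h (wmon (Letter x))"
    and p: "Poly_Mapping.keys p \<subseteq> nwords X"
  shows "g p = h p"
proof -
  interpret Z: nonassoc_algebra class_ring Z by (rule Z)
  interpret M: nonassoc_algebra class_ring "free_alg X :: ('k, 'x nword \<Rightarrow>\<^sub>0 'k) module"
    by (rule nonassoc_algebra_free_alg)
  have mods: "module class_ring (free_alg X :: ('k, 'x nword \<Rightarrow>\<^sub>0 'k) module)" "module class_ring Z" ..
  have hom: "g \<in> LinearCombinations.module_hom class_ring (free_alg X) Z"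
    "h \<in> LinearCombinations.module_hom class_ring (free_alg X) Z"
    and mult: "\<And>p q. \<lbrakk>Poly_Mapping.keys p \<subseteq> nwords X; Poly_Mapping.keys q \<subseteq> nwords X\<rbrakk>
      \<Longrightarrow> g (p \<star> q) = g p \<otimes>\<^bsub>Z\<^esub> g q"
    "\<And>p q. \<lbrakk>Poly_Mapping.keys p \<subseteq> nwords X; Poly_Mapping.keys q \<subseteq> nwords X\<rbrakk>
      \<Longrightarrow> h (p \<star> q) = h p \<otimes>\<^bsub>Z\<^esub> h q"
    using g h by (simp_all add: alg_hom_def)
  have words: "g (wmon w) = h (wmon w)" if "w \<in> nwords X" for w
    using that
  proof (induction w)
    case (Letter x)
    then show ?case by (simp add: eq)
  next
    case (App u v)
    then show ?case
      using mult(1)[of "wmon u" "wmon v"] mult(2)[of "wmon u" "wmon v"] by simp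
  qed
  show ?thesis
    using p
  proof (induction p rule: poly_induct_keys)
    case zero
    then show ?case
      using module_hom_zero[OF mods hom(1)] module_hom_zero[OF mods hom(2)] by simp
  next
    case (add p q)
    then show ?case
      using LinearCombinations.module_hom_add[OF hom(1), of p q]
        LinearCombinations.module_hom_add[OF hom(2), of p q] by simp
  next
    case (single w \<alpha>)
    then show ?case
      using LinearCombinations.module_hom_smult[OF hom(1), of \<alpha> "wmon w"]
        LinearCombinations.module_hom_smult[OF hom(2), of \<alpha> "wmon w"] words[of w] by simp
  qed
qed

section \<open>The universal enveloping algebra\<close>

lemma zinbiel_is_nonassoc: "zinbiel_algebra K Z \<Longrightarrow> nonassoc_algebra K Z"
  by (rule zinbiel_algebra.axioms(1))

lemma plus_algebra_simps [simp]:
  "carrier (plus_algebra Z) = carrier Z" "add (plus_algebra Z) = add Z"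
  "zero (plus_algebra Z) = zero Z" "smult (plus_algebra Z) = smult Z"
  "mult (plus_algebra Z) a b = (a \<otimes>\<^bsub>Z\<^esub> b) \<oplus>\<^bsub>Z\<^esub> (b \<otimes>\<^bsub>Z\<^esub> a)"
  by (simp_all add: plus_algebra_def)

lemma alg_hom_plus_iff:
  "h \<in> alg_hom K A (plus_algebra Z) \<longleftrightarrow> h \<in> LinearCombinations.module_hom K A Z \<and>
    (\<forall>x\<in>carrier A. \<forall>y\<in>carrier A. h (x \<otimes>\<^bsub>A\<^esub> y) = (h x \<otimes>\<^bsub>Z\<^esub> h y) \<oplus>\<^bsub>Z\<^esub> (h y \<otimes>\<^bsub>Z\<^esub> h x))"
  by (simp add: alg_hom_def LinearCombinations.module_hom_def)

text \<open>The symmetrised product is linear in each argument, so it can be extended from the basis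
  in one argument and then, by symmetry, in the other. When \<open>A\<close> has zero
  multiplication, its vanishing is the multiplicative condition on a homomorphism to
  \<open>plus_algebra Z\<close>.\<close>

lemma symmetric_products_zero:
  fixes A :: "('k, 'a) module" and Z :: "('k, 'z) module"
  assumes A: "vectorspace K A" and X: "vectorspace.basis K A X" and Z: "nonassoc_algebra K Z"
    and h: "h \<in> LinearCombinations.module_hom K A Z"
    and zero: "\<And>x y. \<lbrakk>x \<in> X; y \<in> X\<rbrakk> \<Longrightarrow> (h x \<otimes>\<^bsub>Z\<^esub> h y) \<oplus>\<^bsub>Z\<^esub> (h y \<otimes>\<^bsub>Z\<^esub> h x) = \<zero>\<^bsub>Z\<^esub>"
    and ab: "a \<in> carrier A" "b \<in> carrier A"
  shows "(h a \<otimes>\<^bsub>Z\<^esub> h b) \<oplus>\<^bsub>Z\<^esub> (h b \<otimes>\<^bsub>Z\<^esub> h a) = \<zero>\<^bsub>Z\<^esub>"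
proof -
  interpret A: vectorspace K A by (rule A)
  interpret Z: nonassoc_algebra K Z by (rule Z)
  have VZ: "vectorspace K Z" ..
  have XA: "X \<subseteq> carrier A"
    using X by (simp add: A.basis_def)
  have closed: "h u \<in> carrier Z" if "u \<in> carrier A" for u
    using LinearCombinations.module_hom_closed[OF h] that by auto
  define s where "s u v = (h u \<otimes>\<^bsub>Z\<^esub> h v) \<oplus>\<^bsub>Z\<^esub> (h v \<otimes>\<^bsub>Z\<^esub> h u)" for u v
  have lin: "(\<lambda>u. s u v) \<in> LinearCombinations.module_hom K A Z" if v: "v \<in> carrier A" for v
    unfolding LinearCombinations.module_hom_def s_def
  proof (intro CollectI conjI allI impI)
    show "(\<lambda>u. (h u \<otimes>\<^bsub>Z\<^esub> h v) \<oplus>\<^bsub>Z\<^esub> (h v \<otimes>\<^bsub>Z\<^esub> h u)) \<in> carrier A \<rightarrow> carrier Z"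
      using v closed Z.prod_closed by auto
  next
    fix u w
    assume "u \<in> carrier A \<and> w \<in> carrier A"
    then have uw: "u \<in> carrier A" "w \<in> carrier A"
      by auto
    note c = closed[OF uw(1)] closed[OF uw(2)] closed[OF v]
    show "(h (u \<oplus>\<^bsub>A\<^esub> w) \<otimes>\<^bsub>Z\<^esub> h v) \<oplus>\<^bsub>Z\<^esub> (h v \<otimes>\<^bsub>Z\<^esub> h (u \<oplus>\<^bsub>A\<^esub> w)) =
        ((h u \<otimes>\<^bsub>Z\<^esub> h v) \<oplus>\<^bsub>Z\<^esub> (h v \<otimes>\<^bsub>Z\<^esub> h u)) \<oplus>\<^bsub>Z\<^esub> ((h w \<otimes>\<^bsub>Z\<^esub> h v) \<oplus>\<^bsub>Z\<^esub> (h v \<otimes>\<^bsub>Z\<^esub> h w))"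
      using c Z.prod_closed
      by (simp add: LinearCombinations.module_hom_add[OF h uw] Z.prod_add_left Z.prod_add_right Z.a_ac)
  next
    fix \<alpha> u
    assume "\<alpha> \<in> carrier K \<and> u \<in> carrier A"
    then have u: "\<alpha> \<in> carrier K" "u \<in> carrier A"
      by auto
    note c = closed[OF u(2)] closed[OF v]
    show "(h (\<alpha> \<odot>\<^bsub>A\<^esub> u) \<otimes>\<^bsub>Z\<^esub> h v) \<oplus>\<^bsub>Z\<^esub> (h v \<otimes>\<^bsub>Z\<^esub> h (\<alpha> \<odot>\<^bsub>A\<^esub> u)) =
        \<alpha> \<odot>\<^bsub>Z\<^esub> ((h u \<otimes>\<^bsub>Z\<^esub> h v) \<oplus>\<^bsub>Z\<^esub> (h v \<otimes>\<^bsub>Z\<^esub> h u))"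
      using c u Z.prod_closed
      by (simp add: LinearCombinations.module_hom_smult[OF h u] Z.prod_smult_left
          Z.prod_smult_right Z.smult_r_distr)
  qed
  have sym: "s u v = s v u" if "u \<in> carrier A" "v \<in> carrier A" for u v
    using that closed Z.prod_closed by (simp add: s_def Z.a_comm)
  have null: "(\<lambda>u. \<zero>\<^bsub>Z\<^esub>) \<in> LinearCombinations.module_hom K A Z"
    by (simp add: LinearCombinations.module_hom_def)
  have 1: "s u x = \<zero>\<^bsub>Z\<^esub>" if "u \<in> carrier A" "x \<in> X" for u x
    by (rule module_hom_eq_on_basis[OF A VZ X lin null])
      (use that XA zero in \<open>auto simp: s_def\<close>)
  have 2: "s x b = \<zero>\<^bsub>Z\<^esub>" if "x \<in> X" for x
    using 1[OF ab(2) that] sym[of x b] that XA ab by auto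
  have "s a b = \<zero>\<^bsub>Z\<^esub>"
    by (rule module_hom_eq_on_basis[OF A VZ X lin null])
      (use ab 2 in auto)
  then show ?thesis
    by (simp add: s_def)
qed

section \<open>Uniqueness of the universal envelope\<close>

lemma alg_hom_closed: "h \<in> alg_hom K A B \<Longrightarrow> x \<in> carrier A \<Longrightarrow> h x \<in> carrier B"
  by (auto simp: alg_hom_def LinearCombinations.module_hom_def)

lemma alg_hom_compose:
  "\<lbrakk>g \<in> alg_hom K A B; h \<in> alg_hom K B C\<rbrakk> \<Longrightarrow> (\<lambda>x. h (g x)) \<in> alg_hom K A C"
  by (auto simp: alg_hom_def LinearCombinations.module_hom_def Pi_def)

lemma alg_hom_restrict:
  assumes "nonassoc_algebra K A" "h \<in> alg_hom K A B"
  shows "restrict h (carrier A) \<in> alg_hom K A B \<inter> extensional (carrier A)"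
proof -
  interpret nonassoc_algebra K A by (rule assms(1))
  show ?thesis
    using assms(2) by (auto simp: alg_hom_def LinearCombinations.module_hom_def prod_closed)
qed

lemma alg_hom_ident: "(\<lambda>x. x) \<in> alg_hom K A A"
  by (auto simp: alg_hom_def LinearCombinations.module_hom_def)

text \<open>Both \<open>g\<close> and the identity factor \<open>i\<close> through itself.
  Uniqueness holds among extensional maps, so both are first restricted to the carrier.\<close>

lemma univ_envelope_endo:
  fixes U :: "('k, 'u) module"
  assumes U: "univ_envelope TYPE('u) K A U i" and g: "g \<in> alg_hom K U U"
    and gi: "\<And>a. a \<in> carrier A \<Longrightarrow> g (i a) = i a" and x: "x \<in> carrier U"
  shows "g x = x"
proof -
  have z: "zinbiel_algebra K U" and i: "i \<in> alg_hom K A (plus_algebra U)"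
    and ex1: "\<exists>!\<psi>. \<psi> \<in> alg_hom K U U \<inter> extensional (carrier U) \<and> (\<forall>a\<in>carrier A. i a = \<psi> (i a))"
    using U unfolding univ_envelope_def by blast+
  have ia: "i a \<in> carrier U" if "a \<in> carrier A" for a
    using alg_hom_closed[OF i that] by simp
  let ?P = "\<lambda>\<psi>. \<psi> \<in> alg_hom K U U \<inter> extensional (carrier U) \<and> (\<forall>a\<in>carrier A. i a = \<psi> (i a))"
  have "?P (restrict g (carrier U))" "?P (restrict (\<lambda>x. x) (carrier U))"
    using alg_hom_restrict[OF zinbiel_is_nonassoc[OF z] g]
      alg_hom_restrict[OF zinbiel_is_nonassoc[OF z] alg_hom_ident] gi ia by simp_all
  with ex1 have "restrict g (carrier U) = restrict (\<lambda>x. x) (carrier U)"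
    by blast
  then show ?thesis
    using x by (metis restrict_apply')
qed

text \<open>Each algebra is tested against both carrier types: the other type yields the map to the
  other algebra, its own type makes the composite the identity.\<close>

lemma univ_envelope_iso:
  fixes U :: "('k, 'u) module" and Q :: "('k, 'q) module"
  assumes U: "univ_envelope TYPE('u) K A U i" "univ_envelope TYPE('q) K A U i"
    and Q: "univ_envelope TYPE('u) K A Q j" "univ_envelope TYPE('q) K A Q j"
  shows "\<exists>\<theta>\<in>alg_hom K Q U. bij_betw \<theta> (carrier Q) (carrier U) \<and> (\<forall>a\<in>carrier A. \<theta> (j a) = i a)"
proof -
  have i: "zinbiel_algebra K U" "i \<in> alg_hom K A (plus_algebra U)"
    and j: "zinbiel_algebra K Q" "j \<in> alg_hom K A (plus_algebra Q)"
    using U(1) Q(1) by (simp_all add: univ_envelope_def)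
  obtain \<theta> where \<theta>: "\<theta> \<in> alg_hom K Q U" "\<And>a. a \<in> carrier A \<Longrightarrow> i a = \<theta> (j a)"
    using Q(1) i unfolding univ_envelope_def by blast
  obtain \<eta> where \<eta>: "\<eta> \<in> alg_hom K U Q" "\<And>a. a \<in> carrier A \<Longrightarrow> j a = \<eta> (i a)"
    using U(2) j unfolding univ_envelope_def by blast
  have "\<theta> (\<eta> x) = x" if "x \<in> carrier U" for x
    using univ_envelope_endo[OF U(1) alg_hom_compose[OF \<eta>(1) \<theta>(1)] _ that] \<theta>(2)[symmetric] \<eta>(2)[symmetric] by simp
  moreover have "\<eta> (\<theta> x) = x" if "x \<in> carrier Q" for x
    using univ_envelope_endo[OF Q(2) alg_hom_compose[OF \<theta>(1) \<eta>(1)] _ that] \<theta>(2)[symmetric] \<eta>(2)[symmetric] by simp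
  ultimately have "bij_betw \<theta> (carrier Q) (carrier U)"
    using alg_hom_closed[OF \<theta>(1)] alg_hom_closed[OF \<eta>(1)]
    by (intro bij_betwI[where g = \<eta>]) auto
  then show ?thesis
    using \<theta> by auto
qed

context ordered_letters
begin

section \<open>The quotient by the relations as universal envelope\<close>

abbreviation free :: "('k::field, 'x nword \<Rightarrow>\<^sub>0 'k) module" where
  "free \<equiv> free_alg X"

lemma relations_carrier: "(relations r X :: ('x nword \<Rightarrow>\<^sub>0 'k::field) set) \<subseteq> carrier free"
  using relation_homogeneous by fastforce

lemma rel_ideal: "alg_ideal class_ring (rel_ideal r X :: ('x nword \<Rightarrow>\<^sub>0 'k::field) set) free"
  by (rule alg_ideal_genideal[OF nonassoc_algebra_free_alg relations_carrier])

lemma relation_mem: "s \<in> relations r X \<Longrightarrow> (s :: 'x nword \<Rightarrow>\<^sub>0 'k::field) \<in> rel_ideal r X"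
  using alg_genideal_superset[of "relations r X"] by blast

interpretation quot: algebra_with_ideal class_ring "free :: ('k::field, 'x nword \<Rightarrow>\<^sub>0 'k) module"
  "rel_ideal r X"
  by (intro algebra_with_ideal.intro algebra_with_ideal_axioms.intro nonassoc_algebra_free_alg rel_ideal)

text \<open>(R1) speaks of monomials only; by linearity the arguments are extended to polynomials in
  turn, from the last to the first.\<close>

lemma zinbiel_mem_rel_ideal:
  fixes p q s :: "'x nword \<Rightarrow>\<^sub>0 'k::field"
  assumes "Poly_Mapping.keys p \<subseteq> nwords X" "Poly_Mapping.keys q \<subseteq> nwords X" "Poly_Mapping.keys s \<subseteq> nwords X"
  shows "p \<star> (q \<star> s) - p \<star> q \<star> s - q \<star> p \<star> s \<in> rel_ideal r X"
proof -
  note T = alg_ideal_free_alg_subspace[OF rel_ideal]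
  note lin = poly_mult_simps poly_mult_smult_left poly_mult_smult_right poly.scale_right_diff_distrib
  have 1: "wmon a \<star> (wmon b \<star> s) - wmon a \<star> wmon b \<star> s - wmon b \<star> wmon a \<star> s \<in> rel_ideal r X"
    if "a \<in> nwords X" "b \<in> nwords X" for a b
  proof (rule poly_linear_in_subspace[where p = s and T = "rel_ideal r X" and
        L = "\<lambda>s. wmon a \<star> (wmon b \<star> s) - wmon a \<star> wmon b \<star> s - wmon b \<star> wmon a \<star> s"])
    fix w
    assume "w \<in> Poly_Mapping.keys s"
    then have "(zinbiel_poly a b w :: 'x nword \<Rightarrow>\<^sub>0 'k) \<in> rel_ideal r X"
      using that assms by (intro relation_mem zinbiel_poly_relation) auto
    then show "wmon a \<star> (wmon b \<star> wmon w) - wmon a \<star> wmon b \<star> wmon w - wmon b \<star> wmon a \<star> wmon w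
        \<in> (rel_ideal r X :: ('x nword \<Rightarrow>\<^sub>0 'k) set)"
      by (simp add: zinbiel_poly_def)
  qed (auto intro!: poly_linearI T simp: lin)
  have 2: "wmon a \<star> (q \<star> s) - wmon a \<star> q \<star> s - q \<star> wmon a \<star> s \<in> rel_ideal r X"
    if "a \<in> nwords X" for a
    by (rule poly_linear_in_subspace[where p = q and T = "rel_ideal r X" and
        L = "\<lambda>q. wmon a \<star> (q \<star> s) - wmon a \<star> q \<star> s - q \<star> wmon a \<star> s"])
      (use 1 that assms in \<open>auto intro!: poly_linearI T simp: lin\<close>)
  show ?thesis
    by (rule poly_linear_in_subspace[where p = p and T = "rel_ideal r X" and
        L = "\<lambda>p. p \<star> (q \<star> s) - p \<star> q \<star> s - q \<star> p \<star> s"])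
      (use 2 assms in \<open>auto intro!: poly_linearI T simp: lin\<close>)
qed

lemma zinbiel_algebra_rel_quot:
  "zinbiel_algebra class_ring (rel_quot r X :: ('k::field, _) module)"
proof (intro zinbiel_algebra.intro zinbiel_algebra_axioms.intro quot.nonassoc_algebra_quot)
  fix a b c :: "('x nword \<Rightarrow>\<^sub>0 'k) set"
  assume "a \<in> carrier (rel_quot r X)" "b \<in> carrier (rel_quot r X)" "c \<in> carrier (rel_quot r X)"
  then obtain p q s where pqs: "Poly_Mapping.keys p \<subseteq> nwords X" "Poly_Mapping.keys q \<subseteq> nwords X"
    "Poly_Mapping.keys s \<subseteq> nwords X" and abc: "a = quot.proj p" "b = quot.proj q" "c = quot.proj s"
    by (auto simp: quot.quot_carrier)
  let ?z = "p \<star> q \<star> s + q \<star> p \<star> s"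
  have keys: "Poly_Mapping.keys (p \<star> (q \<star> s)) \<subseteq> nwords X" "Poly_Mapping.keys ?z \<subseteq> nwords X"
    using pqs by (simp_all add: keys_poly_mult keys_poly_add)
  have "p \<star> (q \<star> s) - ?z \<in> rel_ideal r X"
    using zinbiel_mem_rel_ideal[OF pqs] by (simp add: diff_diff_eq)
  moreover have "p \<star> (q \<star> s) = (p \<star> (q \<star> s) - ?z) \<oplus>\<^bsub>free\<^esub> ?z"
    by simp
  ultimately have "p \<star> (q \<star> s) \<in> quot.proj ?z"
    using quot.mem_proj by blast
  then have "quot.proj (p \<star> (q \<star> s)) = quot.proj ?z"
    using keys by (intro quot.proj_eqI) auto
  then show "a \<otimes>\<^bsub>rel_quot r X\<^esub> (b \<otimes>\<^bsub>rel_quot r X\<^esub> c) =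
      a \<otimes>\<^bsub>rel_quot r X\<^esub> b \<otimes>\<^bsub>rel_quot r X\<^esub> c \<oplus>\<^bsub>rel_quot r X\<^esub> b \<otimes>\<^bsub>rel_quot r X\<^esub> a \<otimes>\<^bsub>rel_quot r X\<^esub> c"
    using pqs by (simp add: abc keys_poly_mult quot.quot_mult quot.quot_add)
qed

text \<open>The kernel of the evaluation contains (R1) by the Zinbiel identity and all
  \<open>xy + yx\<close> by \<open>sym\<close>. The parity facts then give
  \<open>(ax)y + (ay)x\<close> for even \<open>a\<close>, and halving the diagonal cases gives (R2')
  and (R3').\<close>

lemma poly_eval_rel_ideal:
  fixes Z :: "('k::field, 'z) module" and p :: "'x nword \<Rightarrow>\<^sub>0 'k"
  assumes two: "(2::'k) \<noteq> 0" and Z: "zinbiel_algebra class_ring Z"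
    and f: "\<And>x. x \<in> X \<Longrightarrow> f x \<in> carrier Z"
    and sym: "\<And>x y. \<lbrakk>x \<in> X; y \<in> X\<rbrakk> \<Longrightarrow> (f x \<otimes>\<^bsub>Z\<^esub> f y) \<oplus>\<^bsub>Z\<^esub> (f y \<otimes>\<^bsub>Z\<^esub> f x) = \<zero>\<^bsub>Z\<^esub>"
    and p: "p \<in> rel_ideal r X"
  shows "lin_ext Z (word_eval Z f) p = \<zero>\<^bsub>Z\<^esub>"
proof -
  interpret Z: zinbiel_algebra class_ring Z by (rule Z)
  interpret E: letter_family Z X f
    by (rule letter_family.intro[OF zinbiel_is_nonassoc[OF Z]]) (rule f)
  define N where "N = {p \<in> carrier (free :: ('k, 'x nword \<Rightarrow>\<^sub>0 'k) module). E.poly_eval p = \<zero>\<^bsub>Z\<^esub>}"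
  have N: "alg_ideal class_ring N free"
    unfolding N_def
    by (rule alg_ideal_kernel[OF nonassoc_algebra_free_alg zinbiel_is_nonassoc[OF Z] E.poly_eval_alg_hom])
  note T = alg_ideal_free_alg_subspace[OF N]
  have mult: "p \<star> wmon v \<in> N" "wmon v \<star> p \<in> N" if "p \<in> N" "v \<in> nwords X" for p v
    using N that by (simp_all add: alg_ideal_def)
  have memI: "p \<in> N" if "Poly_Mapping.keys p \<subseteq> nwords X" "E.poly_eval p = \<zero>\<^bsub>Z\<^esub>" for p
    using that by (simp add: N_def)
  have wmon_keys: "Poly_Mapping.keys (wmon w :: 'x nword \<Rightarrow>\<^sub>0 'k) \<subseteq> nwords X" if "w \<in> nwords X" for w
    using that by simp
  \<comment> \<open>The kernel is closed under products with words of any length, so it can stand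
    for every degree at once.\<close>
  interpret graded_zinbiel_ideal X "\<lambda>_. N"
  proof
    show "poly.subspace N"
      by (rule T)
    show "p \<star> wmon v \<in> N" "wmon v \<star> p \<in> N" if "p \<in> N" "v \<in> nwords X" for p v
      using mult that by auto
    show "zinbiel_poly a b c \<in> N" if abc: "a \<in> nwords X" "b \<in> nwords X" "c \<in> nwords X" for a b c
    proof -
      have keys: "Poly_Mapping.keys (wmon (a \<diamondop> b \<diamondop> c) + wmon (b \<diamondop> a \<diamondop> c) :: 'x nword \<Rightarrow>\<^sub>0 'k) \<subseteq> nwords X"
        using abc by (intro keys_poly_add) auto
      have "(zinbiel_poly a b c :: 'x nword \<Rightarrow>\<^sub>0 'k) = wmon (a \<diamondop> (b \<diamondop> c)) +
          poly_smult (-1) (wmon (a \<diamondop> b \<diamondop> c) + wmon (b \<diamondop> a \<diamondop> c))"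
        unfolding poly.scale_minus_left by (simp add: zinbiel_poly_def)
      moreover have "E.poly_eval (wmon (a \<diamondop> (b \<diamondop> c)) + poly_smult (-1) (wmon (a \<diamondop> b \<diamondop> c) + wmon (b \<diamondop> a \<diamondop> c))) =
          E.poly_eval (wmon (a \<diamondop> (b \<diamondop> c))) \<oplus>\<^bsub>Z\<^esub> (-1) \<odot>\<^bsub>Z\<^esub> E.poly_eval (wmon (a \<diamondop> b \<diamondop> c) + wmon (b \<diamondop> a \<diamondop> c))"
        using abc keys by (subst E.lin_ext_add) (simp_all add: E.lin_ext_smult keys_poly_smult_subset
            del: poly.scale_minus_left poly_smult_single)
      moreover have "E.poly_eval (wmon (a \<diamondop> b \<diamondop> c) + wmon (b \<diamondop> a \<diamondop> c)) = E.poly_eval (wmon (a \<diamondop> (b \<diamondop> c)))"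
        using abc by (simp add: E.lin_ext_add E.lin_ext_wmon Z.zinbiel E.word_eval_closed)
      moreover have "v \<oplus>\<^bsub>Z\<^esub> (-1) \<odot>\<^bsub>Z\<^esub> v = \<zero>\<^bsub>Z\<^esub>" if "v \<in> carrier Z" for v
        using Z.smult_l_distr[of 1 "-1" v] Z.smult_one[of v] Z.smult_l_null[of v] that by simp
      ultimately have "E.poly_eval (zinbiel_poly a b c) = \<zero>\<^bsub>Z\<^esub>"
        using abc by (simp add: E.lin_ext_closed)
      moreover have "Poly_Mapping.keys (zinbiel_poly a b c :: 'x nword \<Rightarrow>\<^sub>0 'k) \<subseteq> nwords X"
        using relation_homogeneous[OF zinbiel_poly_relation[OF abc]] by blast
      ultimately show ?thesis
        by (intro memI)
    qed
    show "wmon (Letter x \<diamondop> Letter y) + wmon (Letter y \<diamondop> Letter x) \<in> N" if "x \<in> X" "y \<in> X" for x y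
      using that by (intro memI keys_poly_add) (simp_all add: E.lin_ext_add E.lin_ext_wmon sym)
  qed
  \<comment> \<open>Here characteristic 2 is excluded: for \<open>x = y\<close> the symmetric sums
    are twice the relation.\<close>
  have half: "p \<in> N" if "p + p \<in> N" for p :: "'x nword \<Rightarrow>\<^sub>0 'k"
  proof -
    have "poly_smult (1 / 2) (p + p) = p"
      using two by (intro poly_mapping_eqI) (simp add: lookup_add)
    then show ?thesis
      using poly.subspace_scale[OF T that, of "1 / 2"] by simp
  qed
  have "relations r X \<subseteq> N"
  proof
    fix s :: "'x nword \<Rightarrow>\<^sub>0 'k"
    assume "s \<in> relations r X"
    then consider (zinbiel) a b c where "s = zinbiel_poly a b c" "a \<in> nwords X" "b \<in> nwords X" "c \<in> nwords X"
      | (alt2) x y where "s = alt_poly2 x y" "x \<in> X" "y \<in> X"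
      | (alt3) a x y where "s = alt_poly3 a x y" "a \<in> nwords X" "even (wlen a)" "x \<in> X" "y \<in> X"
      by (rule relations_cases)
    then show "s \<in> N"
    proof cases
      case zinbiel
      from zinbiel_poly[OF zinbiel(2-4)] show ?thesis
        unfolding zinbiel(1) .
    next
      case alt2
      note sum = anticomm[OF alt2(2,3)]
      show ?thesis
      proof (cases "x = y")
        case True
        with sum half[of "wmon (Letter x \<diamondop> Letter x)"] show ?thesis
          by (simp add: alt2(1) alt_poly2_def)
      next
        case False
        with sum show ?thesis
          by (simp add: alt2(1) alt_poly2_def)
      qed
    next
      case alt3
      then have sum: "wmon (a \<diamondop> Letter x \<diamondop> Letter y) + wmon (a \<diamondop> Letter y \<diamondop> Letter x) \<in> N"
        by (intro even_odd_odd_mem) simp_all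
      show ?thesis
      proof (cases "x = y")
        case True
        with sum half[of "wmon (a \<diamondop> Letter x \<diamondop> Letter x)"] show ?thesis
          by (simp add: alt3(1) alt_poly3_def)
      next
        case False
        with sum show ?thesis
          by (simp add: alt3(1) alt_poly3_def)
      qed
    qed
  qed
  from alg_genideal_minimal[OF N this] p show ?thesis
    by (auto simp: N_def)
qed

text \<open>Since \<open>A\<close> has zero product, symmetrised products of classes must vanish. On
  \<open>X\<close> this follows from \<open>anticomm_mem\<close> in every characteristic, and
  bilinearity does the rest.\<close>

lemma gen_class_alg_hom:
  fixes A :: "('k::field, 'x) module"
  assumes A: "nonassoc_algebra class_ring A"
    and A0: "\<And>a b. \<lbrakk>a \<in> carrier A; b \<in> carrier A\<rbrakk> \<Longrightarrow> a \<otimes>\<^bsub>A\<^esub> b = \<zero>\<^bsub>A\<^esub>"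
    and X: "vectorspace.basis class_ring A X"
    and j: "j \<in> LinearCombinations.module_hom class_ring A (rel_quot r X)" "\<And>x. x \<in> X \<Longrightarrow> j x = gen_class r X x"
  shows "j \<in> alg_hom class_ring A (plus_algebra (rel_quot r X))"
proof -
  interpret A: nonassoc_algebra class_ring A by (rule A)
  note Q = quot.nonassoc_algebra_quot
  interpret Q: nonassoc_algebra class_ring "rel_quot r X :: ('k, ('x nword \<Rightarrow>\<^sub>0 'k) set) module"
    by (rule Q)
  have VA: "vectorspace class_ring A" "module class_ring A"
    "module class_ring (rel_quot r X :: ('k, ('x nword \<Rightarrow>\<^sub>0 'k) set) module)" ..
  have "(j x \<otimes>\<^bsub>rel_quot r X\<^esub> j y) \<oplus>\<^bsub>rel_quot r X\<^esub> (j y \<otimes>\<^bsub>rel_quot r X\<^esub> j x) = \<zero>\<^bsub>rel_quot r X\<^esub>"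
    if xy: "x \<in> X" "y \<in> X" for x y
  proof -
    let ?p = "wmon (Letter x \<diamondop> Letter y) + wmon (Letter y \<diamondop> Letter x) :: 'x nword \<Rightarrow>\<^sub>0 'k"
    have "(j x \<otimes>\<^bsub>rel_quot r X\<^esub> j y) \<oplus>\<^bsub>rel_quot r X\<^esub> (j y \<otimes>\<^bsub>rel_quot r X\<^esub> j x) = quot.proj ?p"
      using xy by (simp add: j(2) quot.quot_mult quot.quot_add)
    moreover have "?p \<in> rel_ideal r X"
      using xy by (intro anticomm_mem alg_ideal_free_alg_subspace[OF rel_ideal] relation_mem alt_poly2_relation)
    then have "?p \<in> quot.proj 0"
      by (auto simp: quot.mem_proj)
    then have "quot.proj ?p = quot.proj 0"
      by (intro quot.proj_eqI) simp_all
    ultimately show ?thesis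
      by (simp add: quot.quot_zero)
  qed
  then show ?thesis
    unfolding alg_hom_plus_iff
    using symmetric_products_zero[OF VA(1) X Q j(1)] j(1) A0 module_hom_zero[OF VA(2,3) j(1)]
    by simp
qed

text \<open>Existence: evaluating letters by \<open>\<phi>\<close> kills the ideal and so factors
  through the quotient; the factor after \<open>j\<close> agrees with \<open>\<phi>\<close> on the
  basis. Uniqueness: the classes of the letters generate the quotient.\<close>

lemma univ_envelope_rel_quot:
  fixes A :: "('k::field, 'x) module"
  assumes two: "(2::'k) \<noteq> 0" and A: "nonassoc_algebra class_ring A"
    and A0: "\<And>a b. \<lbrakk>a \<in> carrier A; b \<in> carrier A\<rbrakk> \<Longrightarrow> a \<otimes>\<^bsub>A\<^esub> b = \<zero>\<^bsub>A\<^esub>"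
    and X: "vectorspace.basis class_ring A X"
    and j: "j \<in> LinearCombinations.module_hom class_ring A (rel_quot r X)" "\<And>x. x \<in> X \<Longrightarrow> j x = gen_class r X x"
  shows "univ_envelope TYPE('z) class_ring A (rel_quot r X) j"
  unfolding univ_envelope_def
proof (intro conjI allI impI zinbiel_algebra_rel_quot gen_class_alg_hom[OF A A0 X j])
  let ?Q = "rel_quot r X :: ('k, ('x nword \<Rightarrow>\<^sub>0 'k) set) module"
  fix Z :: "('k, 'z) module" and \<phi>
  assume "zinbiel_algebra class_ring Z \<and> \<phi> \<in> alg_hom class_ring A (plus_algebra Z)"
  then have Z: "zinbiel_algebra class_ring Z"
    and \<phi>: "\<phi> \<in> LinearCombinations.module_hom class_ring A Z"
      "\<And>a b. \<lbrakk>a \<in> carrier A; b \<in> carrier A\<rbrakk>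
        \<Longrightarrow> \<phi> (a \<otimes>\<^bsub>A\<^esub> b) = (\<phi> a \<otimes>\<^bsub>Z\<^esub> \<phi> b) \<oplus>\<^bsub>Z\<^esub> (\<phi> b \<otimes>\<^bsub>Z\<^esub> \<phi> a)"
    by (auto simp: alg_hom_plus_iff)
  note ZN = zinbiel_is_nonassoc[OF Z]
  interpret A: nonassoc_algebra class_ring A by (rule A)
  interpret Z: nonassoc_algebra class_ring Z by (rule ZN)
  have V: "vectorspace class_ring A" "vectorspace class_ring Z" "module class_ring A" "module class_ring Z" ..
  have XA: "X \<subseteq> carrier A"
    using X by (simp add: A.basis_def)
  have \<phi>X: "\<phi> x \<in> carrier Z" if "x \<in> X" for x
    using LinearCombinations.module_hom_closed[OF \<phi>(1)] that XA by auto
  interpret E: letter_family Z X \<phi>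
    by (rule letter_family.intro[OF ZN]) (rule \<phi>X)
  \<comment> \<open>As \<open>xy = 0\<close> in \<open>A\<close>, the homomorphism law for
    \<open>\<phi>\<close> becomes the vanishing of the symmetrised product.\<close>
  have sym: "(\<phi> x \<otimes>\<^bsub>Z\<^esub> \<phi> y) \<oplus>\<^bsub>Z\<^esub> (\<phi> y \<otimes>\<^bsub>Z\<^esub> \<phi> x) = \<zero>\<^bsub>Z\<^esub>" if "x \<in> X" "y \<in> X" for x y
    using \<phi>(2)[OF subsetD[OF XA] subsetD[OF XA], OF that] A0[OF subsetD[OF XA] subsetD[OF XA], OF that]
      module_hom_zero[OF V(3,4) \<phi>(1)] by simp
  have "\<exists>\<theta>\<in>alg_hom class_ring ?Q Z \<inter> extensional (carrier ?Q).
      \<forall>p\<in>carrier free. \<theta> (quot.proj p) = E.poly_eval p"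
    by (rule quot.quot_hom_factor[OF E.poly_eval_alg_hom ZN])
      (rule poly_eval_rel_ideal[OF two Z \<phi>X sym])
  then obtain \<theta> where \<theta>: "\<theta> \<in> alg_hom class_ring ?Q Z" "\<theta> \<in> extensional (carrier ?Q)"
    "\<And>p. Poly_Mapping.keys p \<subseteq> nwords X \<Longrightarrow> \<theta> (quot.proj p) = E.poly_eval p"
    by auto
  have comp: "(\<lambda>a. \<theta> (j a)) \<in> LinearCombinations.module_hom class_ring A Z"
    using j(1) \<theta>(1) by (auto simp: alg_hom_def LinearCombinations.module_hom_def Pi_def)
  have "\<phi> a = \<theta> (j a)" if "a \<in> carrier A" for a
    by (rule module_hom_eq_on_basis[OF V(1,2) X \<phi>(1) comp _ that])
      (simp add: j(2) \<theta>(3) E.lin_ext_wmon)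
  moreover have "\<psi> = \<theta>" if \<psi>: "\<psi> \<in> alg_hom class_ring ?Q Z" "\<psi> \<in> extensional (carrier ?Q)"
    "\<forall>a\<in>carrier A. \<phi> a = \<psi> (j a)" for \<psi>
  proof (rule extensionalityI[OF \<psi>(2) \<theta>(2)])
    fix C
    assume "C \<in> carrier ?Q"
    then obtain p where p: "Poly_Mapping.keys p \<subseteq> nwords X" "C = quot.proj p"
      by (auto simp: quot.quot_carrier)
    have "\<psi> (quot.proj (wmon (Letter x))) = \<theta> (quot.proj (wmon (Letter x)))" if "x \<in> X" for x
      using \<psi>(3) j(2)[OF that] that XA by (auto simp: \<theta>(3) E.lin_ext_wmon)
    then show "\<psi> C = \<theta> C"
      unfolding p(2)
      by (intro alg_hom_eq_on_letters[OF ZN alg_hom_compose[OF quot.proj_alg_hom \<psi>(1)]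
            alg_hom_compose[OF quot.proj_alg_hom \<theta>(1)] _ p(1)])
  qed
  ultimately show "\<exists>!\<psi>. \<psi> \<in> alg_hom class_ring ?Q Z \<inter> extensional (carrier ?Q) \<and>
      (\<forall>a\<in>carrier A. \<phi> a = \<psi> (j a))"
    using \<theta>(1,2) by blast
qed

lemma gen_class_extension:
  fixes A :: "('k::field, 'x) module"
  assumes A: "nonassoc_algebra class_ring A" and X: "vectorspace.basis class_ring A X"
  shows "\<exists>j\<in>LinearCombinations.module_hom class_ring A (rel_quot r X). \<forall>x\<in>X. j x = gen_class r X x"
proof (rule basis_extension)
  show "vectorspace class_ring A"
    by (rule nonassoc_algebra.axioms(1)[OF A])
  show "vectorspace class_ring (rel_quot r X :: ('k, ('x nword \<Rightarrow>\<^sub>0 'k) set) module)"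
    by (rule nonassoc_algebra.axioms(1)[OF quot.nonassoc_algebra_quot])
  show "gen_class r X x \<in> carrier (rel_quot r X :: ('k, ('x nword \<Rightarrow>\<^sub>0 'k) set) module)" if "x \<in> X" for x
    using that by (auto simp: quot.quot_carrier)
qed (rule X)

end

theorem theorem4p1:
  fixes A :: "('k::field, 'a) module"
    and X :: "'a set"
    and r :: "'a rel"
  assumes "nonassoc_algebra class_ring A"
    and "\<forall>a\<in>carrier A. \<forall>b\<in>carrier A. a \<otimes>\<^bsub>A\<^esub> b = \<zero>\<^bsub>A\<^esub>"
    and "vectorspace.basis class_ring A X"
    and "well_order_on X r"
  shows "GS_basis r X (relations r X :: ('a nword \<Rightarrow>\<^sub>0 'k) set) \<and>
    ((2::'k) \<noteq> 0 \<longrightarrow>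
      (\<exists>j. (\<forall>x\<in>X. j x = gen_class r X x) \<and>
           univ_envelope TYPE('z) class_ring A (rel_quot r X) j) \<and>
      (\<forall>(U :: ('k, 'u) module) i.
         univ_envelope TYPE('u) class_ring A U i \<and>
         univ_envelope TYPE(('a nword \<Rightarrow>\<^sub>0 'k) set) class_ring A U i \<longrightarrow>
         (\<exists>\<theta> \<in> alg_hom class_ring (rel_quot r X) U.
            bij_betw \<theta> (carrier (rel_quot r X)) (carrier U) \<and>
            (\<forall>x\<in>X. \<theta> (gen_class r X x) = i x))))"
proof -
  interpret ordered_letters r X
    using assms(4) by unfold_locales
  interpret A: nonassoc_algebra class_ring A
    by (rule assms(1))
  have XA: "X \<subseteq> carrier A"
    using assms(3) by (simp add: A.basis_def)
  have A0: "a \<otimes>\<^bsub>A\<^esub> b = \<zero>\<^bsub>A\<^esub>" if "a \<in> carrier A" "b \<in> carrier A" for a b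
    using assms(2) that by blast
  obtain j where j: "j \<in> LinearCombinations.module_hom class_ring A (rel_quot r X)"
    "\<And>x. x \<in> X \<Longrightarrow> j x = gen_class r X x"
    using gen_class_extension[OF assms(1,3)] by blast
  \<comment> \<open>The carrier type of the test algebras stays open here; it is instantiated by
    \<open>'z\<close>, by the type of \<open>U\<close> and by that of the quotient.\<close>
  note envelope = univ_envelope_rel_quot[OF _ assms(1) A0 assms(3) j]
  show ?thesis
  proof (intro conjI impI allI)
    show "GS_basis r X (relations r X :: ('a nword \<Rightarrow>\<^sub>0 'k) set)"
      by (rule GS_basis_relations)
    assume two: "(2::'k) \<noteq> 0"
    show "\<exists>j. (\<forall>x\<in>X. j x = gen_class r X x) \<and> univ_envelope TYPE('z) class_ring A (rel_quot r X) j"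
      using j(2) envelope[OF two] by blast
    fix U :: "('k, 'u) module" and i
    assume "univ_envelope TYPE('u) class_ring A U i \<and>
      univ_envelope TYPE(('a nword \<Rightarrow>\<^sub>0 'k) set) class_ring A U i"
    then obtain \<theta> where \<theta>: "\<theta> \<in> alg_hom class_ring (rel_quot r X) U"
      "bij_betw \<theta> (carrier (rel_quot r X)) (carrier U)" "\<forall>a\<in>carrier A. \<theta> (j a) = i a"
      using univ_envelope_iso[OF _ _ envelope[OF two] envelope[OF two]] by blast
    have "\<theta> (gen_class r X x) = i x" if "x \<in> X" for x
    proof -
      have "\<theta> (j x) = i x"
        using \<theta>(3) XA that by blast
      then show ?thesis
        unfolding j(2)[OF that] .
    qed
    with \<theta>(1,2) show "\<exists>\<theta> \<in> alg_hom class_ring (rel_quot r X) U.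
        bij_betw \<theta> (carrier (rel_quot r X)) (carrier U) \<and> (\<forall>x\<in>X. \<theta> (gen_class r X x) = i x)"
      by blast
  qed
qed

end
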